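(* Let $\mathcal A$ be an essential arrangement of $d$ lines in $\mathbb P^2_k$, $L$ a line with $L\notin\mathcal A$, and $\mathcal A''=\mathcal A|_L$. If $d$ is odd, then $L\in j_{\mathcal D}$ if and only if either $\frac{d-1}{2}\ge|\mathcal A''|$ or $\det\alpha_L=0$, where $$\alpha_L:\ H^0\!\left(\mathcal O_L\!\left(|\mathcal A''|-\tfrac{d+3}{2}\right)\right)\longrightarrow H^1\!\left(\mathcal O_L\!\left(\tfrac{d-1}{2}-|\mathcal A''|\right)\right).$$ If $d$ is even, then $L\in j_{\mathcal D}$ if and only if either $\frac{d-2}{2}\ge|\mathcal A''|$ or $\mathrm{rank}\,\alpha_L\le|\mathcal A''|-\frac{d+4}{2}$, where $$\alpha_L:\ H^0\!\left(\mathcal O_L\!\left(|\mathcal A''|-\tfrac{d+4}{2}\right)\right)\longrightarrow H^1\!\left(\mathcal O_L\!\left(\tfrac{d-2}{2}-|\mathcal A''|\right)\right).$$ Here $\alpha_L$ is the connecting homomorphism described in the context.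
   Context: $k$ is a field of characteristic $0$, $R=k[x_0,x_1,x_2]$. An arrangement $\mathcal A$ of $d$ lines in $\mathbb P^2_k$ is a set of $d$ distinct lines, with defining polynomial $Q\in R_d$ the product of the $d$ linear forms; it is essential if the lines do not all pass through one point. $D(\mathcal A)=\{\theta\in\mathrm{Der}_k(R):\theta(Q)\in\langle Q\rangle\}$, graded by $\deg(\sum f_i\,\partial/\partial x_i)=\deg f_i$, and $\theta_E=\sum x_i\,\partial/\partial x_i$. $D(\mathcal A)=D_0\oplus R\theta_E$ with $D_0=\{\theta:\theta(Q)=0\}$, and $\mathcal D=\mathcal D_{\mathcal A}$ is the sheaf on $\mathbb P^2$ associated to $D_0\cong D(\mathcal A)/R\theta_E$; it is a rank two bundle with $c_1(\mathcal D)=-(d-1)$. For a line $L\notin\mathcal A$, $\mathcal A''=\mathcal A|_L$ is the set of distinct points in which the lines of $\mathcal A$ meet $L$. Normalization: for a rank two bundle $\mathcal F$ on $\mathbb P^2$, $\mathcal F_{norm}=\mathcal F(k_{\mathcal F})$ with $k_{\mathcal F}=-c_1(\mathcal F)/2$ if $c_1(\mathcal F)$ is even and $k_{\mathcal F}=-(c_1(\mathcal F)+1)/2$ if $c_1(\mathcal F)$ is odd. Thus $k_{\mathcal D}=\frac{d-1}{2}$ for $d$ odd and $k_{\mathcal D}=\frac{d-2}{2}$ for $d$ even. Jump lines: $j_{\mathcal D}$ is the set of lines $L\subset\mathbb P^2$ with $H^0(\mathcal D_{norm}(-1)|_L)\neq0$. The map $\alpha_L$: put $\mathcal B=\mathcal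 A\cup\{L\}$, let $i:L\hookrightarrow\mathbb P^2$ be the inclusion, let $\alpha$ be the linear form of $L$, and $S=R/\alpha$. Multiplication by $\alpha$ gives $D(\mathcal A)(-1)\to D(\mathcal B)$ and restriction of derivations modulo $\alpha$ gives $D(\mathcal B)\to D(\mathcal A'')$, where $D(\mathcal A'')\subseteq\mathrm{Der}_k(S)$ is the module of derivations $\theta$ with $\theta(Q'')\in\langle Q''\rangle$, $Q''\in S$ being the product of the linear forms of the points of $\mathcal A''$. Dividing by Euler derivations and sheafifying, one gets an exact sequence $0\to\mathcal D_{\mathcal A}(-1)\to\mathcal D_{\mathcal B}\to i_*\mathcal D''\to0$ with $\mathcal D''\simeq\mathcal O_L(1-|\mathcal A''|)$. Restricting to $L$ gives $$0\to\mathcal Tor_1(i_*\mathcal D'',\mathcal O_L)\to\mathcal D_{\mathcal A}(-1)|_L\to\mathcal D_{\mathcal B}|_L\to i_*\mathcal D''|_L\to0 .$$ Taking the short exact sequence formed by the $\mathcal Tor_1$ term, $\mathcal D_{\mathcal A}(-1)|_L$, and the image of the latter in $\mathcal D_{\mathcal B}|_L$, and twisting by $k_{\mathcal D}$, yields exact sequences on $L\simeq\mathbb P^1$ $$0\to\mathcal O_L\!\left(\tfrac{d-1}{2}-|\mathcal A''|\right)\to\mathcal D_{norm}(-1)|_L\to\mathcal O_L\!\left(|\mathcal A''|-\tfrac{d+3}{2}\right)\to0\quad(d\text{ odd}),$$ $$0\to\mathcal O_L\!\left(\tfrac{d-2}{2}-|\mathcal A''|\right)\to\mathcal D_{norm}(-1)|_L\to\mathcal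 O_L\!\left(|\mathcal A''|-\tfrac{d+4}{2}\right)\to0\quad(d\text{ even}),$$ and $\alpha_L$ is the connecting homomorphism of the long exact cohomology sequence. For $d$ odd and $|\mathcal A''|\ge\frac{d+1}{2}$ its source and target have equal dimension, so the vanishing of $\det\alpha_L$ makes sense (the determinant of the map between zero spaces being $1$). *)

theory Defs
  imports
    "HOL-Analysis.Cartesian_Space"
    "HOL-Library.Poly_Mapping"
    "HOL-Library.Set_Algebras"
    "HOL-Computational_Algebra.Fraction_Field"
    "Jordan_Normal_Form.VS_Connect"
    "Jordan_Normal_Form.Determinant"
begin

no_notation vec_index (infixl "$" 100)

section \<open>Linear algebra over the ground field\<close>

text \<open>A subquotient \<open>V / W\<close> of a \<open>k\<close>-vector space (with scalar multiplication \<open>sc\<close>) is the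
  vector space whose elements are the cosets of \<open>W\<close>; sets of vectors are added elementwise.
  The ring-multiplication fields of the record are irrelevant.\<close>

definition quot_space ::
  "('k \<Rightarrow> 'v \<Rightarrow> 'v) \<Rightarrow> 'v::ab_group_add set \<Rightarrow> 'v set \<Rightarrow> ('k, 'v set) module" where
  "quot_space sc V W =
    \<lparr>carrier = (\<lambda>x. x +o W) ` V, mult = undefined, one = undefined,
     zero = W, add = (+), smult = (\<lambda>c X. sc c ` X + W)\<rparr>"

definition map_rank ::
  "('k::field, 'v) module \<Rightarrow> ('k, 'w) module \<Rightarrow> ('v \<Rightarrow> 'w) \<Rightarrow> nat" where
  "map_rank V W T = vectorspace.dim class_ring (W\<lparr>carrier := T ` carrier V\<rparr>)"

definition ordered_basis :: "('k::field, 'v) module \<Rightarrow> 'v list \<Rightarrow> bool" where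
  "ordered_basis V bs \<longleftrightarrow> distinct bs \<and> vectorspace.basis class_ring V (set bs)"

definition coordinates :: "('k::field, 'v) module \<Rightarrow> 'v list \<Rightarrow> 'v \<Rightarrow> nat \<Rightarrow> 'k" where
  "coordinates V bs x =
    (SOME c. x = finsum V (\<lambda>i. smult V (c i) (bs ! i)) {..<length bs})"

text \<open>The determinant of a linear map between two spaces of the same finite dimension. It is taken
  with respect to chosen bases, hence determined up to a nonzero factor only; it is \<open>1\<close> for zero
  spaces.\<close>

definition map_det ::
  "('k::field, 'v) module \<Rightarrow> ('k, 'w) module \<Rightarrow> ('v \<Rightarrow> 'w) \<Rightarrow> 'k" where
  "map_det V W T =
    (let bs = (SOME bs. ordered_basis V bs); cs = (SOME cs. ordered_basis W cs)
     in Determinant.det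
          (Matrix.mat (length cs) (length bs) (\<lambda>(i, j). coordinates W cs (T (bs ! j)) i)))"


section \<open>The polynomial ring and derivations\<close>

text \<open>\<open>R = k[x\<^sub>0,x\<^sub>1,x\<^sub>2]\<close>; the variables are indexed by the three-element type \<open>3\<close>.\<close>

type_synonym 'k R = "(3 \<Rightarrow>\<^sub>0 nat) \<Rightarrow>\<^sub>0 'k"

definition const :: "'k::zero \<Rightarrow> 'k R" where
  "const c = Poly_Mapping.single 0 c"

definition var :: "3 \<Rightarrow> 'k::zero_neq_one R" where
  "var i = Poly_Mapping.single (Poly_Mapping.single i 1) 1"

definition homog :: "int \<Rightarrow> 'k::zero R \<Rightarrow> bool" where
  "homog e p \<longleftrightarrow> (\<forall>m\<in>Poly_Mapping.keys p. int (\<Sum>i\<in>UNIV. Poly_Mapping.lookup m i) = e)"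

definition partial_deriv :: "3 \<Rightarrow> 'k::comm_ring_1 R \<Rightarrow> 'k R" where
  "partial_deriv i p =
    (\<Sum>m\<in>Poly_Mapping.keys p. Poly_Mapping.single (m - Poly_Mapping.single i 1)
                    (of_nat (Poly_Mapping.lookup m i) * Poly_Mapping.lookup p m))"

definition dot :: "'k::comm_ring_1 ^ 3 \<Rightarrow> 'k ^ 3 \<Rightarrow> 'k" where
  "dot a x = (\<Sum>i\<in>UNIV. a $ i * x $ i)"

definition linear_form :: "'k::comm_ring_1 ^ 3 \<Rightarrow> 'k R" where
  "linear_form a = (\<Sum>i\<in>UNIV. const (a $ i) * var i)"

text \<open>The vector \<open>\<theta>\<close> stands for the derivation \<open>\<Sum>i. \<theta>\<^sub>i \<partial>/\<partial>x\<^sub>i\<close>.\<close>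

definition apply_deriv :: "'k::comm_ring_1 R ^ 3 \<Rightarrow> 'k R \<Rightarrow> 'k R" where
  "apply_deriv \<theta> p = (\<Sum>i\<in>UNIV. \<theta> $ i * partial_deriv i p)"

definition euler :: "'k::comm_ring_1 R ^ 3" where
  "euler = (\<chi> i. var i)"


section \<open>Line arrangements\<close>

text \<open>Points and lines of the projective plane are the linear subspaces of \<open>k\<^sup>3\<close> of dimension
  one and two.\<close>

definition is_point :: "('k::field ^ 3) set \<Rightarrow> bool" where
  "is_point P \<longleftrightarrow> vec.subspace P \<and> vec.dim P = 1"

definition is_line :: "('k::field ^ 3) set \<Rightarrow> bool" where
  "is_line L \<longleftrightarrow> vec.subspace L \<and> vec.dim L = 2"

definition arrangement :: "('k::field ^ 3) set set \<Rightarrow> bool" where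
  "arrangement A \<longleftrightarrow> finite A \<and> (\<forall>H\<in>A. is_line H)"

definition essential :: "('k::field ^ 3) set set \<Rightarrow> bool" where
  "essential A \<longleftrightarrow> \<not> (\<exists>P. is_point P \<and> (\<forall>H\<in>A. P \<subseteq> H))"

text \<open>The set \<open>A''\<close> of points in which the lines of \<open>A\<close> meet the line \<open>L\<close>.\<close>

definition restriction :: "('k::field ^ 3) set set \<Rightarrow> ('k ^ 3) set \<Rightarrow> ('k ^ 3) set set" where
  "restriction A L = (\<lambda>H. H \<inter> L) ` A"

definition line_form :: "('k::field ^ 3) set \<Rightarrow> 'k R" where
  "line_form L = linear_form (SOME a. L = {x. dot a x = 0})"

definition defining_poly :: "('k::field ^ 3) set set \<Rightarrow> 'k R" where
  "defining_poly A = (\<Prod>H\<in>A. line_form H)"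

definition D :: "('k::field ^ 3) set set \<Rightarrow> ('k R ^ 3) set" where
  "D A = {\<theta>. defining_poly A dvd apply_deriv \<theta> (defining_poly A)}"


section \<open>Sheaves associated to graded modules\<close>

text \<open>A graded \<open>R\<close>-module is given as a subquotient \<open>N / N'\<close> of a free module \<open>R\<^sup>n\<close>, that is, as a
  pair \<open>(N, N')\<close> of graded submodules with \<open>N' \<subseteq> N\<close>.\<close>

type_synonym ('k, 'n) gmod = "('k R ^ 'n) set \<times> ('k R ^ 'n) set"

text \<open>\<open>D(A) / R \<theta>\<^sub>E\<close>, isomorphic to \<open>D\<^sub>0\<close>; the degree of a derivation is the degree of its
  coefficients.\<close>

definition der_mod :: "('k::field ^ 3) set set \<Rightarrow> ('k, 3) gmod" where
  "der_mod A = (D A, range (\<lambda>f. f *s euler))"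

definition free_mod :: "('k::field, 1) gmod" where
  "free_mod = (UNIV, {0})"

text \<open>\<open>M / \<alpha>M\<close>; the associated sheaf is the restriction of that of \<open>M\<close> to the line \<open>\<alpha> = 0\<close>.\<close>

definition mod_form :: "'k::field R \<Rightarrow> ('k, 'n::finite) gmod \<Rightarrow> ('k, 'n) gmod" where
  "mod_form \<alpha> M = (fst M, snd M + (*s) \<alpha> ` fst M)"

text \<open>By exactness of localization the sections of the sheaf associated to \<open>N / N'\<close> on the principal
  open set \<open>D\<^sub>+(g)\<close> are the quotient of the degree-zero parts of the localizations of \<open>N\<close> and \<open>N'\<close> at
  \<open>g\<close>, both of which lie in \<open>F\<^sup>n\<close> with \<open>F = Frac R\<close>. Accordingly a (quasi-coherent) sheaf on the
  projective plane is given by its values on the sets \<open>D\<^sub>+(g)\<close>, \<open>g\<close> homogeneous of positive degree: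
  \<open>E g = (V, W)\<close> means that the group of sections on \<open>D\<^sub>+(g)\<close> is \<open>V / W\<close>. The restriction map to
  \<open>D\<^sub>+(gh)\<close> is induced by the inclusion, i.e. it enlarges a coset of \<open>snd (E g)\<close> to one of
  \<open>snd (E (g * h))\<close>. A sheaf on a line \<open>L\<close> is identified with its direct image on the plane.\<close>

type_synonym ('k, 'n) sheaf = "'k R \<Rightarrow> ('k R fract ^ 'n) set \<times> ('k R fract ^ 'n) set"

definition principal :: "'k::field R \<Rightarrow> bool" where
  "principal g \<longleftrightarrow> g \<noteq> 0 \<and> (\<exists>e>0. homog e g)"

definition localize :: "'k::field R \<Rightarrow> int \<Rightarrow> ('k R ^ 'n::finite) set \<Rightarrow> ('k R fract ^ 'n) set" where
  "localize g n N =
    {(\<chi> i. Fract (m $ i) (g ^ j)) | m j.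
       m \<in> N \<and> (\<exists>e. homog e g \<and> (\<forall>i. homog (n + int j * e) (m $ i)))}"

text \<open>The sheaf associated to the graded module \<open>M(n)\<close>.\<close>

definition tilde :: "('k::field, 'n::finite) gmod \<Rightarrow> int \<Rightarrow> ('k, 'n) sheaf" where
  "tilde M n = (\<lambda>g. (localize g n (fst M), localize g n (snd M)))"

definition structure_ring :: "'k::field R \<Rightarrow> 'k R fract set" where
  "structure_ring g = (\<lambda>x. x $ 1) ` localize g 0 (UNIV :: ('k R ^ 1) set)"

definition kscale :: "'k::field \<Rightarrow> 'k R fract ^ 'n::finite \<Rightarrow> 'k R fract ^ 'n" where
  "kscale c x = Fract (const c) 1 *s x"

definition sections :: "('k::field, 'n::finite) sheaf \<Rightarrow> 'k R \<Rightarrow> ('k, ('k R fract ^ 'n) set) module" where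
  "sections E g = quot_space kscale (fst (E g)) (snd (E g))"

definition sheaf_iso ::
  "('k::field, 'm::finite) sheaf \<Rightarrow> ('k, 'n::finite) sheaf
    \<Rightarrow> ('k R \<Rightarrow> ('k R fract ^ 'm) set \<Rightarrow> ('k R fract ^ 'n) set) \<Rightarrow> bool" where
  "sheaf_iso E G \<phi> \<longleftrightarrow>
    (\<forall>g. principal g \<longrightarrow>
      bij_betw (\<phi> g) (carrier (sections E g)) (carrier (sections G g)) \<and>
      (\<forall>X\<in>carrier (sections E g). \<forall>Y\<in>carrier (sections E g). \<phi> g (X + Y) = \<phi> g X + \<phi> g Y) \<and>
      (\<forall>r\<in>structure_ring g. \<forall>X\<in>carrier (sections E g).
        \<phi> g ((*s) r ` X + snd (E g)) = (*s) r ` (\<phi> g X) + snd (G g)) \<and>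
      (\<forall>h. principal h \<longrightarrow> (\<forall>X\<in>carrier (sections E g).
        \<phi> (g * h) (X + snd (E (g * h))) = \<phi> g X + snd (G (g * h)))))"

text \<open>Kernel and image of the morphism \<open>E \<rightarrow> G\<close> induced by a linear map \<open>f\<close> of the ambient spaces.
  As \<open>D\<^sub>+(g)\<close> is affine, the sections of the image sheaf on it are the images of sections.\<close>

definition kernel_sheaf ::
  "('k R fract ^ 'm \<Rightarrow> 'k R fract ^ 'n) \<Rightarrow> ('k::field, 'm::finite) sheaf \<Rightarrow> ('k, 'n::finite) sheaf \<Rightarrow> ('k, 'm) sheaf"
  where "kernel_sheaf f E G = (\<lambda>g. ({x \<in> fst (E g). f x \<in> snd (G g)}, snd (E g)))"

definition image_sheaf ::
  "('k R fract ^ 'm \<Rightarrow> 'k R fract ^ 'n::finite) \<Rightarrow> ('k::field, 'm::finite) sheaf \<Rightarrow> ('k, 'n) sheaf \<Rightarrow> ('k, 'n) sheaf"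
  where "image_sheaf f E G = (\<lambda>g. (f ` fst (E g) + snd (G g), snd (G g)))"


section \<open>Cohomology on a line\<close>

text \<open>Linear forms \<open>u\<close>, \<open>v\<close> without common zero on \<open>L\<close>, i.e. homogeneous coordinates on
  \<open>L \<cong> P\<^sup>1\<close>. Cohomology on \<open>L\<close> is Cech cohomology for the affine cover of \<open>L\<close> by
  \<open>D\<^sub>+(u)\<close> and \<open>D\<^sub>+(v)\<close>.\<close>

definition line_coords :: "('k::field ^ 3) set \<Rightarrow> 'k R \<times> 'k R" where
  "line_coords L =
    map_prod linear_form linear_form (SOME (a, b). {x \<in> L. dot a x = 0 \<and> dot b x = 0} = {0})"

definition coord_u :: "('k::field ^ 3) set \<Rightarrow> 'k R" where
  "coord_u L = fst (line_coords L)"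

definition coord_v :: "('k::field ^ 3) set \<Rightarrow> 'k R" where
  "coord_v L = snd (line_coords L)"

definition coord_uv :: "('k::field ^ 3) set \<Rightarrow> 'k R" where
  "coord_uv L = coord_u L * coord_v L"

definition H0 ::
  "('k::field ^ 3) set \<Rightarrow> ('k, 'n::finite) sheaf
    \<Rightarrow> ('k, ('k R fract ^ 'n) set \<times> ('k R fract ^ 'n) set) module" where
  "H0 L E =
    (let U = sections E (coord_u L); V = sections E (coord_v L) in
     \<lparr>carrier = {(X, Y). X \<in> carrier U \<and> Y \<in> carrier V \<and>
                   X + snd (E (coord_uv L)) = Y + snd (E (coord_uv L))},
      mult = undefined, one = undefined,
      zero = (zero U, zero V),
      add = (\<lambda>(X, Y) (X', Y'). (add U X X', add V Y Y')),
      smult = (\<lambda>c (X, Y). (smult U c X, smult V c Y))\<rparr>)"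

definition coboundaries :: "('k::field ^ 3) set \<Rightarrow> ('k, 'n::finite) sheaf \<Rightarrow> ('k R fract ^ 'n) set" where
  "coboundaries L E = fst (E (coord_u L)) + fst (E (coord_v L)) + snd (E (coord_uv L))"

definition H1 :: "('k::field ^ 3) set \<Rightarrow> ('k, 'n::finite) sheaf \<Rightarrow> ('k, ('k R fract ^ 'n) set) module" where
  "H1 L E = quot_space kscale (fst (E (coord_uv L))) (coboundaries L E)"

definition H0_map ::
  "('k::field ^ 3) set \<Rightarrow> ('k R \<Rightarrow> ('k R fract ^ 'm::finite) set \<Rightarrow> ('k R fract ^ 'n::finite) set)
    \<Rightarrow> ('k R fract ^ 'm) set \<times> ('k R fract ^ 'm) set
    \<Rightarrow> ('k R fract ^ 'n) set \<times> ('k R fract ^ 'n) set" where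
  "H0_map L \<phi> = map_prod (\<phi> (coord_u L)) (\<phi> (coord_v L))"

definition H1_map ::
  "('k::field ^ 3) set \<Rightarrow> ('k, 'm::finite) sheaf \<Rightarrow> ('k, 'n::finite) sheaf
    \<Rightarrow> ('k R \<Rightarrow> ('k R fract ^ 'm) set \<Rightarrow> ('k R fract ^ 'n) set)
    \<Rightarrow> ('k R fract ^ 'm) set \<Rightarrow> ('k R fract ^ 'n) set" where
  "H1_map L E G \<phi> Z =
    (THE Z'. \<exists>z\<in>fst (E (coord_uv L)). z \<in> Z \<and>
       Z' = \<phi> (coord_uv L) (z +o snd (E (coord_uv L))) + coboundaries L G)"

text \<open>The connecting homomorphism \<open>H\<^sup>0(im) \<rightarrow> H\<^sup>1(ker)\<close> of \<open>0 \<rightarrow> ker \<rightarrow> E \<rightarrow> im \<rightarrow> 0\<close>: lift a global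
  section of the image to \<open>x\<close> on \<open>D\<^sub>+(u)\<close> and \<open>y\<close> on \<open>D\<^sub>+(v)\<close> and take the class of \<open>y - x\<close>.\<close>

definition connecting ::
  "('k::field ^ 3) set \<Rightarrow> ('k R fract ^ 'm::finite \<Rightarrow> 'k R fract ^ 'n::finite)
    \<Rightarrow> ('k, 'm) sheaf \<Rightarrow> ('k, 'n) sheaf
    \<Rightarrow> ('k R fract ^ 'n) set \<times> ('k R fract ^ 'n) set \<Rightarrow> ('k R fract ^ 'm) set" where
  "connecting L f E G = (\<lambda>(X, Y).
    (THE Z. \<exists>x\<in>fst (E (coord_u L)). \<exists>y\<in>fst (E (coord_v L)).
       f x \<in> X \<and> f y \<in> Y \<and> Z = (y - x) +o coboundaries L (kernel_sheaf f E G)))"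


section \<open>Jump lines and the map \<open>\<alpha>\<^sub>L\<close>\<close>

text \<open>The twist normalizing a rank two bundle with first Chern class \<open>c\<close>.\<close>

definition norm_twist :: "int \<Rightarrow> int" where
  "norm_twist c = (if even c then - (c div 2) else - ((c + 1) div 2))"

text \<open>\<open>k\<^sub>\<D>\<close>, using \<open>c\<^sub>1(\<D>) = -(d - 1)\<close>.\<close>

definition der_twist :: "('k::field ^ 3) set set \<Rightarrow> int" where
  "der_twist A = norm_twist (- (int (card A) - 1))"

text \<open>\<open>\<D>(n)\<close> restricted to \<open>L\<close>, and \<open>\<O>\<^sub>L(n)\<close>.\<close>

definition der_on_line ::
  "('k::field ^ 3) set \<Rightarrow> ('k ^ 3) set set \<Rightarrow> int \<Rightarrow> ('k, 3) sheaf" where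
  "der_on_line L A n = tilde (mod_form (line_form L) (der_mod A)) n"

definition O_line :: "('k::field ^ 3) set \<Rightarrow> int \<Rightarrow> ('k, 1) sheaf" where
  "O_line L n = tilde (mod_form (line_form L) free_mod) n"

definition jump_lines :: "('k::field ^ 3) set set \<Rightarrow> ('k ^ 3) set set" where
  "jump_lines A =
    {L. is_line L \<and>
        carrier (H0 L (der_on_line L A (der_twist A - 1)))
          \<noteq> {zero (H0 L (der_on_line L A (der_twist A - 1)))}}"

text \<open>Multiplication by \<open>\<alpha>\<close> gives \<open>\<D>\<^sub>A(-1)|\<^sub>L \<rightarrow> \<D>\<^sub>B|\<^sub>L\<close> with \<open>B = A \<union> {L}\<close>; by exactness of the
  restricted sequence its kernel is the Tor term. After twisting by \<open>k\<^sub>\<D>\<close> the kernel is isomorphic to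
  \<open>\<O>\<^sub>L(a)\<close> and the image to \<open>\<O>\<^sub>L(b)\<close> for the values of \<open>a\<close>, \<open>b\<close> for which the map is used, and these
  identifications are chosen. They are unique up to nonzero constants, which affect neither the
  rank nor the vanishing of the determinant.\<close>

definition alpha_map ::
  "('k::field ^ 3) set set \<Rightarrow> ('k ^ 3) set \<Rightarrow> int \<Rightarrow> int
    \<Rightarrow> ('k R fract ^ 1) set \<times> ('k R fract ^ 1) set \<Rightarrow> ('k R fract ^ 1) set" where
  "alpha_map A L b a =
    (let E = der_on_line L A (der_twist A - 1);
         G = der_on_line L (insert L A) (der_twist A);
         f = (*s) (Fract (line_form L) 1);
         \<psi> = (SOME \<psi>. sheaf_iso (O_line L b) (image_sheaf f E G) \<psi>);
         \<phi> = (SOME \<phi>. sheaf_iso (kernel_sheaf f E G) (O_line L a) \<phi>)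
     in H1_map L (kernel_sheaf f E G) (O_line L a) \<phi> \<circ> connecting L f E G \<circ> H0_map L \<psi>)"

end

theory Submission
  imports Defs
begin

text \<open>
  On \<open>L\<close>, with linear form \<open>\<alpha>\<close>, coordinates \<open>u\<close>, \<open>v\<close> and \<open>\<B> = \<A> \<union> {L}\<close>, the sheaf \<open>\<D>(-1)|\<^sub>L\<close> is cut by
  multiplication by \<open>\<alpha>\<close> into a kernel, the sheaf of \<open>D(\<B>)/(R \<theta>\<^sub>E + \<alpha> D(\<A>))\<close>, and an image, the sheaf of
  \<open>D(\<A>)/D(\<B>)\<close>. The map \<open>\<theta> \<mapsto> \<theta>(u) v - \<theta>(v) u mod \<alpha>\<close> identifies the kernel with the multiples of
  \<open>Q''\<close>, and \<open>\<theta> \<mapsto> \<theta>(\<alpha>) mod \<alpha>\<close> identifies the image with the multiples of \<open>Q / Q''\<close>; both are onto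
  locally because the products of the lines of \<open>\<A>\<close> avoiding a given point of \<open>L\<close> have no common zero
  on \<open>L\<close>. So both are line bundles of the expected degrees. The long exact sequence, read on Cech
  representatives, shows that \<open>L\<close> is a jump line iff the subbundle has a global section or \<open>\<alpha>\<^sub>L\<close> is not
  injective, and \<open>h\<^sup>0(\<O>(b)) = b + 1\<close>, \<open>h\<^sup>1(\<O>(a)) = -a - 1\<close> turn non-injectivity into the conditions on
  determinant and rank.
\<close>

text \<open>\<open>alpha_map\<close> takes its two identifications by choice, so nothing can be
  computed from formulas for them. The explicit maps only show that isomorphisms exist. After that
  any chosen isomorphism is turned into a relation between representatives
  (\<open>sheaf_corr\<close>), and the long exact sequence is chased with such relations: exactness
  alone decides whether the connecting map is injective, for all choices at once. The ring
  R/\<alpha> is realized inside R. \<open>toL\<close> substitutes a parametrization of L; its kernel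
  is generated by \<alpha>, so congruences modulo \<alpha> become identities between polynomials in
  two variables, where the lines of A restrict to primes. Lines through the same point of L restrict
  to associated primes. For this reason one representative line per point is fixed; the product
  \<open>Q2\<close> of the representatives lifts Q'', and the product \<open>Q1\<close> of the
  remaining lines vanishes at a point of L with the multiplicity of the pencil there minus one.
  Surjectivity onto the line bundles is required on every principal open set
  \<open>D\<^sub>+(g)\<close>. It is proved in the form that some power of g, times
  \<open>Q2\<close> or \<open>Q1\<close>, is attained modulo \<alpha>.\<close>

lemma R_induct [case_names single add]:
  fixes p :: "'a \<Rightarrow>\<^sub>0 'b::comm_monoid_add"
  assumes "\<And>m c. P (Poly_Mapping.single m c)" "\<And>p q. P p \<Longrightarrow> P q \<Longrightarrow> P (p + q)"
  shows "P p"
proof -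
  have "P p" if "Poly_Mapping.keys p = A" "finite A" for A p
    using that(2,1)
  proof (induction A arbitrary: p rule: finite_induct)
    case empty
    have "p = Poly_Mapping.single undefined 0"
      by (rule poly_mapping_eqI) (use empty in \<open>auto simp: in_keys_iff\<close>)
    then show ?case using assms(1) by metis
  next
    case (insert x A)
    define q where "q = Poly_Mapping.update x 0 p"
    have "Poly_Mapping.keys q = A" using insert by (auto simp: q_def keys_update)
    moreover have "p = q + Poly_Mapping.single x (Poly_Mapping.lookup p x)"
      by (rule poly_mapping_eqI) (auto simp: q_def lookup_add lookup_update lookup_single when_def)
    ultimately show ?case using insert.IH assms by metis
  qed
  then show ?thesis by simp
qed

lemma sum_keys_superset:
  assumes "finite S" "Poly_Mapping.keys p \<subseteq> S" "\<And>m. f m 0 = 0"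
  shows "(\<Sum>m\<in>Poly_Mapping.keys p. f m (Poly_Mapping.lookup p m)) = (\<Sum>m\<in>S. f m (Poly_Mapping.lookup p m))"
  by (rule sum.mono_neutral_left) (use assms in \<open>auto simp: in_keys_iff\<close>)

text \<open>Cancellation can make the support of \<open>p + q\<close> smaller than the union of the
  two supports; summing over the union is harmless because \<open>f m 0 = 0\<close>. Substitution
  and partial derivatives get their additivity from here.\<close>

lemma sum_keys_add:
  fixes f :: "_ \<Rightarrow> _ \<Rightarrow> 'c::comm_monoid_add"
  assumes "\<And>m. f m 0 = 0" "\<And>m a b. f m (a + b) = f m a + f m b"
  shows "(\<Sum>m\<in>Poly_Mapping.keys (p + q). f m (Poly_Mapping.lookup (p + q) m)) =
    (\<Sum>m\<in>Poly_Mapping.keys p. f m (Poly_Mapping.lookup p m)) +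
    (\<Sum>m\<in>Poly_Mapping.keys q. f m (Poly_Mapping.lookup q m))"
proof -
  let ?S = "Poly_Mapping.keys p \<union> Poly_Mapping.keys q"
  show ?thesis
    by (subst (1 2 3) sum_keys_superset[of ?S])
      (use assms keys_add[of p q] in \<open>auto simp: lookup_add sum.distrib\<close>)
qed

lemma const_0 [simp]: "const 0 = 0" by (simp add: const_def)
lemma const_1 [simp]: "const 1 = 1" by (simp add: const_def)
lemma const_add: "const (a + b) = const a + const b" by (simp add: const_def single_add)
lemma const_mult: "const (a * b) = const a * (const b :: 'k::comm_ring_1 R)"
  by (simp add: const_def mult_single)
lemma const_uminus: "const (- a) = - const a" by (simp add: const_def single_uminus)
lemma const_sum: "const (sum f S) = (\<Sum>i\<in>S. const (f i))"
  by (induction S rule: infinite_finite_induct) (auto simp: const_add)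
lemma const_eq_0_iff [simp]: "const a = 0 \<longleftrightarrow> a = 0"
  unfolding const_def by (metis single_zero inj_single injD)

section \<open>Substitution\<close>

text \<open>The ring homomorphism over \<open>k\<close> with prescribed values on the variables. It
  serves as evaluation at a point, as restriction to a line and as the lift back from the
  line.\<close>

definition subst :: "(3 \<Rightarrow> 'k::comm_ring_1 R) \<Rightarrow> 'k R \<Rightarrow> 'k R" where
  "subst \<sigma> p = (\<Sum>m\<in>Poly_Mapping.keys p.
     const (Poly_Mapping.lookup p m) * (\<Prod>i\<in>UNIV. \<sigma> i ^ Poly_Mapping.lookup m i))"

lemma subst_add: "subst \<sigma> (p + q) = subst \<sigma> p + subst \<sigma> q"
  unfolding subst_def by (rule sum_keys_add) (auto simp: const_add ring_distribs)

lemma subst_single: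
  "subst \<sigma> (Poly_Mapping.single m c) = const c * (\<Prod>i\<in>UNIV. \<sigma> i ^ Poly_Mapping.lookup m i)"
  by (simp add: subst_def)

lemma subst_0 [simp]: "subst \<sigma> 0 = 0" by (simp add: subst_def)

lemma subst_const [simp]: "subst \<sigma> (const c) = const c"
  by (simp add: subst_single const_def)

lemma subst_1 [simp]: "subst \<sigma> 1 = 1"
  using subst_const[of \<sigma> 1] by simp

lemma subst_mult: "subst \<sigma> (p * q) = subst \<sigma> p * subst \<sigma> q"
proof (induction p rule: R_induct)
  case (single m c)
  show ?case
  proof (induction q rule: R_induct)
    case (single m' c')
    show ?case
      by (simp add: mult_single subst_single const_mult lookup_add power_add prod.distrib ac_simps)
  qed (simp add: ring_distribs subst_add)
qed (simp add: ring_distribs subst_add)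

lemma subst_uminus: "subst \<sigma> (- p) = - subst \<sigma> p"
  using subst_add[of \<sigma> p "- p"] by (simp add: eq_neg_iff_add_eq_0 add.commute)

lemma subst_diff: "subst \<sigma> (p - q) = subst \<sigma> p - subst \<sigma> q"
  using subst_add[of \<sigma> p "- q"] by (simp add: subst_uminus)

lemma subst_sum: "subst \<sigma> (sum f S) = (\<Sum>i\<in>S. subst \<sigma> (f i))"
  by (induction S rule: infinite_finite_induct) (auto simp: subst_add)

lemma subst_prod: "subst \<sigma> (prod f S) = (\<Prod>i\<in>S. subst \<sigma> (f i))"
  by (induction S rule: infinite_finite_induct) (auto simp: subst_mult)

lemma subst_power: "subst \<sigma> (p ^ n) = subst \<sigma> p ^ n"
  by (induction n) (auto simp: subst_mult)

lemma subst_var [simp]: "subst \<sigma> (var i) = \<sigma> i"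
proof -
  have "(\<Prod>j\<in>UNIV. \<sigma> j ^ Poly_Mapping.lookup (Poly_Mapping.single i (1::nat)) j) =
      (\<Prod>j\<in>UNIV. if j = i then \<sigma> j else 1)"
    by (rule prod.cong) (auto simp: lookup_single when_def)
  then show ?thesis unfolding var_def by (simp add: subst_single)
qed

text \<open>Monomials are products of constants and variables, so identities between ring
  homomorphisms need checking only on these.\<close>

lemma poly_induct_ring [case_names const var add mult]:
  fixes p :: "'k::comm_ring_1 R"
  assumes c: "\<And>c. P (const c)" and v: "\<And>i. P (var i)"
    and a: "\<And>p q. P p \<Longrightarrow> P q \<Longrightarrow> P (p + q)" and m: "\<And>p q. P p \<Longrightarrow> P q \<Longrightarrow> P (p * q)"
  shows "P p"
proof (induction p rule: R_induct)
  case (single t c)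
  show ?case
  proof (induction t arbitrary: c rule: R_induct)
    case (single i n)
    show ?case
    proof (induction n)
      case 0
      then show ?case using assms(1)[of c] by (simp add: const_def)
    next
      case (Suc n)
      have "Poly_Mapping.single (Poly_Mapping.single i (Suc n)) c =
          Poly_Mapping.single (Poly_Mapping.single i n) c * var i"
        by (simp add: var_def mult_single single_add[symmetric])
      then show ?case using m[OF Suc v[of i]] by simp
    qed
  next
    case (add s t)
    have "Poly_Mapping.single (s + t) c = Poly_Mapping.single s c * Poly_Mapping.single t 1"
      by (simp add: mult_single)
    then show ?case using m[OF add(1) add(2)] by simp
  qed
qed (rule a)

lemma subst_subst: "subst \<sigma> (subst \<rho> p) = subst (\<lambda>i. subst \<sigma> (\<rho> i)) p"
  by (induction p rule: poly_induct_ring) (auto simp: subst_add subst_mult)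

lemma subst_id: "subst var p = p"
  by (induction p rule: poly_induct_ring) (auto simp: subst_add subst_mult)

text \<open>Polynomials with congruent values are closed under sums and, by telescoping
  \<open>x y - x' y'\<close>, under products. With \<open>var\<close> as one of the substitutions
  this compares a polynomial with its restriction to a line.\<close>

lemma dvd_subst_diff:
  fixes p :: "'k::comm_ring_1 R"
  assumes "\<And>i. d dvd \<sigma> i - \<rho> i"
  shows "d dvd subst \<sigma> p - subst \<rho> p"
proof (induction p rule: poly_induct_ring)
  case (add p q)
  have "subst \<sigma> (p + q) - subst \<rho> (p + q) = (subst \<sigma> p - subst \<rho> p) + (subst \<sigma> q - subst \<rho> q)"
    by (simp add: subst_add)
  then show ?case using add by simp
next
  case (mult p q)
  have "subst \<sigma> (p * q) - subst \<rho> (p * q) =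
      (subst \<sigma> p - subst \<rho> p) * subst \<sigma> q + subst \<rho> p * (subst \<sigma> q - subst \<rho> q)"
    by (simp add: subst_mult algebra_simps)
  then show ?case using mult by simp
qed (use assms in auto)

section \<open>Degrees\<close>

definition mdeg :: "(3 \<Rightarrow>\<^sub>0 nat) \<Rightarrow> nat" where
  "mdeg m = (\<Sum>i\<in>UNIV. Poly_Mapping.lookup m i)"

lemma mdeg_add: "mdeg (a + b) = mdeg a + mdeg b"
  by (simp add: mdeg_def lookup_add sum.distrib)

lemma homog_iff: "homog e p \<longleftrightarrow> (\<forall>m. Poly_Mapping.lookup p m \<noteq> 0 \<longrightarrow> int (mdeg m) = e)"
  by (auto simp: homog_def mdeg_def in_keys_iff)

lemma homog_0 [simp]: "homog e 0" by (simp add: homog_iff)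

lemma homog_add: "homog e p \<Longrightarrow> homog e q \<Longrightarrow> homog e (p + q)"
  unfolding homog_iff by (metis add.right_neutral lookup_add add.left_neutral)

lemma homog_uminus: "homog e p \<Longrightarrow> homog e (- p)" by (simp add: homog_iff)

lemma homog_diff: "homog e (p::'k::ab_group_add R) \<Longrightarrow> homog e q \<Longrightarrow> homog e (p - q)"
  using homog_add[of e p "- q"] by (simp add: homog_uminus)

lemma homog_sum: "(\<And>i. i \<in> S \<Longrightarrow> homog e (f i)) \<Longrightarrow> homog e (sum f S)"
  by (induction S rule: infinite_finite_induct) (auto intro: homog_add)

lemma homog_mult: "homog d p \<Longrightarrow> homog e q \<Longrightarrow> homog (d + e) (p * q)"
  using keys_mult[of p q] unfolding homog_def mdeg_def[symmetric] by (fastforce simp: mdeg_add)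

lemma homog_const [simp]: "homog 0 (const c)"
  by (auto simp: homog_iff const_def lookup_single when_def mdeg_def)

lemma homog_1 [simp]: "homog 0 (1 :: 'k::comm_semiring_1 R)"
  by (auto simp: homog_iff lookup_one when_def mdeg_def)

lemma homog_var [simp]: "homog 1 (var i)"
  by (auto simp: homog_iff var_def lookup_single when_def mdeg_def if_distrib[of int] cong: if_cong)

lemma homog_power: "homog d p \<Longrightarrow> homog (int n * d) ((p :: 'k::comm_semiring_1 R) ^ n)"
  by (induction n) (auto simp: ring_distribs intro: homog_mult)

lemma homog_prod: "(\<And>i. i \<in> S \<Longrightarrow> homog (d i) (f i :: 'k::comm_semiring_1 R)) \<Longrightarrow> homog (sum d S) (prod f S)"
  by (induction S rule: infinite_finite_induct) (auto intro: homog_mult)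

lemma homog_const_mult: "homog e p \<Longrightarrow> homog e (const c * p)"
  using homog_mult[OF homog_const] by fastforce

text \<open>\<open>localize\<close> accepts any witness for the degree of \<open>g\<close>; a
  nonzero form has only one, so all fractions over powers of \<open>g\<close> refer to the same
  degree.\<close>

lemma homog_unique: "homog d p \<Longrightarrow> homog e p \<Longrightarrow> p \<noteq> 0 \<Longrightarrow> d = e"
  unfolding homog_iff by (metis lookup_zero poly_mapping_eqI)

lemma homog_neg: "homog e p \<Longrightarrow> e < 0 \<Longrightarrow> p = 0"
  by (rule poly_mapping_eqI) (auto simp: homog_iff)

lemma homog_subst:
  assumes "\<And>i. homog 1 (\<sigma> i)" "homog e p"
  shows "homog e (subst \<sigma> p)"
  unfolding subst_def
proof (rule homog_sum)
  fix m assume "m \<in> Poly_Mapping.keys p"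
  then have e: "e = (\<Sum>i\<in>UNIV. int (Poly_Mapping.lookup m i) * 1)"
    using assms(2) by (simp add: homog_iff in_keys_iff mdeg_def)
  have "homog e (\<Prod>i\<in>UNIV. \<sigma> i ^ Poly_Mapping.lookup m i)"
    unfolding e by (rule homog_prod) (rule homog_power[OF assms(1)])
  then show "homog e (const (Poly_Mapping.lookup p m) * (\<Prod>i\<in>UNIV. \<sigma> i ^ Poly_Mapping.lookup m i))"
    by (rule homog_const_mult)
qed

definition hcomp :: "int \<Rightarrow> 'k::comm_ring_1 R \<Rightarrow> 'k R" where
  "hcomp e p = (\<Sum>m\<in>Poly_Mapping.keys p.
     if int (mdeg m) = e then Poly_Mapping.single m (Poly_Mapping.lookup p m) else 0)"

lemma lookup_hcomp:
  "Poly_Mapping.lookup (hcomp e p) m = (if int (mdeg m) = e then Poly_Mapping.lookup p m else 0)"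
proof -
  have "Poly_Mapping.lookup (hcomp e p) m = (\<Sum>k\<in>Poly_Mapping.keys p.
     if k = m then (if int (mdeg m) = e then Poly_Mapping.lookup p m else 0) else 0)"
    unfolding hcomp_def lookup_sum by (rule sum.cong) (auto simp: lookup_single when_def)
  then show ?thesis by (auto simp: in_keys_iff)
qed

lemma homog_hcomp [simp]: "homog e (hcomp e p)"
  by (simp add: homog_iff lookup_hcomp)

lemma hcomp_add: "hcomp e (p + q) = hcomp e p + hcomp e q"
  by (rule poly_mapping_eqI) (simp add: lookup_hcomp lookup_add)

lemma hcomp_0 [simp]: "hcomp e 0 = 0"
  by (rule poly_mapping_eqI) (simp add: lookup_hcomp)

lemma hcomp_diff: "hcomp e (p - q) = hcomp e p - hcomp e q"
  by (rule poly_mapping_eqI) (simp add: lookup_hcomp lookup_minus)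

lemma hcomp_sum: "hcomp e (sum f S) = (\<Sum>i\<in>S. hcomp e (f i))"
  by (induction S rule: infinite_finite_induct) (auto simp: hcomp_add)

lemma hcomp_homog: "homog e p \<Longrightarrow> hcomp e p = p"
  by (rule poly_mapping_eqI) (auto simp: lookup_hcomp homog_iff)

lemma hcomp_mult:
  assumes "homog d q"
  shows "hcomp e (q * p) = q * hcomp (e - d) p"
proof (induction p rule: R_induct)
  case (single m c)
  have 1: "homog (d + int (mdeg m)) (q * Poly_Mapping.single m c)"
    by (rule homog_mult[OF assms]) (auto simp: homog_iff lookup_single when_def)
  show ?case
  proof (cases "int (mdeg m) = e - d")
    case True
    then have "homog e (q * Poly_Mapping.single m c)" using 1 by (simp add: add.commute)
    moreover have "homog (e - d) (Poly_Mapping.single m c)"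
      using True by (auto simp: homog_iff lookup_single when_def)
    ultimately show ?thesis by (simp add: hcomp_homog)
  next
    case False
    have "hcomp (e - d) (Poly_Mapping.single m c) = 0"
      by (rule poly_mapping_eqI) (use False in \<open>auto simp: lookup_hcomp lookup_single when_def\<close>)
    moreover have "hcomp e (q * Poly_Mapping.single m c) = 0"
      by (rule poly_mapping_eqI) (use False 1 in \<open>auto simp: lookup_hcomp homog_iff\<close>)
    ultimately show ?thesis by simp
  qed
qed (simp add: ring_distribs hcomp_add)

text \<open>Taking components commutes with multiplication by the form \<open>q\<close>, so
  \<open>q * p\<close> equals \<open>q\<close> times a component of \<open>p\<close>; cancelling
  \<open>q\<close> shows that \<open>p\<close> is that component.\<close>

lemma homog_cancel:
  fixes p q :: "'k::field R"
  assumes "homog d q" "q \<noteq> 0" "homog e (q * p)"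
  shows "homog (e - d) p"
proof -
  have "q * p = q * hcomp (e - d) p" using hcomp_homog[OF assms(3)] hcomp_mult[OF assms(1)] by metis
  then have "p = hcomp (e - d) p" using assms(2) by simp
  then show ?thesis by (metis homog_hcomp)
qed

section \<open>Derivations\<close>

lemma partial_deriv_add: "partial_deriv i (p + q) = partial_deriv i p + partial_deriv i q"
  unfolding partial_deriv_def
  by (rule sum_keys_add) (auto simp: ring_distribs single_add)

lemma partial_deriv_single:
  "partial_deriv i (Poly_Mapping.single m c) =
   Poly_Mapping.single (m - Poly_Mapping.single i 1) (of_nat (Poly_Mapping.lookup m i) * c)"
  by (simp add: partial_deriv_def)

lemma minus_single_add:
  fixes m m' :: "3 \<Rightarrow>\<^sub>0 nat"
  assumes "Poly_Mapping.lookup m i > 0"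
  shows "m + m' - Poly_Mapping.single i 1 = (m - Poly_Mapping.single i 1) + m'"
  by (rule poly_mapping_eqI)
    (use assms in \<open>auto simp: lookup_add lookup_minus lookup_single when_def\<close>)

lemma partial_deriv_mult:
  "partial_deriv i (p * q) = partial_deriv i p * q + p * partial_deriv i q"
proof (induction p rule: R_induct)
  case (single m c)
  show ?case
  proof (induction q rule: R_induct)
    case (single m' c')
    \<comment> \<open>Subtraction of exponents is truncated. If \<open>i\<close> does not occur in
      \<open>m\<close>, the two exponents may differ, but then both coefficients are zero.\<close>
    have 1: "Poly_Mapping.single (m + m' - Poly_Mapping.single i 1) (of_nat (Poly_Mapping.lookup m i) * c * c')
       = Poly_Mapping.single ((m - Poly_Mapping.single i 1) + m') (of_nat (Poly_Mapping.lookup m i) * c * c')"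
      by (cases "Poly_Mapping.lookup m i = 0") (simp_all add: minus_single_add[simplified])
    have 2: "Poly_Mapping.single (m + m' - Poly_Mapping.single i 1) (of_nat (Poly_Mapping.lookup m' i) * c * c')
       = Poly_Mapping.single (m + (m' - Poly_Mapping.single i 1)) (of_nat (Poly_Mapping.lookup m' i) * c * c')"
      using minus_single_add[of m' i m, simplified]
      by (cases "Poly_Mapping.lookup m' i = 0") (simp_all add: add.commute)
    have "partial_deriv i (Poly_Mapping.single m c * Poly_Mapping.single m' c') =
      Poly_Mapping.single (m + m' - Poly_Mapping.single i 1) (of_nat (Poly_Mapping.lookup m i) * c * c')
      + Poly_Mapping.single (m + m' - Poly_Mapping.single i 1) (of_nat (Poly_Mapping.lookup m' i) * c * c')"
      by (simp add: mult_single partial_deriv_single lookup_add single_add[symmetric] algebra_simps)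
    also have "\<dots> = partial_deriv i (Poly_Mapping.single m c) * Poly_Mapping.single m' c'
       + Poly_Mapping.single m c * partial_deriv i (Poly_Mapping.single m' c')"
      unfolding 1 2 by (simp add: mult_single partial_deriv_single algebra_simps)
    finally show ?case .
  qed (simp add: ring_distribs partial_deriv_add)
qed (simp add: ring_distribs partial_deriv_add)

lemma partial_deriv_const [simp]: "partial_deriv i (const c) = 0"
  by (simp add: const_def partial_deriv_single)

lemma partial_deriv_1 [simp]: "partial_deriv i 1 = 0"
  unfolding const_1[symmetric] by (rule partial_deriv_const)

lemma partial_deriv_var: "partial_deriv i (var j) = (if i = j then 1 else 0)"
  by (auto simp: var_def partial_deriv_single lookup_single when_def)

lemma partial_deriv_sum: "partial_deriv i (sum f S) = (\<Sum>j\<in>S. partial_deriv i (f j))"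
proof (induction S rule: infinite_finite_induct)
  case empty
  then show ?case using partial_deriv_const[of i 0] by simp
next
  case (infinite S)
  then show ?case using partial_deriv_const[of i 0] by simp
qed (auto simp: partial_deriv_add)

lemma apply_deriv_mult: "apply_deriv \<theta> (p * q) = apply_deriv \<theta> p * q + p * apply_deriv \<theta> q"
  by (simp add: apply_deriv_def partial_deriv_mult algebra_simps sum.distrib sum_distrib_left)

text \<open>The value of a derivation, or the image of a vector, under the linear form with coefficient
  vector \<open>a\<close>.\<close>

definition pair :: "'k::comm_ring_1 ^ 3 \<Rightarrow> 'k R ^ 3 \<Rightarrow> 'k R" where
  "pair a \<theta> = (\<Sum>i\<in>UNIV. const (a $ i) * \<theta> $ i)"

lemma apply_deriv_linear_form: "apply_deriv \<theta> (linear_form a) = pair a \<theta>"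
proof -
  have "partial_deriv i (linear_form a) = const (a $ i)" for i :: 3
    unfolding linear_form_def partial_deriv_sum partial_deriv_mult
    by (simp add: partial_deriv_var if_distrib cong: if_cong)
  then show ?thesis by (simp add: apply_deriv_def pair_def mult.commute)
qed

lemma pair_add: "pair a (\<theta> + \<eta>) = pair a \<theta> + pair a \<eta>"
  by (simp add: pair_def ring_distribs sum.distrib)
lemma pair_diff: "pair a (\<theta> - \<eta>) = pair a \<theta> - pair a \<eta>"
  by (simp add: pair_def ring_distribs sum_subtractf)
lemma pair_smult: "pair a (r *s \<theta>) = r * pair a \<theta>"
  by (simp add: pair_def sum_distrib_left ac_simps)
lemma pair_0 [simp]: "pair a 0 = 0"
  by (simp add: pair_def)
lemma pair_euler: "pair a euler = linear_form a"
  by (simp add: pair_def euler_def linear_form_def)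

lemma homog_linear_form [simp]: "homog 1 (linear_form a)"
  unfolding linear_form_def by (rule homog_sum) (rule homog_const_mult[OF homog_var])

lemma hcomp_pair: "hcomp e (pair a \<theta>) = pair a (\<chi> i. hcomp e (\<theta> $ i))"
  by (simp add: pair_def hcomp_sum hcomp_mult[OF homog_const])

lemma apply_deriv_prod:
  assumes "finite S"
  shows "apply_deriv \<theta> (prod f S) = (\<Sum>j\<in>S. apply_deriv \<theta> (f j) * prod f (S - {j}))"
  using assms
proof (induction S rule: finite_induct)
  case empty
  then show ?case by (simp add: apply_deriv_def)
next
  case (insert x S)
  have "prod f (insert x S - {j}) = f x * prod f (S - {j})" if "j \<in> S" for j
  proof -
    have "insert x S - {j} = insert x (S - {j})" using that insert by auto
    then show ?thesis using insert by simp
  qed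
  then have "(\<Sum>j\<in>S. apply_deriv \<theta> (f j) * prod f (insert x S - {j})) =
      f x * (\<Sum>j\<in>S. apply_deriv \<theta> (f j) * prod f (S - {j}))"
    by (simp add: sum_distrib_left ac_simps)
  then show ?case using insert by (simp add: apply_deriv_mult)
qed

section \<open>Lines and coordinate frames\<close>

lemma dot_add: "dot c (x + y) = dot c x + dot c y"
  by (simp add: dot_def ring_distribs sum.distrib)
lemma dot_diff: "dot c (x - y) = dot c x - dot c y"
  by (simp add: dot_def ring_distribs sum_subtractf)
lemma dot_smult: "dot c (t *s x) = t * dot c x"
  by (simp add: dot_def sum_distrib_left ac_simps)
lemma dot_0 [simp]: "dot c 0 = 0" by (simp add: dot_def)
lemma dot_0_left [simp]: "dot 0 c = 0" by (simp add: dot_def)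
lemma dot_axis [simp]: "dot (axis i 1) x = x $ i"
  by (simp add: dot_def axis_def if_distrib[of "\<lambda>t. t * _"] cong: if_cong)
lemma dot_axis_right [simp]: "dot x (axis i 1) = x $ i"
  by (simp add: dot_def axis_def if_distrib[of "\<lambda>t. _ * t"] cong: if_cong)

lemma subspace_kernel: "vec.subspace {x. dot c x = 0}"
  by (rule vec.subspaceI) (auto simp: dot_add dot_smult)

text \<open>Extend a basis of \<open>L\<close> by a vector \<open>r\<close> outside
  \<open>L\<close>, let \<open>g\<close> kill the basis and fix \<open>r\<close>, and take a
  coordinate of \<open>g\<close> in which \<open>r\<close> does not vanish. Its kernel contains
  \<open>L\<close> and is proper, so the dimensions agree. Hence the choice in
  \<open>line_form\<close> yields an equation of the line.\<close>

lemma is_line_covec: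
  fixes L :: "('k::field ^ 3) set"
  assumes "is_line L"
  obtains c where "L = {x. dot c x = 0}"
proof -
  have L: "vec.subspace L" "vec.dim L = 2" using assms by (auto simp: is_line_def)
  obtain B where B: "B \<subseteq> L" "vec.independent B" "L \<subseteq> vec.span B" "card B = vec.dim L"
    using vec.basis_exists by blast
  have d3: "vec.dim (UNIV :: ('k^3) set) = 3" unfolding vec_dim_card by simp
  have sp: "vec.span B = L"
    using B(1,3) L(1) by (metis subset_antisym vec.span_minimal)
  have "L \<noteq> UNIV" using d3 L(2) by auto
  then obtain r where r: "r \<notin> L" by auto
  then have ind: "vec.independent (insert r B)"
    by (subst vec.independent_insert) (use B(2) sp in simp)
  obtain g where g: "Vector_Spaces.linear (*s) (*s) g" "\<And>x. x \<in> insert r B \<Longrightarrow> g x = (if x = r then r else 0)"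
    using vec.linear_independent_extend[OF ind, of "\<lambda>x. if x = r then r else 0"] by blast
  have gL: "g x = 0" if "x \<in> L" for x
  proof -
    have "x \<in> vec.span B" using sp that by simp
    then show ?thesis
      by (rule vec.linear_eq_0_on_span[OF g(1), rotated]) (use g(2) r B(1) in auto)
  qed
  have "r \<noteq> 0" using r L(1) vec.subspace_0 by metis
  then obtain i where i: "r $ i \<noteq> 0" by (auto simp: Finite_Cartesian_Product.vec_eq_iff)
  define c where "c = (\<chi> j. g (axis j 1) $ i)"
  have c: "dot c x = g x $ i" for x
    unfolding c_def dot_def using linear_componentwise[OF g(1), of x i] by (simp add: mult.commute)
  have sub: "L \<subseteq> {x. dot c x = 0}" using gL c by auto
  have "r \<notin> {x. dot c x = 0}" using c[of r] g(2)[of r] i by simp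
  then have "{x. dot c x = 0} \<noteq> UNIV" by blast
  then have "vec.dim {x. dot c x = 0} \<noteq> 3"
    using d3 vec.subspace_dim_equal[OF subspace_kernel vec.subspace_UNIV, of c] by auto
  moreover have "vec.dim {x. dot c x = 0} \<le> 3"
    using vec.dim_subset[of "{x. dot c x = 0}" UNIV] d3 by auto
  ultimately have "vec.dim {x. dot c x = 0} \<le> vec.dim L" using L(2) by simp
  then have "L = {x. dot c x = 0}"
    using vec.subspace_dim_equal[OF L(1) subspace_kernel sub] by simp
  then show ?thesis using that by blast
qed

text \<open>Names the choice hidden in \<open>line_form\<close>, so that the form of a line and the
  value of a derivation on it refer to the same coefficients.\<close>

definition line_covec :: "('k::field ^ 3) set \<Rightarrow> 'k ^ 3" where
  "line_covec H = (SOME a. H = {x. dot a x = 0})"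

lemma line_form_covec: "line_form H = linear_form (line_covec H)"
  by (simp add: line_form_def line_covec_def)

lemma line_covec: "is_line H \<Longrightarrow> H = {x. dot (line_covec H) x = 0}"
  unfolding line_covec_def by (rule someI_ex) (use is_line_covec in blast)

lemma line_covec_nz: "is_line H \<Longrightarrow> line_covec H \<noteq> 0"
proof
  assume H: "is_line H" "line_covec H = 0"
  then have "H = UNIV" using line_covec[OF H(1)] by simp
  then have "vec.dim H = 3" by (simp only: vec_dim_card) simp
  then show False using H(1) unfolding is_line_def by simp
qed

lemma is_line_eq:
  assumes "is_line H" "is_line H'" "H \<subseteq> H'"
  shows "H = H'"
  using assms vec.subspace_dim_equal[of H H'] by (auto simp: is_line_def)

text \<open>Dual bases of covectors and vectors. In the applications \<open>c\<close> is the
  equation of the line, so \<open>p\<close> and \<open>q\<close> span the line and \<open>a\<close>,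
  \<open>b\<close> restrict to coordinates on it.\<close>

locale frame =
  fixes a b c p q r :: "'k::field ^ 3"
  assumes expand: "x = dot a x *s p + dot b x *s q + dot c x *s r"
    and duals [simp]: "dot a p = 1" "dot b p = 0" "dot c p = 0" "dot a q = 0" "dot b q = 1" "dot c q = 0"
      "dot a r = 0" "dot b r = 0" "dot c r = 1"

text \<open>The matrix with rows \<open>a\<close>, \<open>b\<close>, \<open>c\<close> is injective,
  hence invertible; the dual vectors are the columns of its inverse.\<close>

lemma frame_exists:
  fixes a b c :: "'k::field ^ 3"
  assumes "\<And>x. dot a x = 0 \<Longrightarrow> dot b x = 0 \<Longrightarrow> dot c x = 0 \<Longrightarrow> x = 0"
  obtains p q r where "frame a b c p q r"
proof -
  define M :: "'k^3^3" where "M = vector [a, b, c]"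
  have M: "(M *v x) $ 1 = dot a x" "(M *v x) $ 2 = dot b x" "(M *v x) $ 3 = dot c x" for x
    by (simp_all add: M_def matrix_vector_mult_def dot_def)
  have "\<forall>x. M *v x = 0 \<longrightarrow> x = 0"
    using assms M by (metis zero_index)
  then obtain N where N: "N ** M = Finite_Cartesian_Product.mat 1" using matrix_left_invertible_ker[of M] by blast
  then have N': "M ** N = Finite_Cartesian_Product.mat 1" by (simp add: matrix_left_right_inverse)
  define col where "col j = (\<chi> i. N $ i $ j)" for j
  have NM: "N *v y = y $ 1 *s col 1 + y $ 2 *s col 2 + y $ 3 *s col 3" for y
    by (simp add: Finite_Cartesian_Product.vec_eq_iff matrix_vector_mult_def sum_3 col_def mult.commute)
  have e: "x = dot a x *s col 1 + dot b x *s col 2 + dot c x *s col 3" for x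
    using NM[of "M *v x"] N by (simp add: matrix_vector_mul_assoc M)
  have "(M *v col j) $ i = (Finite_Cartesian_Product.mat 1 :: 'k^3^3) $ i $ j" for i j
    unfolding N'[symmetric] by (simp add: matrix_vector_mult_def matrix_matrix_mult_def col_def)
  then have "dot a (col j) = (if j = 1 then 1 else 0)" "dot b (col j) = (if j = 2 then 1 else 0)"
    "dot c (col j) = (if j = 3 then 1 else 0)" for j
    by (auto simp: M[symmetric] Finite_Cartesian_Product.mat_def)
  then have "frame a b c (col 1) (col 2) (col 3)"
    unfolding frame_def using e by auto
  then show ?thesis using that by blast
qed

text \<open>Pick a nonzero entry of \<open>c\<close> and take the two coordinates at the other
  indices.\<close>

lemma frame_completion:
  fixes c :: "'k::field ^ 3"
  assumes "c \<noteq> 0"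
  obtains a b where "\<And>x. dot a x = 0 \<Longrightarrow> dot b x = 0 \<Longrightarrow> dot c x = 0 \<Longrightarrow> x = 0"
proof -
  have "c $ 1 \<noteq> 0 \<or> c $ 2 \<noteq> 0 \<or> c $ 3 \<noteq> 0" using assms by (auto simp: Finite_Cartesian_Product.vec_eq_iff forall_3)
  then show ?thesis
  proof (elim disjE)
    assume "c $ 1 \<noteq> 0"
    then show ?thesis using that[of "axis 2 1" "axis 3 1"]
      unfolding dot_axis by (auto simp: dot_def sum_3 Finite_Cartesian_Product.vec_eq_iff forall_3)
  next
    assume "c $ 2 \<noteq> 0"
    then show ?thesis using that[of "axis 1 1" "axis 3 1"]
      unfolding dot_axis by (auto simp: dot_def sum_3 Finite_Cartesian_Product.vec_eq_iff forall_3)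
  next
    assume "c $ 3 \<noteq> 0"
    then show ?thesis using that[of "axis 1 1" "axis 2 1"]
      unfolding dot_axis by (auto simp: dot_def sum_3 Finite_Cartesian_Product.vec_eq_iff forall_3)
  qed
qed

lemma subst_linear_form_point:
  "subst (\<lambda>i. const (x $ i)) (linear_form c) = const (dot c x)"
  by (simp add: linear_form_def dot_def subst_sum subst_mult const_sum const_mult)

text \<open>Evaluate the factorization at \<open>x\<close>.\<close>

lemma linear_form_dvd_imp:
  fixes c d :: "'k::field ^ 3"
  assumes "linear_form c dvd linear_form d" "dot c x = 0"
  shows "dot d x = 0"
proof -
  from assms(1) obtain h where "linear_form d = linear_form c * h" ..
  then have "const (dot d x) = const (dot c x) * subst (\<lambda>i. const (x $ i)) h"
    by (metis subst_linear_form_point subst_mult)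
  then show ?thesis using assms(2) by simp
qed

lemma linear_form_add: "linear_form (c + d) = linear_form c + linear_form d"
  by (simp add: linear_form_def const_add ring_distribs sum.distrib)
lemma linear_form_smult: "linear_form (t *s c) = const t * linear_form c"
  by (simp add: linear_form_def const_mult sum_distrib_left ac_simps)
lemma linear_form_axis: "linear_form (axis i 1) = var i"
proof -
  have "linear_form (axis i 1) = (\<Sum>j\<in>UNIV. if j = i then var j else 0)"
    unfolding linear_form_def by (rule sum.cong) (auto simp: axis_def)
  then show ?thesis by simp
qed

section \<open>Restriction of polynomials to the line with equation \<open>c\<close>\<close>

context frame
begin

text \<open>Pullback along the parametrization of the line by its basis \<open>p\<close>,
  \<open>q\<close>. The quotient of \<open>R\<close> by \<open>linear_form c\<close> thus becomes
  the ring of polynomials in \<open>var 1\<close>, \<open>var 2\<close> inside \<open>R\<close>, and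
  no second ring type appears.\<close>

definition toL :: "'k R \<Rightarrow> 'k R" where
  "toL = subst (\<lambda>i. const (p $ i) * var 1 + const (q $ i) * var 2)"

definition ofL :: "'k R \<Rightarrow> 'k R" where
  "ofL = subst (\<lambda>i. if i = 1 then linear_form a else if i = 2 then linear_form b else 0)"

lemma toL_simps [simp]: "toL 0 = 0" "toL 1 = 1" "toL (const t) = const t"
  by (simp_all add: toL_def)
lemma toL_hom: "toL (f + g) = toL f + toL g" "toL (f * g) = toL f * toL g" "toL (f - g) = toL f - toL g"
  "toL (- f) = - toL f" "toL (f ^ n) = toL f ^ n" "toL (prod F S) = (\<Prod>s\<in>S. toL (F s))"
  "toL (sum F S) = (\<Sum>s\<in>S. toL (F s))"
  by (simp_all add: toL_def subst_add subst_mult subst_diff subst_uminus subst_power subst_prod subst_sum)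
lemma ofL_hom: "ofL (f + g) = ofL f + ofL g" "ofL (f * g) = ofL f * ofL g" "ofL (f - g) = ofL f - ofL g"
  by (simp_all add: ofL_def subst_add subst_mult subst_diff)

lemma toL_linear_form: "toL (linear_form d) = const (dot d p) * var 1 + const (dot d q) * var 2"
  by (simp add: toL_def linear_form_def subst_sum subst_mult dot_def const_sum const_mult
      ring_distribs sum.distrib sum_distrib_right sum_distrib_left ac_simps)

lemma toL_frame [simp]: "toL (linear_form a) = var 1" "toL (linear_form b) = var 2"
    "toL (linear_form c) = 0"
  by (simp_all add: toL_linear_form)

lemma homog_toL: "homog e f \<Longrightarrow> homog e (toL f)"
  unfolding toL_def
  by (rule homog_subst) (auto intro!: homog_add homog_const_mult)

lemma homog_ofL: "homog e f \<Longrightarrow> homog e (ofL f)"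
  unfolding ofL_def by (rule homog_subst) auto

lemma linear_form_expand:
  "linear_form d = const (dot d p) * linear_form a + const (dot d q) * linear_form b
    + const (dot d r) * linear_form c"
proof -
  have "d $ j = dot d p * a $ j + dot d q * b $ j + dot d r * c $ j" for j
  proof -
    have "dot d (axis j 1) = dot d (dot a (axis j 1) *s p + dot b (axis j 1) *s q + dot c (axis j 1) *s r)"
      by (rule arg_cong[OF expand])
    then show ?thesis by (simp add: dot_add dot_smult mult.commute)
  qed
  then have "d = dot d p *s a + dot d q *s b + dot d r *s c" by (simp add: Finite_Cartesian_Product.vec_eq_iff)
  then show ?thesis by (metis linear_form_add linear_form_smult)
qed

text \<open>Identity and composite are both substitutions. On \<open>var i\<close> they differ by
  \<open>const (r $ i) * linear_form c\<close>, the third term of its expansion in the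
  frame.\<close>

lemma dvd_diff_ofL_toL: "linear_form c dvd f - ofL (toL f)"
proof -
  have "linear_form c dvd subst var f - subst (\<lambda>i. const (p $ i) * linear_form a + const (q $ i) * linear_form b) f"
  proof (rule dvd_subst_diff)
    fix i
    have "var i - (const (p $ i) * linear_form a + const (q $ i) * linear_form b) = const (r $ i) * linear_form c"
      using linear_form_expand[of "axis i 1"] by (simp add: linear_form_axis)
    then show "linear_form c dvd var i - (const (p $ i) * linear_form a + const (q $ i) * linear_form b)"
      by simp
  qed
  moreover have "ofL (toL f) = subst (\<lambda>i. const (p $ i) * linear_form a + const (q $ i) * linear_form b) f"
    by (simp add: ofL_def toL_def subst_subst subst_add subst_mult)
  ultimately show ?thesis by (simp add: subst_id)
qed

text \<open>If \<open>toL f\<close> vanishes, the preceding congruence says that \<open>f\<close>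
  itself is a multiple of the form. Congruences modulo the line become identities of
  polynomials.\<close>

lemma dvd_iff_toL: "linear_form c dvd f \<longleftrightarrow> toL f = 0"
proof
  assume "toL f = 0"
  then show "linear_form c dvd f" using dvd_diff_ofL_toL[of f] by (simp add: ofL_def)
qed (auto simp: toL_hom)

text \<open>A nonzero generator of the kernel of a homomorphism into a domain is prime; it is
  nonzero because its value at \<open>r\<close> is \<open>1\<close>.\<close>

lemma prime_linear_form: "prime_elem (linear_form c)"
proof (rule prime_elemI)
  have "const (dot c r) = subst (\<lambda>i. const (r $ i)) (linear_form c)"
    by (rule subst_linear_form_point[symmetric])
  then show "linear_form c \<noteq> 0" by auto
  show "\<not> linear_form c dvd 1" by (simp add: dvd_iff_toL)
qed (simp add: dvd_iff_toL toL_hom)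

end

lemma prime_elem_linear_form: "c \<noteq> 0 \<Longrightarrow> prime_elem (linear_form (c :: 'k::field ^ 3))"
  by (metis frame_completion frame_exists frame.prime_linear_form)

lemma prime_line_form: "is_line H \<Longrightarrow> prime_elem (line_form H)"
  unfolding line_form_covec by (rule prime_elem_linear_form) (rule line_covec_nz)

lemma line_form_dvd: "is_line H \<Longrightarrow> is_line H' \<Longrightarrow> line_form H dvd line_form H' \<Longrightarrow> H = H'"
proof -
  assume H: "is_line H" "is_line H'" "line_form H dvd line_form H'"
  have "H \<subseteq> H'"
  proof
    fix x assume "x \<in> H"
    then have "dot (line_covec H) x = 0" using line_covec[OF H(1)] by blast
    then have "dot (line_covec H') x = 0"
      using linear_form_dvd_imp H(3) unfolding line_form_covec by blast
    then show "x \<in> H'" using line_covec[OF H(2)] by blast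
  qed
  then show ?thesis using is_line_eq H by blast
qed

section \<open>Products of primes and the conditions defining \<open>D\<close>\<close>

lemma prime_elem_dvd_prodD:
  assumes "prime_elem \<pi>" "\<pi> dvd prod f S"
  shows "\<exists>s\<in>S. \<pi> dvd f s"
  using assms(2)
proof (induction S rule: infinite_finite_induct)
  case (insert x S)
  then have "\<pi> dvd f x \<or> \<pi> dvd prod f S" using prime_elem_dvd_multD[OF assms(1)] by simp
  then show ?case using insert.IH by blast
qed (use prime_elem_not_unit[OF assms(1)] in simp_all)

text \<open>Modulo the form of a line \<open>H\<close>, all terms of the Leibniz sum vanish except
  the one differentiating \<open>H\<close>, and its cofactor is prime to \<open>H\<close>.
  Membership becomes one condition per line, so enlarging \<open>A\<close> just adds a
  condition.\<close>

lemma D_iff: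
  assumes "arrangement A"
  shows "\<theta> \<in> D A \<longleftrightarrow> (\<forall>H\<in>A. line_form H dvd pair (line_covec H) \<theta>)"
proof -
  have fin: "finite A" and lines: "\<And>H. H \<in> A \<Longrightarrow> is_line H"
    using assms by (auto simp: arrangement_def)
  let ?t = "\<lambda>H. pair (line_covec H) \<theta> * prod line_form (A - {H})"
  have eq: "apply_deriv \<theta> (defining_poly A) = (\<Sum>H\<in>A. ?t H)"
    unfolding defining_poly_def apply_deriv_prod[OF fin]
    by (simp add: line_form_covec apply_deriv_linear_form)
  show ?thesis
  proof
    assume R: "\<forall>H\<in>A. line_form H dvd pair (line_covec H) \<theta>"
    have "defining_poly A dvd ?t H" if "H \<in> A" for H
    proof -
      have "defining_poly A = line_form H * prod line_form (A - {H})"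
        unfolding defining_poly_def by (rule prod.remove[OF fin that])
      then show ?thesis using R that by (simp add: mult_dvd_mono)
    qed
    then show "\<theta> \<in> D A" unfolding D_def mem_Collect_eq eq by (rule dvd_sum)
  next
    assume "\<theta> \<in> D A"
    then have dv: "defining_poly A dvd (\<Sum>H\<in>A. ?t H)" by (simp add: D_def eq)
    show "\<forall>H\<in>A. line_form H dvd pair (line_covec H) \<theta>"
    proof
      fix H assume H: "H \<in> A"
      have pr: "prime_elem (line_form H)" using prime_line_form lines H by blast
      have "line_form H dvd (\<Sum>H\<in>A. ?t H)"
        using dv dvd_trans[OF dvd_prodI[OF fin H]] unfolding defining_poly_def by blast
      moreover have "(\<Sum>H\<in>A. ?t H) = ?t H + (\<Sum>K\<in>A-{H}. ?t K)"
        by (rule sum.remove[OF fin H])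
      moreover have "line_form H dvd (\<Sum>K\<in>A-{H}. ?t K)"
        by (rule dvd_sum, rule dvd_mult, rule dvd_prodI) (use fin H in auto)
      ultimately have "line_form H dvd ?t H" by (simp add: dvd_add_left_iff)
      moreover have "\<not> line_form H dvd prod line_form (A - {H})"
      proof
        assume "line_form H dvd prod line_form (A - {H})"
        then obtain K where "K \<in> A - {H}" "line_form H dvd line_form K"
          using prime_elem_dvd_prodD[OF pr] by blast
        then show False using line_form_dvd lines H by blast
      qed
      ultimately show "line_form H dvd pair (line_covec H) \<theta>"
        using prime_elem_dvd_multD[OF pr] by blast
    qed
  qed
qed

text \<open>Each prime divides \<open>Y * Z\<close> but not \<open>Y\<close>, so it can be split off
  \<open>Z\<close>. The family may repeat a prime, which allows powers: \<open>cocycle_form\<close>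
  applies it to \<open>j\<close> copies of \<open>var 1\<close>.\<close>

lemma prime_prod_dvd_cancel:
  fixes Y :: "'a::idom"
  assumes "finite S" "\<And>s. s \<in> S \<Longrightarrow> prime_elem (\<pi> s)" "\<And>s. s \<in> S \<Longrightarrow> \<not> \<pi> s dvd Y"
    "prod \<pi> S dvd Y * Z"
  shows "prod \<pi> S dvd Z"
  using assms
proof (induction S arbitrary: Z rule: finite_induct)
  case (insert s S)
  have "\<pi> s dvd Y * Z" using insert.prems(3) insert.hyps by (auto dest: dvd_mult_left)
  then have "\<pi> s dvd Z" using insert.prems prime_elem_dvd_multD[of "\<pi> s" Y Z] by blast
  then obtain Z' where Z': "Z = \<pi> s * Z'" ..
  have "\<pi> s * prod \<pi> S dvd \<pi> s * (Y * Z')"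
    using insert.prems(3) insert.hyps Z' by (simp add: ac_simps)
  moreover have "\<pi> s \<noteq> 0" using insert.prems(1)[of s] by auto
  ultimately have "prod \<pi> S dvd Z'" using insert.IH[of Z'] insert.prems by simp
  then show ?case using insert.hyps Z' by simp
qed simp

text \<open>Primes need to be nonassociated only across different blocks \<open>F i\<close>. Within
  a block they may be associated, as are the restrictions to \<open>L\<close> of lines through one
  point, so each block has to divide as a whole.\<close>

lemma prime_prods_dvd:
  fixes X :: "'a::idom"
  assumes "finite I" "\<And>i. i \<in> I \<Longrightarrow> finite (F i)"
    "\<And>i s. i \<in> I \<Longrightarrow> s \<in> F i \<Longrightarrow> prime_elem (\<pi> s)"
    "\<And>i j s t. i \<in> I \<Longrightarrow> j \<in> I \<Longrightarrow> i \<noteq> j \<Longrightarrow> s \<in> F i \<Longrightarrow> t \<in> F j \<Longrightarrow> \<not> \<pi> s dvd \<pi> t"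
    "\<And>i. i \<in> I \<Longrightarrow> prod \<pi> (F i) dvd X"
  shows "(\<Prod>i\<in>I. prod \<pi> (F i)) dvd X"
  using assms
proof (induction I rule: finite_induct)
  case (insert i I)
  let ?Y = "\<Prod>j\<in>I. prod \<pi> (F j)"
  have "?Y dvd X"
  proof (rule insert.IH)
    show "\<not> \<pi> s dvd \<pi> t" if "k \<in> I" "j \<in> I" "k \<noteq> j" "s \<in> F k" "t \<in> F j" for k j s t
      using insert.prems(3)[of k j s t] that by simp
    show "prime_elem (\<pi> s)" if "j \<in> I" "s \<in> F j" for j s using insert.prems(2)[of j s] that by simp
  qed (use insert.prems(1,4) in simp_all)
  then obtain Z where Z: "X = ?Y * Z" ..
  have "prod \<pi> (F i) dvd Z"
  proof (rule prime_prod_dvd_cancel)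
    fix s assume s: "s \<in> F i"
    show "prime_elem (\<pi> s)" using insert.prems(2) s by blast
    show "\<not> \<pi> s dvd ?Y"
    proof
      assume "\<pi> s dvd ?Y"
      then obtain j where j: "j \<in> I" "\<pi> s dvd prod \<pi> (F j)"
        using prime_elem_dvd_prodD \<open>prime_elem (\<pi> s)\<close> by blast
      then obtain t where "t \<in> F j" "\<pi> s dvd \<pi> t"
        using prime_elem_dvd_prodD \<open>prime_elem (\<pi> s)\<close> by blast
      then show False using insert.prems(3)[of i j s t] j s insert.hyps by auto
    qed
  qed (use insert.prems Z in auto)
  then show ?case using insert.hyps Z by (simp add: mult.commute mult_dvd_mono)
qed simp

lemma primes_dvd:
  fixes X :: "'a::idom"
  assumes "finite I" "\<And>i. i \<in> I \<Longrightarrow> prime_elem (\<pi> i)"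
    "\<And>i j. i \<in> I \<Longrightarrow> j \<in> I \<Longrightarrow> i \<noteq> j \<Longrightarrow> \<not> \<pi> i dvd \<pi> j"
    "\<And>i. i \<in> I \<Longrightarrow> \<pi> i dvd X"
  shows "prod \<pi> I dvd X"
  using prime_prods_dvd[of I "\<lambda>i. {i}" \<pi> X] assms by simp

section \<open>Ideals without common zero on the line\<close>

definition ideal_R :: "'k::comm_ring_1 R set \<Rightarrow> bool" where
  "ideal_R I \<longleftrightarrow> 0 \<in> I \<and> (\<forall>x\<in>I. \<forall>y\<in>I. x + y \<in> I) \<and> (\<forall>r. \<forall>x\<in>I. r * x \<in> I)"

text \<open>Every nontrivial monomial has a variable as a factor. The application is to forms
  \<open>g\<close> of positive degree.\<close>

lemma no_constant_term:
  fixes g :: "'k::comm_ring_1 R"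
  assumes "Poly_Mapping.lookup g 0 = 0"
  shows "\<exists>h. g = (\<Sum>i\<in>UNIV. var i * h i)"
proof -
  have "\<exists>h. p - const (Poly_Mapping.lookup p 0) = (\<Sum>i\<in>UNIV. var i * h i)" for p :: "'k R"
  proof (induction p rule: R_induct)
    case (single m c)
    show ?case
    proof (cases "m = 0")
      case True
      then show ?thesis by (intro exI[of _ "\<lambda>_. 0"]) (simp add: const_def)
    next
      case False
      then obtain i where i: "Poly_Mapping.lookup m i \<noteq> 0"
        using poly_mapping_eqI[of m 0] by auto
      have m: "m = Poly_Mapping.single i 1 + (m - Poly_Mapping.single i 1)"
      proof (rule poly_mapping_eqI)
        fix k
        show "Poly_Mapping.lookup m k = Poly_Mapping.lookup (Poly_Mapping.single i 1 + (m - Poly_Mapping.single i 1)) k"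
          using i unfolding lookup_add lookup_minus lookup_single when_def by (cases "i = k") simp_all
      qed
      let ?y = "Poly_Mapping.single (m - Poly_Mapping.single i 1) c"
      have "Poly_Mapping.single m c = var i * ?y"
        by (subst m) (simp only: var_def mult_single mult_1)
      also have "\<dots> = (\<Sum>j\<in>UNIV. var j * (if j = i then ?y else 0))"
        by (simp only: if_distrib[of "\<lambda>x. _ * x"] mult_zero_right sum.delta finite UNIV_I if_True)
      finally have e: "Poly_Mapping.single m c = (\<Sum>j\<in>UNIV. var j * (if j = i then ?y else 0))" .
      have "Poly_Mapping.lookup (Poly_Mapping.single m c) 0 = 0"
        using False by (simp add: lookup_single)
      then show ?thesis
        by (intro exI[of _ "\<lambda>j. if j = i then ?y else 0"]) (simp only: const_0 diff_zero e[symmetric])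
    qed
  next
    case (add p q)
    then obtain h h' where h: "p - const (Poly_Mapping.lookup p 0) = (\<Sum>i\<in>UNIV. var i * h i)"
      "q - const (Poly_Mapping.lookup q 0) = (\<Sum>i\<in>UNIV. var i * h' i)" by blast
    have 1: "(\<Sum>i\<in>UNIV. var i * (h i + h' i)) = (\<Sum>i\<in>UNIV. var i * h i) + (\<Sum>i\<in>UNIV. var i * h' i)"
      by (simp only: distrib_left sum.distrib)
    have 2: "p + q - const (Poly_Mapping.lookup (p + q) 0) =
        (p - const (Poly_Mapping.lookup p 0)) + (q - const (Poly_Mapping.lookup q 0))"
      by (simp only: lookup_add const_add add_diff_add)
    show ?case unfolding 2 h 1[symmetric] by (rule exI[of _ "\<lambda>i. h i + h' i"]) (rule refl)
  qed
  from this[of g] show ?thesis unfolding assms const_0 diff_zero .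
qed

context frame
begin

lemma pair_expand:
  "pair d \<theta> = const (dot d p) * pair a \<theta> + const (dot d q) * pair b \<theta> + const (dot d r) * pair c \<theta>"
proof -
  have "d $ j = dot d p * a $ j + dot d q * b $ j + dot d r * c $ j" for j
  proof -
    have "dot d (axis j 1) = dot d (dot a (axis j 1) *s p + dot b (axis j 1) *s q + dot c (axis j 1) *s r)"
      by (rule arg_cong[OF expand])
    then show ?thesis by (simp add: dot_add dot_smult mult.commute)
  qed
  then have "const (d $ j) = const (dot d p) * const (a $ j) + const (dot d q) * const (b $ j)
     + const (dot d r) * const (c $ j)" for j
    by (metis const_add const_mult)
  then show ?thesis
    by (simp add: pair_def sum_distrib_left ring_distribs sum.distrib ac_simps)
qed

lemma component_expand:
  "\<theta> $ i = const (p $ i) * pair a \<theta> + const (q $ i) * pair b \<theta> + const (r $ i) * pair c \<theta>"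
proof -
  have "pair (axis i 1) \<theta> = (\<Sum>j\<in>UNIV. if j = i then \<theta> $ j else 0)"
    unfolding pair_def by (rule sum.cong) (auto simp: axis_def)
  then show ?thesis using pair_expand[of "axis i 1" \<theta>] by simp
qed

text \<open>Three independent linear forms generate the same ideal as the variables.\<close>

lemma generate:
  assumes "Poly_Mapping.lookup g 0 = 0"
  obtains x y z where "g = linear_form a * x + linear_form b * y + linear_form c * z"
proof -
  obtain h where h: "g = (\<Sum>i\<in>UNIV. var i * h i)" using no_constant_term[OF assms] by blast
  have "var i = linear_form a * const (p $ i) + linear_form b * const (q $ i) + linear_form c * const (r $ i)" for i
    using linear_form_expand[of "axis i 1"] by (simp add: linear_form_axis mult.commute)
  then have "g = (\<Sum>i\<in>UNIV. (linear_form a * const (p $ i) + linear_form b * const (q $ i) + linear_form c * const (r $ i)) * h i)"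
    using h by simp
  also have "\<dots> = linear_form a * (\<Sum>i\<in>UNIV. const (p $ i) * h i) + linear_form b * (\<Sum>i\<in>UNIV. const (q $ i) * h i)
      + linear_form c * (\<Sum>i\<in>UNIV. const (r $ i) * h i)"
    unfolding sum_distrib_left sum.distrib[symmetric]
    by (rule sum.cong) (simp_all only: distrib_right mult.assoc)
  finally show ?thesis using that by blast
qed

end

locale line_frame = frame a b c p q r for a b c p q r :: "'k::field ^ 3" +
  fixes L :: "('k ^ 3) set"
  assumes L: "is_line L" and c: "c = line_covec L"
begin

lemma L_iff: "x \<in> L \<longleftrightarrow> dot c x = 0"
  using line_covec[OF L] c by blast

lemma line_form_L: "line_form L = linear_form c"
  by (simp add: line_form_covec c)

abbreviation "\<alpha> \<equiv> linear_form c"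

lemma prime_\<alpha>: "prime_elem \<alpha>" by (rule prime_linear_form)

lemma not_\<alpha>_dvd: "is_line H \<Longrightarrow> H \<noteq> L \<Longrightarrow> \<not> \<alpha> dvd line_form H"
  using line_form_dvd[OF L] line_form_L by auto

lemma covec_pq:
  assumes "is_line H" "H \<noteq> L"
  shows "dot (line_covec H) p \<noteq> 0 \<or> dot (line_covec H) q \<noteq> 0"
proof (rule ccontr)
  assume "\<not> ?thesis"
  then have "toL (linear_form (line_covec H)) = 0" by (simp add: toL_linear_form)
  then have "\<alpha> dvd line_form H" by (simp add: dvd_iff_toL line_form_covec)
  then show False using not_\<alpha>_dvd assms by blast
qed

lemma meet_iff: "x \<in> H \<inter> L \<longleftrightarrow> x = dot a x *s p + dot b x *s q \<and>
    dot a x * dot (line_covec H) p + dot b x * dot (line_covec H) q = 0" if "is_line H"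
proof -
  have "x \<in> L \<longleftrightarrow> x = dot a x *s p + dot b x *s q"
  proof
    assume "x \<in> L"
    then show "x = dot a x *s p + dot b x *s q" using expand[of x] L_iff by simp
  next
    assume "x = dot a x *s p + dot b x *s q"
    then have "dot c x = dot c (dot a x *s p + dot b x *s q)" by (rule arg_cong)
    then show "x \<in> L" by (simp add: L_iff dot_add dot_smult)
  qed
  moreover have "x \<in> H \<longleftrightarrow> dot a x * dot (line_covec H) p + dot b x * dot (line_covec H) q = 0"
    if "x = dot a x *s p + dot b x *s q"
  proof -
    have "x \<in> H \<longleftrightarrow> dot (line_covec H) x = 0" using line_covec[OF \<open>is_line H\<close>] by blast
    also have "dot (line_covec H) x = dot (line_covec H) (dot a x *s p + dot b x *s q)"
      by (rule arg_cong[OF that])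
    finally show ?thesis by (simp add: dot_add dot_smult)
  qed
  ultimately show ?thesis by auto
qed

text \<open>For \<open>H \<noteq> L\<close> a vector spanning the point \<open>H \<inter> L\<close>:
  on the span of \<open>p\<close>, \<open>q\<close> the equation of \<open>H\<close> has two
  coefficients, and exchanging them with one sign changed gives a zero.\<close>

definition vtx :: "('k ^ 3) set \<Rightarrow> 'k ^ 3" where
  "vtx H = dot (line_covec H) q *s p - dot (line_covec H) p *s q"

lemma dot_vtx [simp]: "dot a (vtx H) = dot (line_covec H) q" "dot b (vtx H) = - dot (line_covec H) p"
  "dot c (vtx H) = 0"
  by (simp_all add: vtx_def dot_diff dot_smult)

lemma dot_covec_vtx: "dot d (vtx H) = dot (line_covec H) q * dot d p - dot (line_covec H) p * dot d q"
  by (simp add: vtx_def dot_diff dot_smult)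

lemma meet_eq_iff:
  assumes "is_line H" "H \<noteq> L" "is_line H'" "H' \<noteq> L"
  shows "H \<inter> L = H' \<inter> L \<longleftrightarrow> dot (line_covec H') (vtx H) = 0"
proof
  assume eq: "H \<inter> L = H' \<inter> L"
  have "dot (line_covec H) (vtx H) = 0" by (simp add: dot_covec_vtx)
  then have "vtx H \<in> H" using line_covec[OF assms(1)] by blast
  moreover have "vtx H \<in> L" by (simp add: L_iff)
  ultimately have "vtx H \<in> H'" using eq by blast
  then show "dot (line_covec H') (vtx H) = 0" using line_covec[OF assms(3)] by blast
next
  assume "dot (line_covec H') (vtx H) = 0"
  then have e: "dot (line_covec H) q * dot (line_covec H') p = dot (line_covec H) p * dot (line_covec H') q"
    unfolding dot_covec_vtx by (simp only: right_minus_eq)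
  have e': "dot (line_covec H') q * dot (line_covec H) p = dot (line_covec H') p * dot (line_covec H) q"
    unfolding mult.commute[of "dot (line_covec H') q"] mult.commute[of "dot (line_covec H') p"]
    by (rule e[symmetric])
  \<comment> \<open>Proportional coefficient pairs have the same zeros: the new equation times
    \<open>u\<close>, and times \<open>v\<close>, is a multiple of the old one, and one of
    \<open>u\<close>, \<open>v\<close> is nonzero.\<close>
  have imp: "s * u' + t * v' = 0"
    if e: "v * u' = u * v'" and nz: "u \<noteq> 0 \<or> v \<noteq> 0" and 0: "s * u + t * v = 0" for s t u v u' v' :: 'k
  proof -
    have "u * (s * u' + t * v') = s * u * u' + t * (u * v')" by (simp add: algebra_simps)
    also have "\<dots> = s * u * u' + t * (v * u')" by (simp only: e)
    also have "\<dots> = u' * (s * u + t * v)" by (simp add: algebra_simps)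
    finally have 1: "u * (s * u' + t * v') = 0" using 0 by simp
    have "v * (s * u' + t * v') = s * (v * u') + t * v * v'" by (simp add: algebra_simps)
    also have "\<dots> = s * (u * v') + t * v * v'" by (simp only: e)
    also have "\<dots> = v' * (s * u + t * v)" by (simp add: algebra_simps)
    finally have 2: "v * (s * u' + t * v') = 0" using 0 by simp
    show ?thesis using nz 1 2 by auto
  qed
  show "H \<inter> L = H' \<inter> L"
  proof (rule Set.set_eqI)
    fix x
    have "dot a x * dot (line_covec H) p + dot b x * dot (line_covec H) q = 0 \<longleftrightarrow>
        dot a x * dot (line_covec H') p + dot b x * dot (line_covec H') q = 0"
      using imp[OF e covec_pq[OF assms(1,2)], of "dot a x" "dot b x"]
        imp[OF e' covec_pq[OF assms(3,4)], of "dot a x" "dot b x"] by blast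
    then show "x \<in> H \<inter> L \<longleftrightarrow> x \<in> H' \<inter> L"
      unfolding meet_iff[OF assms(1)] meet_iff[OF assms(3)] by (simp only:)
  qed
qed

text \<open>Both equations restrict to nonzero forms on \<open>L\<close> with the same zero;
  \<open>t\<close> is the quotient of their coefficients at a place where the first does not
  vanish.\<close>

lemma pencil_covec:
  assumes "is_line H" "H \<noteq> L" "is_line H'" "H' \<noteq> L" "H \<inter> L = H' \<inter> L"
  obtains t where "t \<noteq> 0" "dot (line_covec H') p = t * dot (line_covec H) p"
    "dot (line_covec H') q = t * dot (line_covec H) q"
proof -
  let ?d = "line_covec H" and ?e = "line_covec H'"
  have e: "dot ?d q * dot ?e p = dot ?d p * dot ?e q"
    using iffD1[OF meet_eq_iff[OF assms(1-4)] assms(5)] unfolding dot_covec_vtx by (simp only: right_minus_eq)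
  from covec_pq[OF assms(1,2)] show ?thesis
  proof
    assume nz: "dot ?d p \<noteq> 0"
    then have "dot ?e p \<noteq> 0" using e covec_pq[OF assms(3,4)] by auto
    moreover have "dot ?e q = dot ?e p / dot ?d p * dot ?d q"
      unfolding times_divide_eq_left by (rule eq_divide_imp[OF nz]) (simp only: mult.commute[of _ "dot ?d p"] mult.commute[of _ "dot ?d q"] e)
    ultimately show ?thesis using nz that[of "dot ?e p / dot ?d p"] by simp
  next
    assume nz: "dot ?d q \<noteq> 0"
    then have "dot ?e q \<noteq> 0" using e covec_pq[OF assms(3,4)] by auto
    moreover have "dot ?e p = dot ?e q / dot ?d q * dot ?d p"
      unfolding times_divide_eq_left by (rule eq_divide_imp[OF nz]) (simp only: mult.commute[of _ "dot ?d p"] mult.commute[of _ "dot ?d q"] e[symmetric])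
    ultimately show ?thesis using nz that[of "dot ?e q / dot ?d q"] by simp
  qed
qed

lemma toL_prime:
  assumes "is_line H" "H \<noteq> L"
  shows "prime_elem (toL (line_form H))"
proof -
  let ?d = "line_covec H"
  have "toL (line_form H) = linear_form (dot ?d p *s axis 1 1 + dot ?d q *s axis 2 1)"
    by (simp add: line_form_covec toL_linear_form linear_form_add linear_form_smult linear_form_axis)
  moreover have "dot ?d p *s axis 1 1 + dot ?d q *s axis 2 1 \<noteq> (0 :: 'k^3)"
    using covec_pq[OF assms] by (auto simp: Finite_Cartesian_Product.vec_eq_iff forall_3 axis_def)
  ultimately show ?thesis by (metis prime_elem_linear_form)
qed

text \<open>The restricted form of \<open>H\<close> vanishes at the coordinates of
  \<open>vtx H\<close> with respect to \<open>p\<close>, \<open>q\<close>. Divisibility makes the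
  equation of \<open>H'\<close> vanish there too.\<close>

lemma toL_dvd_imp:
  assumes "is_line H" "H \<noteq> L" "is_line H'" "H' \<noteq> L" "toL (line_form H) dvd toL (line_form H')"
  shows "H \<inter> L = H' \<inter> L"
proof -
  let ?d = "line_covec H" and ?e = "line_covec H'"
  have l: "toL (linear_form d) = linear_form (dot d p *s axis 1 1 + dot d q *s axis 2 1)" for d
    by (simp add: toL_linear_form linear_form_add linear_form_smult linear_form_axis)
  have dt: "dot (s *s axis 1 1 + t *s axis 2 1) (x *s axis 1 1 - y *s axis 2 1 :: 'k^3) = s * x - t * y"
    for s t x y :: 'k by (simp add: dot_def sum_3 axis_def)
  have "dot (dot ?e p *s axis 1 1 + dot ?e q *s axis 2 1) (dot ?d q *s axis 1 1 - dot ?d p *s axis 2 (1::'k) :: 'k^3) = 0"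
  proof (rule linear_form_dvd_imp)
    show "linear_form (dot ?d p *s axis 1 1 + dot ?d q *s axis 2 1) dvd
        linear_form (dot ?e p *s axis 1 1 + dot ?e q *s axis 2 1)"
      using assms(5) by (simp only: line_form_covec l)
  qed (simp add: dt)
  then have "dot ?e (vtx H) = 0" by (simp add: dot_covec_vtx dt mult.commute)
  then show ?thesis using meet_eq_iff[OF assms(1-4)] by blast
qed

text \<open>The three equations have only the zero vector in common, so they form a frame and
  \<open>generate\<close> applies.\<close>

lemma generate_pair:
  assumes "is_line H" "H \<noteq> L" "is_line H'" "H' \<noteq> L" "H \<inter> L \<noteq> H' \<inter> L" "Poly_Mapping.lookup g 0 = 0"
  obtains x y z where "g = line_form H * x + line_form H' * y + \<alpha> * z"
proof -
  let ?d = "line_covec H" and ?e = "line_covec H'"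
  have "\<exists>p' q' r'. frame ?d ?e c p' q' r'"
  proof (rule frame_exists[of ?d ?e c])
    fix x assume x: "dot ?d x = 0" "dot ?e x = 0" "dot c x = 0"
    have xH: "x \<in> H \<inter> L" "x \<in> H' \<inter> L"
      using x line_covec[OF assms(1)] line_covec[OF assms(3)] L_iff by blast+
    have 1: "dot a x * dot ?d p + dot b x * dot ?d q = 0" using meet_iff[OF assms(1)] xH by blast
    have 2: "dot a x * dot ?e p + dot b x * dot ?e q = 0" using meet_iff[OF assms(3)] xH by blast
    have D: "dot ?d q * dot ?e p - dot ?d p * dot ?e q \<noteq> 0"
      using meet_eq_iff[OF assms(1-4)] assms(5) by (simp add: dot_covec_vtx)
    have "dot a x * (dot ?d q * dot ?e p - dot ?d p * dot ?e q) =
        dot ?d q * (dot a x * dot ?e p + dot b x * dot ?e q) - dot ?e q * (dot a x * dot ?d p + dot b x * dot ?d q)"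
      "dot b x * (dot ?d q * dot ?e p - dot ?d p * dot ?e q) =
        dot ?e p * (dot a x * dot ?d p + dot b x * dot ?d q) - dot ?d p * (dot a x * dot ?e p + dot b x * dot ?e q)"
      by (simp_all add: algebra_simps)
    then have "dot a x = 0" "dot b x = 0" using D unfolding 1 2 by simp_all
    then show "x = 0" using expand[of x] x(3) by simp
  qed blast
  then show ?thesis using frame.generate[OF _ assms(6)] that unfolding line_form_covec by metis
qed

text \<open>Each line \<open>H\<close> of \<open>C\<close> meets \<open>L\<close> away from
  \<open>K\<close>, so \<open>g\<close> lies in the ideal of \<open>H\<close>, \<open>K\<close> and
  \<open>\<alpha>\<close>. Multiplying this representation with the one for \<open>g ^ N\<close>
  collects \<open>H\<close> in the product.\<close>

lemma power_in_pencil: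
  assumes "finite C" "\<And>H. H \<in> C \<Longrightarrow> is_line H \<and> H \<noteq> L \<and> H \<inter> L \<noteq> K \<inter> L" "is_line K" "K \<noteq> L"
    "Poly_Mapping.lookup g 0 = 0"
  shows "\<exists>N x y z. g ^ N = prod line_form C * x + line_form K * y + \<alpha> * z"
  using assms
proof (induction C rule: finite_induct)
  case empty
  show ?case by (intro exI[of _ 0] exI[of _ 1] exI[of _ "0 :: 'k R"]) simp
next
  case (insert H C)
  have "\<exists>N x y z. g ^ N = prod line_form C * x + line_form K * y + \<alpha> * z"
    by (rule insert.IH) (use insert.prems in simp_all)
  then obtain N x y z where 1: "g ^ N = prod line_form C * x + line_form K * y + \<alpha> * z" by blast
  obtain x' y' z' where 2: "g = line_form H * x' + line_form K * y' + \<alpha> * z'"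
    by (rule generate_pair[of H K g]) (use insert.prems in simp_all)
  have "g ^ Suc N = g * g ^ N" by simp
  also have "\<dots> = (line_form H * x' + (line_form K * y' + \<alpha> * z')) * (prod line_form C * x + line_form K * y + \<alpha> * z)"
    by (rule arg_cong2[of _ _ _ _ "(*)"]) (simp only: 2 add.assoc, rule 1)
  also have "\<dots> = prod line_form (insert H C) * (x * x')
      + line_form K * (line_form H * x' * y + y' * (prod line_form C * x + line_form K * y + \<alpha> * z))
      + \<alpha> * (line_form H * x' * z + z' * (prod line_form C * x + line_form K * y + \<alpha> * z))"
    unfolding prod.insert[OF insert.hyps] by (simp only: ring_distribs ac_simps)
  finally show ?case by blast
qed

text \<open>The products of the lines of \<open>C\<close> avoiding a point \<open>P\<close> of \<open>L\<close> have no common zero on \<open>L\<close>.\<close>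

lemma power_in_ideal:
  assumes "finite C" "ideal_R I" "\<alpha> \<in> I" "T \<noteq> {}"
    "\<And>H. H \<in> C \<Longrightarrow> is_line H \<and> H \<noteq> L \<and> H \<inter> L \<in> T"
    "\<And>P. P \<in> T \<Longrightarrow> prod line_form {H \<in> C. H \<inter> L \<noteq> P} \<in> I"
    "Poly_Mapping.lookup g 0 = 0"
  shows "\<exists>N. g ^ N \<in> I"
  using assms
proof (induction C arbitrary: I rule: finite_induct)
  case empty
  then have "(1 :: 'k R) \<in> I" by auto
  then show ?case by (intro exI[of _ 0]) simp
next
  case (insert K C)
  have K: "is_line K" "K \<noteq> L" "K \<inter> L \<in> T" using insert.prems(4) by auto
  have idl: "\<And>x y. x \<in> I \<Longrightarrow> y \<in> I \<Longrightarrow> x + y \<in> I" "\<And>r x. x \<in> I \<Longrightarrow> r * x \<in> I" "0 \<in> I"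
    using insert.prems(1) by (auto simp: ideal_R_def)
  \<comment> \<open>The induction hypothesis is applied to the colon ideal of \<open>I\<close> by
    the form of \<open>K\<close>. For points not on \<open>K\<close> the missing factor
    \<open>K\<close> of the product is supplied by that form.\<close>
  let ?I = "{y. line_form K * y \<in> I}"
  have "\<exists>N. g ^ N \<in> ?I"
  proof (rule insert.IH)
    show "ideal_R ?I" unfolding ideal_R_def
      using idl by (auto simp: ring_distribs mult.left_commute[of "line_form K"])
    show "\<alpha> \<in> ?I" using idl(2) insert.prems(2) by simp
    fix P assume P: "P \<in> T"
    show "prod line_form {H \<in> C. H \<inter> L \<noteq> P} \<in> ?I"
    proof (cases "K \<inter> L = P")
      case True
      then have "{H \<in> insert K C. H \<inter> L \<noteq> P} = {H \<in> C. H \<inter> L \<noteq> P}" by auto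
      then show ?thesis using insert.prems(5)[OF P] idl(2) by simp
    next
      case False
      then have "{H \<in> insert K C. H \<inter> L \<noteq> P} = insert K {H \<in> C. H \<inter> L \<noteq> P}" by auto
      then show ?thesis using insert.prems(5)[OF P] insert.hyps by simp
    qed
  qed (use insert.prems in auto)
  then obtain N where N: "line_form K * g ^ N \<in> I" by blast
  let ?C = "{H \<in> insert K C. H \<inter> L \<noteq> K \<inter> L}"
  obtain M x y z where M: "g ^ M = prod line_form ?C * x + line_form K * y + \<alpha> * z"
  proof -
    have "\<exists>M x y z. g ^ M = prod line_form ?C * x + line_form K * y + \<alpha> * z"
      by (rule power_in_pencil) (use insert.prems(4,6) insert.hyps K in auto)
    then show ?thesis using that by blast
  qed
  \<comment> \<open>Of the three summands, the first contains the product avoiding the point of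
    \<open>K\<close>, the second the element \<open>line_form K * g ^ N\<close> of \<open>I\<close>
    found above, the third \<open>\<alpha>\<close>.\<close>
  have "g ^ (N + M) = g ^ N * (prod line_form ?C * x + line_form K * y + \<alpha> * z)"
    by (simp only: power_add M)
  also have "\<dots> = (g ^ N * x) * prod line_form ?C + y * (line_form K * g ^ N) + (g ^ N * z) * \<alpha>"
    by (simp only: ring_distribs ac_simps)
  also have "\<dots> \<in> I" by (intro idl(1,2) N insert.prems(2) insert.prems(5)[OF K(3)])
  finally show ?case by blast
qed

end

section \<open>Derivations modulo a line\<close>

definition hcompv :: "int \<Rightarrow> 'k::comm_ring_1 R ^ 'n::finite \<Rightarrow> 'k R ^ 'n" where
  "hcompv e x = (\<chi> i. hcomp e (x $ i))"

definition submod :: "('k::comm_ring_1 R ^ 'n::finite) set \<Rightarrow> bool" where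
  "submod N \<longleftrightarrow> 0 \<in> N \<and> (\<forall>x\<in>N. \<forall>y\<in>N. x + y \<in> N) \<and> (\<forall>r. \<forall>x\<in>N. r *s x \<in> N)"

definition graded :: "('k::comm_ring_1 R ^ 'n::finite) set \<Rightarrow> bool" where
  "graded N \<longleftrightarrow> (\<forall>e. \<forall>x\<in>N. hcompv e x \<in> N)"

lemma submodD:
  assumes "submod N"
  shows "0 \<in> N" "x \<in> N \<Longrightarrow> y \<in> N \<Longrightarrow> x + y \<in> N" "x \<in> N \<Longrightarrow> r *s x \<in> N"
  using assms by (auto simp: submod_def)

lemma submod_D:
  assumes "arrangement A"
  shows "submod (D A)"
  unfolding submod_def by (auto simp: D_iff[OF assms] pair_add pair_smult intro!: dvd_add dvd_mult)

lemma graded_D: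
  fixes A :: "('k::field ^ 3) set set"
  assumes "arrangement A"
  shows "graded (D A)"
  unfolding graded_def
proof (intro allI ballI)
  fix e x assume x: "x \<in> D A"
  have "line_form H dvd pair (line_covec H) (hcompv e x)" if "H \<in> A" for H
  proof -
    have "line_form H dvd pair (line_covec H) x" using D_iff[OF assms] x that by blast
    then obtain y where "pair (line_covec H) x = linear_form (line_covec H) * y"
      unfolding line_form_covec by (elim dvdE)
    then have "hcomp e (pair (line_covec H) x) = linear_form (line_covec H) * hcomp (e - 1) y"
      by (simp only: hcomp_mult[OF homog_linear_form])
    then have "pair (line_covec H) (hcompv e x) = line_form H * hcomp (e - 1) y"
      unfolding hcompv_def hcomp_pair line_form_covec .
    then show ?thesis by simp
  qed
  then show "hcompv e x \<in> D A" unfolding D_iff[OF assms] by blast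
qed

lemma const_dvd_cancel:
  fixes u :: "'k::field"
  assumes "u \<noteq> 0" "d dvd const u * x"
  shows "d dvd x"
proof -
  have "d dvd const (inverse u) * (const u * x)" using assms(2) by (rule dvd_mult)
  also have "const (inverse u) * (const u * x) = const (inverse u * u) * x"
    by (simp only: const_mult mult.assoc)
  finally show ?thesis using assms(1) by simp
qed

lemma prime_not_dvd_prod:
  assumes "prime_elem \<pi>" "\<And>s. s \<in> S \<Longrightarrow> \<not> \<pi> dvd f s"
  shows "\<not> \<pi> dvd prod f S"
  using prime_elem_dvd_prodD[OF assms(1)] assms(2) by blast

text \<open>The derivation with constant coefficients in the direction \<open>w\<close>. The
  explicit elements of \<open>D\<close> constructed below are such derivations multiplied by
  products of lines.\<close>

definition const_vec :: "'k::zero ^ 3 \<Rightarrow> 'k R ^ 3" where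
  "const_vec w = (\<chi> i. const (w $ i))"

lemma pair_const_vec: "pair d (const_vec w) = const (dot d w)"
  by (simp add: pair_def const_vec_def dot_def const_sum const_mult)

context frame
begin

text \<open>The quotient found on the line is lifted by \<open>ofL\<close>; replacing
  \<open>X\<close> and \<open>f\<close> by the lifts of their restrictions costs only multiples of
  \<open>linear_form c\<close>.\<close>

lemma toL_dvd_lift:
  assumes "toL f dvd toL X"
  shows "\<exists>y. linear_form c dvd X - f * y"
proof -
  from assms obtain y where y: "toL X = toL f * y" ..
  have "ofL (toL X) = ofL (toL f) * ofL y" unfolding y by (rule ofL_hom)
  then have "X - f * ofL y = (X - ofL (toL X)) - (f - ofL (toL f)) * ofL y"
    by (simp add: algebra_simps)
  also have "linear_form c dvd \<dots>" by (intro dvd_diff dvd_mult2 dvd_diff_ofL_toL)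
  finally show ?thesis by blast
qed

text \<open>The determinant of the values of \<open>\<theta>\<close> and of the Euler derivation on
  \<open>a\<close> and \<open>b\<close>, so it vanishes on multiples of
  \<open>euler\<close>.\<close>

definition lam :: "'k R ^ 3 \<Rightarrow> 'k R" where
  "lam \<theta> = pair a \<theta> * linear_form b - pair b \<theta> * linear_form a"

lemma lam_add: "lam (\<theta> + \<eta>) = lam \<theta> + lam \<eta>"
  by (simp add: lam_def pair_add algebra_simps)

lemma lam_smult: "lam (f *s \<theta>) = f * lam \<theta>"
  by (simp add: lam_def pair_smult algebra_simps)

lemma toL_lam: "toL (lam \<theta>) = toL (pair a \<theta>) * var 2 - toL (pair b \<theta>) * var 1"
  by (simp add: lam_def toL_hom)

lemma dvd_of_frame:
  assumes "linear_form c dvd pair a \<theta>" "linear_form c dvd pair b \<theta>" "linear_form c dvd pair c \<theta>"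
  obtains \<eta> where "\<theta> = linear_form c *s \<eta>"
proof -
  have "linear_form c dvd \<theta> $ i" for i
    unfolding component_expand[of \<theta> i] using assms by (intro dvd_add dvd_mult)
  then have "\<forall>i. \<exists>y. \<theta> $ i = linear_form c * y" by (auto simp: dvd_def)
  then obtain y where "\<And>i. \<theta> $ i = linear_form c * y i" by metis
  then have "\<theta> = linear_form c *s (\<chi> i. y i)"
    by (simp add: Finite_Cartesian_Product.vec_eq_iff)
  then show ?thesis using that by blast
qed

text \<open>On the line, \<open>\<theta>(a) v = \<theta>(b) u\<close> with \<open>u\<close>,
  \<open>v\<close> coprime makes the pair of values a multiple \<open>h\<close> of
  \<open>(u, v)\<close>. Subtracting \<open>h *s euler\<close> leaves a derivation whose values on
  the whole frame are divisible by the form.\<close>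

lemma lam_dvd_imp:
  assumes "linear_form c dvd lam \<theta>" "linear_form c dvd pair c \<theta>"
  obtains h \<eta> where "\<theta> = h *s euler + linear_form c *s \<eta>"
proof -
  have eq: "toL (pair a \<theta>) * var 2 = toL (pair b \<theta>) * var 1"
    using assms(1) by (simp add: dvd_iff_toL toL_lam)
  have pr: "prime_elem (var 1 :: 'k R)"
    unfolding linear_form_axis[symmetric]
    by (rule prime_elem_linear_form) (simp add: axis_eq_0_iff)
  have "\<not> var 1 dvd (var 2 :: 'k R)"
  proof
    assume "var 1 dvd (var 2 :: 'k R)"
    then have "linear_form (axis 1 1) dvd (linear_form (axis 2 1) :: 'k R)" by (simp add: linear_form_axis)
    from linear_form_dvd_imp[OF this, of "axis 2 1"] show False unfolding dot_axis by (simp add: axis_def)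
  qed
  moreover have "var 1 dvd toL (pair a \<theta>) * var 2" unfolding eq by simp
  ultimately have "var 1 dvd toL (pair a \<theta>)" using prime_elem_dvd_multD[OF pr] by blast
  then obtain h' where h': "toL (pair a \<theta>) = var 1 * h'" ..
  have "var 1 * (h' * var 2) = var 1 * toL (pair b \<theta>)"
    using eq unfolding h' by (simp only: ac_simps)
  then have h'': "toL (pair b \<theta>) = h' * var 2" using prime_elem_not_zeroI[OF pr] by simp
  define h where "h = ofL h'"
  define \<zeta> where "\<zeta> = \<theta> - h *s euler"
  have o: "ofL (var 1) = linear_form a" "ofL (var 2) = linear_form b" by (simp_all add: ofL_def)
  have "ofL (toL (pair a \<theta>)) = h * linear_form a" unfolding h' ofL_hom o h_def by (rule mult.commute)
  then have 1: "linear_form c dvd pair a \<zeta>"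
    using dvd_diff_ofL_toL[of "pair a \<theta>"] by (simp add: \<zeta>_def pair_diff pair_smult pair_euler)
  have "ofL (toL (pair b \<theta>)) = h * linear_form b" unfolding h'' ofL_hom o h_def by (rule refl)
  then have 2: "linear_form c dvd pair b \<zeta>"
    using dvd_diff_ofL_toL[of "pair b \<theta>"] by (simp add: \<zeta>_def pair_diff pair_smult pair_euler)
  have 3: "linear_form c dvd pair c \<zeta>"
    using assms(2) by (simp add: \<zeta>_def pair_diff pair_smult pair_euler)
  obtain \<eta> where "\<zeta> = linear_form c *s \<eta>" using dvd_of_frame[OF 1 2 3] .
  then have "\<theta> = h *s euler + linear_form c *s \<eta>" by (simp add: \<zeta>_def algebra_simps)
  then show ?thesis using that by blast
qed

end

section \<open>The modules \<open>D A\<close> and \<open>D (insert L A)\<close> modulo the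
  line\<close>

locale arr_frame = line_frame a b c p q r L for a b c p q r :: "'k::field ^ 3" and L +
  fixes A :: "('k ^ 3) set set"
  assumes arr: "arrangement A" and LA: "L \<notin> A" and ne: "A \<noteq> {}"
begin

lemma finA: "finite A" and lines: "H \<in> A \<Longrightarrow> is_line H" and nL: "H \<in> A \<Longrightarrow> H \<noteq> L"
  using arr LA by (auto simp: arrangement_def)

definition rep :: "('k ^ 3) set \<Rightarrow> ('k ^ 3) set" where
  "rep P = (SOME H. H \<in> A \<and> H \<inter> L = P)"

definition reps where "reps = rep ` restriction A L"

lemma rep: "P \<in> restriction A L \<Longrightarrow> rep P \<in> A \<and> rep P \<inter> L = P"
  unfolding rep_def by (rule someI_ex) (auto simp: restriction_def)

lemma meet_in: "H \<in> A \<Longrightarrow> H \<inter> L \<in> restriction A L"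
  by (auto simp: restriction_def)

lemma reps_sub: "reps \<subseteq> A" using rep by (auto simp: reps_def)

lemma fin_reps: "finite reps" using reps_sub finA finite_subset by blast

lemma rep_unique: "H \<in> reps \<Longrightarrow> H = rep (H \<inter> L)"
  using rep by (auto simp: reps_def)

lemma rep_in: "P \<in> restriction A L \<Longrightarrow> rep P \<in> reps" by (simp add: reps_def)

lemma card_reps: "card reps = card (restriction A L)"
  unfolding reps_def by (rule card_image) (metis inj_onI rep)

lemma ne_restr: "restriction A L \<noteq> {}" using ne by (simp add: restriction_def)

text \<open>A lift of Q'' to \<open>R\<close>, up to a constant: which line represents a point of
  \<open>A''\<close> does not matter on \<open>L\<close>. The degrees of \<open>Q2\<close> and of
  its cofactor \<open>Q1\<close> in the defining polynomial determine the twists of the two line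
  bundles.\<close>

definition Q2 where "Q2 = prod line_form reps"
definition Q1 where "Q1 = prod line_form (A - reps)"

lemma homog_Q2: "homog (int (card (restriction A L))) Q2"
  using homog_prod[of reps "\<lambda>_. 1" line_form] unfolding Q2_def card_reps[symmetric]
  by (simp add: line_form_covec)

lemma homog_Q1: "homog (int (card A) - int (card (restriction A L))) Q1"
proof -
  have "card (A - reps) = card A - card reps" using fin_reps reps_sub by (rule card_Diff_subset)
  moreover have "card reps \<le> card A" using finA reps_sub by (rule card_mono)
  ultimately have "int (card A) - int (card (restriction A L)) = int (card (A - reps))"
    by (simp add: card_reps)
  then show ?thesis
    using homog_prod[of "A - reps" "\<lambda>_. 1" line_form] unfolding Q1_def by (simp add: line_form_covec)
qed

lemma Q2_ndvd: "\<not> \<alpha> dvd Q2" unfolding Q2_def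
  by (rule prime_not_dvd_prod[OF prime_\<alpha>]) (use not_\<alpha>_dvd lines nL reps_sub in blast)

lemma Q1_ndvd: "\<not> \<alpha> dvd Q1" unfolding Q1_def
  by (rule prime_not_dvd_prod[OF prime_\<alpha>]) (use not_\<alpha>_dvd lines nL in blast)

lemma arr_insert: "arrangement (insert L A)"
  using arr L by (simp add: arrangement_def)

lemma D_insert: "D (insert L A) = {\<theta> \<in> D A. \<alpha> dvd pair c \<theta>}"
  by (rule Set.set_eqI) (simp add: D_iff[OF arr] D_iff[OF arr_insert] line_form_L c[symmetric] conj_commute)

lemma D_dvd: "\<theta> \<in> D A \<Longrightarrow> H \<in> A \<Longrightarrow> line_form H dvd pair (line_covec H) \<theta>"
  using D_iff[OF arr] by blast

text \<open>The form of a line of \<open>A\<close> is prime and does not divide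
  \<open>\<alpha>\<close>, so \<open>\<alpha>\<close> cancels in each condition of
  \<open>D_iff\<close>.\<close>

lemma \<alpha>_smult_D_imp:
  assumes "\<alpha> *s \<eta> \<in> D A"
  shows "\<eta> \<in> D A"
  unfolding D_iff[OF arr]
proof
  fix H assume H: "H \<in> A"
  have "line_form H dvd \<alpha> * pair (line_covec H) \<eta>"
    using D_dvd[OF assms H] by (simp add: pair_smult)
  moreover have "\<not> line_form H dvd \<alpha>"
    using line_form_dvd[OF lines[OF H] L] nL[OF H] line_form_L by auto
  ultimately show "line_form H dvd pair (line_covec H) \<eta>"
    using prime_elem_dvd_multD[OF prime_line_form[OF lines[OF H]]] by blast
qed

text \<open>The right side is what is divided out in \<open>\<D>\<close> restricted to
  \<open>L\<close>, so \<open>lam\<close> modulo \<open>\<alpha>\<close> is injective on the kernel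
  sheaf. After \<open>lam_dvd_imp\<close> has split off the Euler part, the rest is
  \<open>\<alpha>\<close> times a derivation that lies in \<open>D A\<close> by
  cancellation.\<close>

lemma lam_kernel:
  "{\<theta> \<in> D (insert L A). \<alpha> dvd lam \<theta>} = range (\<lambda>f. f *s euler) + (*s) \<alpha> ` D A"
proof (rule Set.set_eqI, rule iffI)
  fix \<theta> assume "\<theta> \<in> {\<theta> \<in> D (insert L A). \<alpha> dvd lam \<theta>}"
  then have \<theta>: "\<theta> \<in> D A" "\<alpha> dvd pair c \<theta>" "\<alpha> dvd lam \<theta>" by (auto simp: D_insert)
  obtain h \<eta> where e: "\<theta> = h *s euler + \<alpha> *s \<eta>" using lam_dvd_imp[OF \<theta>(3,2)] .
  have "\<theta> + (- h) *s euler \<in> D A"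
    by (intro submodD[OF submod_D[OF arr]] \<theta>) (simp add: D_iff[OF arr] pair_euler line_form_covec)
  then have "\<alpha> *s \<eta> \<in> D A" by (simp add: e vector_smult_lneg)
  then have "\<eta> \<in> D A" by (rule \<alpha>_smult_D_imp)
  then show "\<theta> \<in> range (\<lambda>f. f *s euler) + (*s) \<alpha> ` D A" unfolding e by (intro set_plus_intro) auto
next
  fix \<theta> assume "\<theta> \<in> range (\<lambda>f. f *s euler) + (*s) \<alpha> ` D A"
  then obtain h \<eta> where e: "\<theta> = h *s euler + \<alpha> *s \<eta>" "\<eta> \<in> D A" by (auto elim!: set_plus_elim)
  have "\<theta> \<in> D A" unfolding e(1)
    by (intro submodD[OF submod_D[OF arr]] e(2)) (simp add: D_iff[OF arr] pair_euler line_form_covec)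
  moreover have "\<alpha> dvd pair c \<theta>" by (simp add: e(1) pair_add pair_smult pair_euler)
  moreover have "lam \<theta> = \<alpha> * lam \<eta>" by (simp add: e(1) lam_add lam_smult) (simp add: lam_def pair_euler)
  ultimately show "\<theta> \<in> {\<theta> \<in> D (insert L A). \<alpha> dvd lam \<theta>}" by (simp add: D_insert)
qed

lemma reps_meet: "H \<in> reps \<Longrightarrow> K \<in> reps \<Longrightarrow> H \<noteq> K \<Longrightarrow> H \<inter> L \<noteq> K \<inter> L"
  using rep_unique by metis

lemma reps_meet_iff: "H \<in> reps \<Longrightarrow> P \<in> restriction A L \<Longrightarrow> H \<inter> L = P \<longleftrightarrow> H = rep P"
  using rep_unique[of H] rep[of P] by metis

text \<open>At the point \<open>H \<inter> L\<close> the equation of \<open>H\<close> annihilates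
  both the vector of values of \<open>\<theta>\<close> and the point itself, so the two are
  dependent and their determinant vanishes. In formulas, \<open>lam \<theta>\<close> times either
  coefficient of that equation is a combination of multiples of the restricted form of
  \<open>H\<close>.\<close>

lemma lam_division:
  assumes "\<theta> \<in> D (insert L A)"
  shows "\<exists>y. \<alpha> dvd lam \<theta> - Q2 * y"
proof (rule toL_dvd_lift)
  let ?A = "toL (pair a \<theta>)" and ?B = "toL (pair b \<theta>)"
  have \<theta>: "\<theta> \<in> D A" "toL (pair c \<theta>) = 0" using assms by (auto simp: D_insert dvd_iff_toL)
  have "(\<Prod>H\<in>reps. toL (line_form H)) dvd toL (lam \<theta>)"
  proof (rule primes_dvd[OF fin_reps])
    fix H assume "H \<in> reps"
    then have H: "H \<in> A" using reps_sub by blast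
    show "prime_elem (toL (line_form H))" using toL_prime lines nL H by blast
    show "\<not> toL (line_form H) dvd toL (line_form K)" if "K \<in> reps" "H \<noteq> K" for K
      using toL_dvd_imp[of H K] reps_meet[OF \<open>H \<in> reps\<close> that] lines nL H that reps_sub by blast
    let ?e = "line_covec H"
    let ?\<pi> = "toL (line_form H)"
    have \<pi>: "?\<pi> = const (dot ?e p) * var 1 + const (dot ?e q) * var 2"
      by (simp add: line_form_covec toL_linear_form)
    have "?\<pi> dvd toL (pair ?e \<theta>)"
      using D_dvd[OF \<theta>(1) H] by (auto simp: dvd_def toL_hom)
    also have "toL (pair ?e \<theta>) = const (dot ?e p) * ?A + const (dot ?e q) * ?B"
      using pair_expand[of ?e \<theta>] \<theta>(2) by (simp add: toL_hom)
    finally have dv: "?\<pi> dvd const (dot ?e p) * ?A + const (dot ?e q) * ?B" .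
    have 1: "const (dot ?e q) * toL (lam \<theta>) = ?A * ?\<pi> - var 1 * (const (dot ?e p) * ?A + const (dot ?e q) * ?B)"
      unfolding toL_lam \<pi> by (simp add: algebra_simps)
    have 2: "const (dot ?e p) * toL (lam \<theta>) = var 2 * (const (dot ?e p) * ?A + const (dot ?e q) * ?B) - ?B * ?\<pi>"
      unfolding toL_lam \<pi> by (simp add: algebra_simps)
    have "?\<pi> dvd const (dot ?e q) * toL (lam \<theta>)" "?\<pi> dvd const (dot ?e p) * toL (lam \<theta>)"
      unfolding 1 2 by (intro dvd_diff dvd_mult dv dvd_refl)+
    then show "?\<pi> dvd toL (lam \<theta>)"
      using covec_pq[OF lines[OF H] nL[OF H]] const_dvd_cancel by blast
  qed
  then show "toL Q2 dvd toL (lam \<theta>)" by (simp add: Q2_def toL_hom)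
qed

text \<open>Passing from \<open>K\<close> to another line \<open>H\<close> of the pencil replaces
  its covector by \<open>t\<close> times it plus \<open>s\<close> times \<open>c\<close>, which
  multiplies this 2 by 2 determinant by \<open>t\<close>. Written with \<open>H\<close>, the
  determinant is visibly divisible by the form of \<open>H\<close>.\<close>

lemma pencil_dvd:
  assumes "\<theta> \<in> D A" "K \<in> A"
  shows "prod line_form {H \<in> A. H \<inter> L = K \<inter> L} dvd
    pair (line_covec K) \<theta> * \<alpha> - pair c \<theta> * line_form K"
proof (rule primes_dvd)
  show "finite {H \<in> A. H \<inter> L = K \<inter> L}" using finA by simp
  fix H assume "H \<in> {H \<in> A. H \<inter> L = K \<inter> L}"
  then have H: "H \<in> A" "K \<inter> L = H \<inter> L" by auto
  show "prime_elem (line_form H)" using prime_line_form lines H by blast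
  show "\<not> line_form H dvd line_form J" if "J \<in> {H \<in> A. H \<inter> L = K \<inter> L}" "H \<noteq> J" for J
    using line_form_dvd lines H that by blast
  let ?d = "line_covec K" and ?e = "line_covec H"
  obtain t where t: "t \<noteq> 0" "dot ?e p = t * dot ?d p" "dot ?e q = t * dot ?d q"
    using pencil_covec[of K H] lines nL H assms(2) by metis
  define s where "s = dot ?e r - t * dot ?d r"
  have r: "dot ?e r = t * dot ?d r + s" by (simp add: s_def)
  have lf: "line_form H = const t * line_form K + const s * \<alpha>"
    unfolding line_form_covec using linear_form_expand[of ?d] linear_form_expand[of ?e]
    unfolding t r const_mult const_add by (simp add: algebra_simps)
  have pr: "pair ?e \<theta> = const t * pair ?d \<theta> + const s * pair c \<theta>"
    using pair_expand[of ?d \<theta>] pair_expand[of ?e \<theta>]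
    unfolding t r const_mult const_add by (simp add: algebra_simps)
  have "const t * (pair ?d \<theta> * \<alpha> - pair c \<theta> * line_form K) = pair ?e \<theta> * \<alpha> - pair c \<theta> * line_form H"
    unfolding lf pr by (simp add: algebra_simps)
  also have "line_form H dvd \<dots>" by (intro dvd_diff dvd_mult dvd_mult2 D_dvd[OF assms(1) H(1)] dvd_refl)
  finally show "line_form H dvd pair ?d \<theta> * \<alpha> - pair c \<theta> * line_form K"
    by (rule const_dvd_cancel[OF t(1)])
qed

text \<open>Restricting \<open>pencil_dvd\<close> to \<open>L\<close> kills the term with
  \<open>\<alpha>\<close>. So \<open>\<theta>(\<alpha>)\<close> times the form of the representative
  is divisible on \<open>L\<close> by the product over the whole pencil, and cancelling the
  representative leaves the other lines of the pencil.\<close>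

lemma c_division:
  assumes "\<theta> \<in> D A"
  shows "\<exists>y. \<alpha> dvd pair c \<theta> - Q1 * y"
proof (rule toL_dvd_lift)
  let ?T = "restriction A L" and ?\<pi> = "\<lambda>H. toL (line_form H)"
  define F where "F P = {H \<in> A. H \<inter> L = P} - {rep P}" for P
  have FA: "F P \<subseteq> A" for P by (auto simp: F_def)
  have "(\<Prod>P\<in>?T. prod ?\<pi> (F P)) dvd toL (pair c \<theta>)"
  proof (rule prime_prods_dvd)
    show "finite ?T" using finA by (simp add: restriction_def)
    show "finite (F P)" for P using FA finA finite_subset by blast
    show "prime_elem (?\<pi> H)" if "H \<in> F P" for P H using toL_prime lines nL FA that by blast
    show "\<not> ?\<pi> H dvd ?\<pi> K" if "P \<noteq> P'" "H \<in> F P" "K \<in> F P'" for P P' H K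
      using toL_dvd_imp[of H K] lines nL FA that by (auto simp: F_def)
    fix P assume "P \<in> ?T"
    then have K: "rep P \<in> A" "rep P \<inter> L = P" using rep by auto
    let ?K = "rep P"
    have nz: "?\<pi> ?K \<noteq> 0" using toL_prime[OF lines nL, OF K(1) K(1)] by auto
    have ins: "{H \<in> A. H \<inter> L = ?K \<inter> L} = insert ?K (F P)" "?K \<notin> F P" "finite (F P)"
      using K finite_subset[OF FA finA] by (auto simp: F_def)
    obtain y where "pair (line_covec ?K) \<theta> * \<alpha> - pair c \<theta> * line_form ?K = prod line_form (insert ?K (F P)) * y"
      using pencil_dvd[OF assms K(1)] unfolding ins(1) by (elim dvdE)
    then have "pair c \<theta> * line_form ?K = pair (line_covec ?K) \<theta> * \<alpha> - line_form ?K * (prod line_form (F P) * y)"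
      using ins(2,3) by (simp add: algebra_simps)
    then have "toL (pair c \<theta> * line_form ?K) = toL (pair (line_covec ?K) \<theta> * \<alpha> - line_form ?K * (prod line_form (F P) * y))"
      by (rule arg_cong)
    then have "?\<pi> ?K * toL (pair c \<theta>) = ?\<pi> ?K * (- (prod ?\<pi> (F P) * toL y))"
      by (simp add: toL_hom mult.commute)
    then have "toL (pair c \<theta>) = prod ?\<pi> (F P) * (- toL y)"
      unfolding mult_left_cancel[OF nz] by simp
    then show "prod ?\<pi> (F P) dvd toL (pair c \<theta>)" by (rule dvdI)
  qed
  also have "(\<Prod>P\<in>?T. prod ?\<pi> (F P)) = prod ?\<pi> (\<Union>P\<in>?T. F P)"
    by (rule prod.UNION_disjoint[symmetric])
      (use finA finite_subset[OF FA finA] in \<open>auto simp: F_def restriction_def\<close>)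
  also have "(\<Union>P\<in>?T. F P) = A - reps"
  proof (rule Set.set_eqI, rule iffI)
    fix H assume "H \<in> (\<Union>P\<in>?T. F P)"
    then have "H \<in> A" "H \<noteq> rep (H \<inter> L)" by (auto simp: F_def)
    then show "H \<in> A - reps" using rep_unique by blast
  next
    fix H assume "H \<in> A - reps"
    then have "H \<in> F (H \<inter> L)" "H \<inter> L \<in> ?T" using rep_in[of "H \<inter> L"] meet_in by (auto simp: F_def)
    then show "H \<in> (\<Union>P\<in>?T. F P)" by blast
  qed
  finally show "toL Q1 dvd toL (pair c \<theta>)" by (simp add: Q1_def toL_hom)
qed

text \<open>Brings local generation into the shape of \<open>power_in_ideal\<close>: it then
  suffices to attain \<open>f\<close> times the product of lines avoiding each single point.\<close>

lemma ideal_generation: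
  assumes "submod N" "\<And>x y. \<mu> (x + y) = \<mu> x + \<mu> y" "\<And>f x. \<mu> (f *s x) = f * \<mu> x"
  shows "ideal_R {h. \<exists>\<theta>\<in>N. \<alpha> dvd \<mu> \<theta> - f * h}" "\<alpha> \<in> {h. \<exists>\<theta>\<in>N. \<alpha> dvd \<mu> \<theta> - f * h}"
proof -
  have 0: "\<mu> 0 = 0" using assms(3)[of 0 0] by simp
  show "\<alpha> \<in> {h. \<exists>\<theta>\<in>N. \<alpha> dvd \<mu> \<theta> - f * h}"
    using 0 submodD(1)[OF assms(1)] by (auto intro!: bexI[of _ 0])
  show "ideal_R {h. \<exists>\<theta>\<in>N. \<alpha> dvd \<mu> \<theta> - f * h}"
    unfolding ideal_R_def
  proof (intro conjI ballI allI)
    show "0 \<in> {h. \<exists>\<theta>\<in>N. \<alpha> dvd \<mu> \<theta> - f * h}"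
      using 0 submodD(1)[OF assms(1)] by (auto intro!: bexI[of _ 0])
  next
    fix x y assume "x \<in> {h. \<exists>\<theta>\<in>N. \<alpha> dvd \<mu> \<theta> - f * h}" "y \<in> {h. \<exists>\<theta>\<in>N. \<alpha> dvd \<mu> \<theta> - f * h}"
    then obtain \<theta> \<eta> where \<theta>: "\<theta> \<in> N" "\<alpha> dvd \<mu> \<theta> - f * x" and \<eta>: "\<eta> \<in> N" "\<alpha> dvd \<mu> \<eta> - f * y" by blast
    have "\<mu> (\<theta> + \<eta>) - f * (x + y) = (\<mu> \<theta> - f * x) + (\<mu> \<eta> - f * y)"
      by (simp add: assms(2) algebra_simps)
    also have "\<alpha> dvd \<dots>" using \<theta> \<eta> by (intro dvd_add)
    finally show "x + y \<in> {h. \<exists>\<theta>\<in>N. \<alpha> dvd \<mu> \<theta> - f * h}"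
      using submodD(2)[OF assms(1) \<theta>(1) \<eta>(1)] by blast
  next
    fix s x assume "x \<in> {h. \<exists>\<theta>\<in>N. \<alpha> dvd \<mu> \<theta> - f * h}"
    then obtain \<theta> where \<theta>: "\<theta> \<in> N" "\<alpha> dvd \<mu> \<theta> - f * x" by blast
    have "\<mu> (s *s \<theta>) - f * (s * x) = s * (\<mu> \<theta> - f * x)"
      by (simp add: assms(3) algebra_simps)
    also have "\<alpha> dvd \<dots>" using \<theta> by (intro dvd_mult)
    finally show "s * x \<in> {h. \<exists>\<theta>\<in>N. \<alpha> dvd \<mu> \<theta> - f * h}"
      using submodD(3)[OF assms(1) \<theta>(1)] by blast
  qed
qed

lemma lam_generation:
  assumes "Poly_Mapping.lookup g 0 = 0"
  shows "\<exists>k. \<exists>\<theta>\<in>D (insert L A). \<alpha> dvd lam \<theta> - Q2 * g ^ k"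
proof -
  let ?I = "{h. \<exists>\<theta>\<in>D (insert L A). \<alpha> dvd lam \<theta> - Q2 * h}"
  have "\<exists>k. g ^ k \<in> ?I"
  proof (rule power_in_ideal[of "A - reps" _ "restriction A L"])
    show "ideal_R ?I" "\<alpha> \<in> ?I"
      using ideal_generation[OF submod_D[OF arr_insert] lam_add lam_smult] by blast+
    fix P assume "P \<in> restriction A L"
    then have K: "rep P \<in> A" "rep P \<inter> L = P" using rep by auto
    let ?K = "rep P"
    let ?w = "vtx ?K"
    let ?X = "{H \<in> A. H \<inter> L \<noteq> P}"
    let ?h = "prod line_form {H \<in> A - reps. H \<inter> L \<noteq> P}"
    \<comment> \<open>The direction is that of the point \<open>P\<close>, so \<open>L\<close> and
      all lines through \<open>P\<close> annihilate it; every other line divides the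
      coefficient.\<close>
    define \<theta> where "\<theta> = prod line_form ?X *s const_vec ?w"
    have "line_form H dvd pair (line_covec H) \<theta>" if H: "H \<in> A" for H
    proof (cases "H \<inter> L = P")
      case True
      then have "dot (line_covec H) ?w = 0" using meet_eq_iff[of ?K H] lines nL K H by auto
      then show ?thesis by (simp add: \<theta>_def pair_smult pair_const_vec)
    next
      case False
      then have "line_form H dvd prod line_form ?X" using H finA by (intro dvd_prodI) auto
      then show ?thesis by (simp add: \<theta>_def pair_smult)
    qed
    moreover have "pair c \<theta> = 0" by (simp add: \<theta>_def pair_smult pair_const_vec)
    ultimately have D: "\<theta> \<in> D (insert L A)" by (simp add: D_insert D_iff[OF arr])
    have X: "?X = (reps - {?K}) \<union> {H \<in> A - reps. H \<inter> L \<noteq> P}"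
      using reps_sub reps_meet_iff \<open>P \<in> _\<close> K(2) by blast
    have "prod line_form ?X = prod line_form (reps - {?K}) * ?h"
      unfolding X using fin_reps finA by (intro prod.union_disjoint) auto
    moreover have "Q2 = line_form ?K * prod line_form (reps - {?K})"
      unfolding Q2_def using \<open>P \<in> _\<close> by (intro prod.remove fin_reps rep_in)
    ultimately have Q: "line_form ?K * prod line_form ?X = Q2 * ?h" by (simp add: ac_simps)
    have lf: "line_form ?K = const (dot (line_covec ?K) p) * linear_form a
        + const (dot (line_covec ?K) q) * linear_form b + const (dot (line_covec ?K) r) * \<alpha>"
      unfolding line_form_covec by (rule linear_form_expand)
    \<comment> \<open>Modulo \<open>\<alpha>\<close> the bracket is the form of \<open>?K\<close>,
      the one factor of \<open>Q2\<close> missing from the product.\<close>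
    have "lam \<theta> = prod line_form ?X * (const (dot (line_covec ?K) q) * linear_form b
        + const (dot (line_covec ?K) p) * linear_form a)"
      by (simp add: \<theta>_def lam_smult) (simp add: lam_def pair_const_vec const_uminus)
    also have "\<dots> = line_form ?K * prod line_form ?X - prod line_form ?X * const (dot (line_covec ?K) r) * \<alpha>"
      unfolding lf by (simp add: algebra_simps)
    finally have "lam \<theta> - Q2 * ?h = - (prod line_form ?X * const (dot (line_covec ?K) r) * \<alpha>)"
      unfolding Q by simp
    then have "\<alpha> dvd lam \<theta> - Q2 * ?h" by simp
    then show "?h \<in> ?I" using D by blast
  qed (use finA ne_restr lines nL meet_in assms in auto)
  then show ?thesis by blast
qed

lemma c_generation:
  assumes "Poly_Mapping.lookup g 0 = 0"
  shows "\<exists>k. \<exists>\<theta>\<in>D A. \<alpha> dvd pair c \<theta> - Q1 * g ^ k"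
proof -
  let ?I = "{h. \<exists>\<theta>\<in>D A. \<alpha> dvd pair c \<theta> - Q1 * h}"
  have "\<exists>k. g ^ k \<in> ?I"
  proof (rule power_in_ideal[of reps _ "restriction A L"])
    show "ideal_R ?I" "\<alpha> \<in> ?I"
      using ideal_generation[OF submod_D[OF arr], of "pair c", OF pair_add pair_smult] by blast+
    fix P assume P: "P \<in> restriction A L"
    then have K: "rep P \<in> A" "rep P \<inter> L = P" using rep by auto
    let ?K = "rep P" and ?d = "line_covec (rep P)"
    let ?h = "prod line_form {H \<in> reps. H \<inter> L \<noteq> P}"
    \<comment> \<open>These constants move \<open>r\<close> along \<open>L\<close> onto the line
      \<open>?K\<close>; they exist because the equation of \<open>?K\<close> does not vanish on
      both \<open>p\<close> and \<open>q\<close>.\<close>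
    have "\<exists>s t. dot ?d r + s * dot ?d p + t * dot ?d q = 0"
    proof (cases "dot ?d p = 0")
      case True
      then have "dot ?d q \<noteq> 0" using covec_pq[OF lines[OF K(1)] nL[OF K(1)]] by simp
      then show ?thesis by (intro exI[of _ 0] exI[of _ "- (dot ?d r / dot ?d q)"]) simp
    next
      case False
      then show ?thesis by (intro exI[of _ "- (dot ?d r / dot ?d p)"] exI[of _ 0]) simp
    qed
    then obtain s t where st: "dot ?d r + s * dot ?d p + t * dot ?d q = 0" by blast
    define w where "w = r + s *s p + t *s q"
    have w: "dot c w = 1" "dot ?d w = 0"
      unfolding w_def dot_add dot_smult st by simp_all
    \<comment> \<open>All lines but \<open>?K\<close> divide the coefficient, and \<open>?K\<close>
      annihilates \<open>w\<close>. As \<open>dot c w = 1\<close>, the value on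
      \<open>\<alpha>\<close> is the bare product.\<close>
    define \<theta> where "\<theta> = prod line_form (A - {?K}) *s const_vec w"
    have "line_form H dvd pair (line_covec H) \<theta>" if H: "H \<in> A" for H
    proof (cases "H = ?K")
      case True
      then show ?thesis by (simp add: \<theta>_def pair_smult pair_const_vec w)
    next
      case False
      then have "line_form H dvd prod line_form (A - {?K})" using H finA by (intro dvd_prodI) auto
      then show ?thesis by (simp add: \<theta>_def pair_smult)
    qed
    then have D: "\<theta> \<in> D A" by (simp add: D_iff[OF arr])
    have e1: "{H \<in> reps. H \<inter> L \<noteq> P} = reps - {?K}" using reps_meet_iff P by blast
    have e2: "A - {?K} = (A - reps) \<union> (reps - {?K})" using reps_sub rep_in[OF P] by blast
    have "prod line_form (A - {?K}) = Q1 * ?h"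
      unfolding e1 e2 Q1_def
    proof (rule prod.union_disjoint)
      show "(A - reps) \<inter> (reps - {?K}) = {}" by blast
    qed (use finA fin_reps in simp_all)
    then have "pair c \<theta> - Q1 * ?h = 0" by (simp add: \<theta>_def pair_smult pair_const_vec w)
    then have "\<alpha> dvd pair c \<theta> - Q1 * ?h" by simp
    then show "?h \<in> ?I" using D by blast
  next
    fix H assume "H \<in> reps"
    then have "H \<in> A" using reps_sub by blast
    then show "is_line H \<and> H \<noteq> L \<and> H \<inter> L \<in> restriction A L" using lines nL meet_in by blast
  qed (rule fin_reps ne_restr assms)+
  then show ?thesis by blast
qed

end

section \<open>Cosets and localization\<close>

definition subgrp :: "'a::ab_group_add set \<Rightarrow> bool" where
  "subgrp W \<longleftrightarrow> 0 \<in> W \<and> (\<forall>x\<in>W. \<forall>y\<in>W. x - y \<in> W)"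

lemma subgrpD:
  assumes "subgrp W"
  shows "0 \<in> W" "x \<in> W \<Longrightarrow> y \<in> W \<Longrightarrow> x - y \<in> W" "x \<in> W \<Longrightarrow> - x \<in> W"
    "x \<in> W \<Longrightarrow> y \<in> W \<Longrightarrow> x + y \<in> W"
proof -
  show 0: "0 \<in> W" using assms by (simp add: subgrp_def)
  show d: "x - y \<in> W" if "x \<in> W" "y \<in> W" for x y using assms that by (simp add: subgrp_def)
  show m: "- x \<in> W" if "x \<in> W" for x using d[OF 0 that] by simp
  show "x + y \<in> W" if "x \<in> W" "y \<in> W" for x y using d[OF that(1) m[OF that(2)]] by simp
qed

lemma coset_mem: "y \<in> x +o W \<longleftrightarrow> y - x \<in> (W :: 'a::ab_group_add set)"
proof
  assume "y - x \<in> W"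
  then have "x + (y - x) \<in> x +o W" by (rule set_plus_intro2)
  then show "y \<in> x +o W" by simp
qed (auto simp: elt_set_plus_def)

lemma coset_eq_iff: "subgrp W \<Longrightarrow> x +o W = y +o W \<longleftrightarrow> x - y \<in> W"
proof
  assume W: "subgrp W" "x +o W = y +o W"
  have "x \<in> x +o W" using subgrpD(1)[OF W(1)] by (simp add: coset_mem)
  then show "x - y \<in> W" by (simp add: W(2) coset_mem)
next
  assume W: "subgrp W" "x - y \<in> W"
  show "x +o W = y +o W"
  proof (rule Set.set_eqI)
    fix z
    have "z - y = (z - x) + (x - y)" "z - x = (z - y) - (x - y)" by simp_all
    then show "z \<in> x +o W \<longleftrightarrow> z \<in> y +o W"
      unfolding coset_mem using W(2) subgrpD[OF W(1)] by metis
  qed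
qed

lemma subgrp_plus: "subgrp W \<Longrightarrow> subgrp W' \<Longrightarrow> subgrp (W + W')"
  unfolding subgrp_def
proof (intro conjI ballI)
  assume W: "0 \<in> W \<and> (\<forall>x\<in>W. \<forall>y\<in>W. x - y \<in> W)" "0 \<in> W' \<and> (\<forall>x\<in>W'. \<forall>y\<in>W'. x - y \<in> W')"
  show "0 \<in> W + W'" using set_plus_intro[of 0 W 0 W'] W by simp
  fix x y assume "x \<in> W + W'" "y \<in> W + W'"
  then obtain a b c d where "x = a + b" "y = c + d" "a \<in> W" "c \<in> W" "b \<in> W'" "d \<in> W'"
    by (auto elim!: set_plus_elim)
  moreover from this have "(a - c) + (b - d) \<in> W + W'" using W by (intro set_plus_intro) auto
  ultimately show "x - y \<in> W + W'" by (simp add: algebra_simps)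
qed

lemma coset_add_subgrp:
  assumes "subgrp W'" "W \<subseteq> W'" "0 \<in> W"
  shows "(x +o W) + W' = x +o W'"
proof (rule Set.set_eqI, rule iffI)
  fix z assume "z \<in> (x +o W) + W'"
  then obtain a b where ab: "z = a + b" "a - x \<in> W" "b \<in> W'" by (auto elim!: set_plus_elim simp: coset_mem)
  then have "(a - x) + b \<in> W'" using assms subgrpD(4) by blast
  then show "z \<in> x +o W'" using ab by (simp add: coset_mem algebra_simps)
next
  fix z assume "z \<in> x +o W'"
  then have "x + (z - x) \<in> (x +o W) + W'"
    using assms by (intro set_plus_intro) (simp_all add: coset_mem)
  then show "z \<in> (x +o W) + W'" by simp
qed

lemma coset_add:
  assumes "subgrp W"
  shows "(x +o W) + (y +o W) = (x + y) +o W"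
proof (rule Set.set_eqI, rule iffI)
  fix z assume "z \<in> (x +o W) + (y +o W)"
  then obtain a b where ab: "z = a + b" "a - x \<in> W" "b - y \<in> W" by (auto elim!: set_plus_elim simp: coset_mem)
  then have "(a - x) + (b - y) \<in> W" using assms subgrpD(4) by blast
  then show "z \<in> (x + y) +o W" using ab by (simp add: coset_mem algebra_simps)
next
  fix z assume "z \<in> (x + y) +o W"
  then have "x + (z - x) \<in> (x +o W) + (y +o W)"
    using assms subgrpD(1) by (intro set_plus_intro) (auto simp add: coset_mem algebra_simps)
  then show "z \<in> (x +o W) + (y +o W)" by simp
qed

lemma coset_smult:
  fixes W :: "('a::comm_ring_1 ^ 'n) set"
  assumes "subgrp W" "\<And>w. w \<in> W \<Longrightarrow> r *s w \<in> W"
  shows "(*s) r ` (x +o W) + W = (r *s x) +o W"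
proof (rule Set.set_eqI, rule iffI)
  fix z assume "z \<in> (*s) r ` (x +o W) + W"
  then obtain a b where ab: "z = r *s a + b" "a - x \<in> W" "b \<in> W" by (auto elim!: set_plus_elim simp: coset_mem)
  then have "r *s (a - x) + b \<in> W" using assms subgrpD(4)[OF assms(1)] by blast
  then show "z \<in> (r *s x) +o W" using ab by (simp add: coset_mem algebra_simps vector_ssub_ldistrib)
next
  fix z assume "z \<in> (r *s x) +o W"
  then have "r *s x + (z - r *s x) \<in> (*s) r ` (x +o W) + W"
    using subgrpD(1)[OF assms(1)] by (intro set_plus_intro imageI) (simp_all add: coset_mem)
  then show "z \<in> (*s) r ` (x +o W) + W" by simp
qed

section \<open>Localization of graded modules\<close>

lemma principal_mult: "principal g \<Longrightarrow> principal h \<Longrightarrow> principal (g * h)"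
  unfolding principal_def using homog_mult add_pos_pos by (metis no_zero_divisors)

lemma principal_linear_form: "c \<noteq> 0 \<Longrightarrow> principal (linear_form c)"
  unfolding principal_def using prime_elem_linear_form[of c] homog_linear_form[of c]
  by (auto intro!: exI[of _ 1])

lemma principal_no_constant: "principal g \<Longrightarrow> Poly_Mapping.lookup g 0 = 0"
  unfolding principal_def homog_iff by (auto simp: mdeg_def)

definition frv :: "'a::idom ^ 'n \<Rightarrow> 'a \<Rightarrow> 'a fract ^ 'n" where
  "frv m s = (\<chi> i. Fract (m $ i) s)"

lemma frv_eq_iff: "s \<noteq> 0 \<Longrightarrow> t \<noteq> 0 \<Longrightarrow> frv m s = frv m' t \<longleftrightarrow> t *s m = s *s m'"
  by (simp add: frv_def Finite_Cartesian_Product.vec_eq_iff eq_fract mult.commute)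

lemma frv_add: "s \<noteq> 0 \<Longrightarrow> t \<noteq> 0 \<Longrightarrow> frv m s + frv m' t = frv (t *s m + s *s m') (s * t)"
  by (simp add: frv_def Finite_Cartesian_Product.vec_eq_iff mult.commute)

lemma frv_diff: "s \<noteq> 0 \<Longrightarrow> t \<noteq> 0 \<Longrightarrow> frv m s - frv m' t = frv (t *s m - s *s m') (s * t)"
  by (simp add: frv_def Finite_Cartesian_Product.vec_eq_iff mult.commute)

lemma frv_smult: "Fract f t *s frv m s = frv (f *s m) (t * s)"
  by (simp add: frv_def Finite_Cartesian_Product.vec_eq_iff)

lemma frv_0: "frv 0 s = 0"
  by (simp add: frv_def Finite_Cartesian_Product.vec_eq_iff fract_collapse)

lemma frv_cancel: "t \<noteq> 0 \<Longrightarrow> frv (t *s m) (t * s) = frv m s"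
  by (cases "s = 0") (simp_all add: frv_def Finite_Cartesian_Product.vec_eq_iff eq_fract fract_collapse)

definition homogv :: "int \<Rightarrow> 'k::zero R ^ 'n \<Rightarrow> bool" where
  "homogv n m \<longleftrightarrow> (\<forall>i. homog n (m $ i))"

lemma homogv_smult: "homog d f \<Longrightarrow> homogv n (m :: 'k::comm_ring_1 R ^ 'n) \<Longrightarrow> homogv (d + n) (f *s m)"
  by (simp add: homogv_def homog_mult)

lemma homogv_add: "homogv n m \<Longrightarrow> homogv n m' \<Longrightarrow> homogv n (m + m' :: 'k::comm_ring_1 R ^ 'n)"
  by (simp add: homogv_def homog_add)

lemma localizeE:
  fixes g :: "'k::field R"
  assumes "x \<in> localize g n N" "g \<noteq> 0" "homog e g"
  obtains m j where "x = frv m (g ^ j)" "m \<in> N" "homogv (n + int j * e) m"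
proof -
  from assms(1) obtain m j e' where m: "x = frv m (g ^ j)" "m \<in> N" "homog e' g" "homogv (n + int j * e') m"
    by (auto simp: localize_def frv_def homogv_def)
  have "e' = e" using homog_unique[OF m(3) assms(3,2)] .
  then show ?thesis using that m by blast
qed

lemma localizeI:
  assumes "m \<in> N" "homog e g" "homogv (n + int j * e) m"
  shows "frv m (g ^ j) \<in> localize g n N"
  unfolding localize_def frv_def using assms by (auto simp: homogv_def)

lemma principalE:
  fixes g :: "'k::field R"
  assumes "principal g"
  obtains e where "g \<noteq> 0" "homog e g" "e > 0"
  using assms by (auto simp: principal_def)

lemma frv_raise: "g \<noteq> 0 \<Longrightarrow> frv m (g ^ j) = frv (g ^ i *s m) (g ^ (i + j))"
  using frv_cancel[of "g ^ i" m "g ^ j"] by (simp add: power_add)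

lemma localize_add:
  fixes N :: "('k::field R ^ 'n::finite) set"
  assumes N: "submod N" and g: "principal g" and x: "x \<in> localize g n N" "y \<in> localize g n N"
  shows "x + y \<in> localize g n N"
proof -
  obtain e where e: "g \<noteq> 0" "homog e g" "e > 0" using principalE[OF g] .
  obtain m j where m: "x = frv m (g ^ j)" "m \<in> N" "homogv (n + int j * e) m" using localizeE[OF x(1) e(1,2)] .
  obtain m' i where m': "y = frv m' (g ^ i)" "m' \<in> N" "homogv (n + int i * e) m'" using localizeE[OF x(2) e(1,2)] .
  have "x + y = frv (g ^ i *s m + g ^ j *s m') (g ^ (j + i))"
    unfolding m(1) m'(1) power_add using e by (intro frv_add) auto
  also have "\<dots> \<in> localize g n N"
  proof (rule localizeI[OF _ e(2)])
    show "g ^ i *s m + g ^ j *s m' \<in> N" using submodD[OF N] m m' by blast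
    have "homogv (int i * e + (n + int j * e)) (g ^ i *s m)" "homogv (int j * e + (n + int i * e)) (g ^ j *s m')"
      by (intro homogv_smult homog_power e m m')+
    then show "homogv (n + int (j + i) * e) (g ^ i *s m + g ^ j *s m')"
      by (intro homogv_add) (simp_all add: algebra_simps)
  qed
  finally show ?thesis .
qed

lemma structure_ringE:
  fixes g :: "'k::field R"
  assumes "t \<in> structure_ring g" "g \<noteq> 0" "homog e g"
  obtains f j where "t = Fract f (g ^ j)" "homog (int j * e) f"
proof -
  from assms(1) obtain x :: "'k R fract ^ 1" where x: "x \<in> localize g 0 UNIV" "t = x $ 1"
    unfolding structure_ring_def by blast
  obtain m :: "'k R ^ 1" and j where "x = frv m (g ^ j)" "homogv (0 + int j * e) m" using localizeE[OF x(1) assms(2,3)] .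
  then show ?thesis using that x(2) by (simp add: frv_def homogv_def)
qed

lemma structure_ringI:
  assumes "homog e g" "homog (int j * e) f"
  shows "Fract f (g ^ j) \<in> structure_ring g"
proof -
  have "frv (\<chi> i. f :: 'a R ^ 1) (g ^ j) \<in> localize g 0 UNIV"
    by (rule localizeI[OF _ assms(1)]) (use assms(2) in \<open>simp_all add: homogv_def\<close>)
  then show ?thesis unfolding structure_ring_def by (intro image_eqI) (simp_all add: frv_def)
qed

lemma const_in_structure_ring: "principal g \<Longrightarrow> Fract (const t) 1 \<in> structure_ring g"
  using structure_ringI[of _ g 0 "const t"] by (auto elim: principalE)

lemma localize_smult:
  fixes N :: "('k::field R ^ 'n::finite) set"
  assumes N: "submod N" and g: "principal g" and x: "x \<in> localize g n N" "t \<in> structure_ring g"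
  shows "t *s x \<in> localize g n N"
proof -
  obtain e where e: "g \<noteq> 0" "homog e g" "e > 0" using principalE[OF g] .
  obtain m j where m: "x = frv m (g ^ j)" "m \<in> N" "homogv (n + int j * e) m" using localizeE[OF x(1) e(1,2)] .
  obtain f i where f: "t = Fract f (g ^ i)" "homog (int i * e) f" using structure_ringE[OF x(2) e(1,2)] .
  have "t *s x = frv (f *s m) (g ^ (i + j))" unfolding m(1) f(1) power_add by (rule frv_smult)
  also have "\<dots> \<in> localize g n N"
  proof (rule localizeI[OF _ e(2)])
    show "f *s m \<in> N" using submodD[OF N] m by blast
    show "homogv (n + int (i + j) * e) (f *s m)"
      using homogv_smult[OF f(2) m(3)] by (simp add: algebra_simps)
  qed
  finally show ?thesis .
qed

lemma localize_0: "submod N \<Longrightarrow> principal g \<Longrightarrow> 0 \<in> localize g n N"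
  using localizeI[of 0 N _ g n 0] by (auto simp: frv_0 homogv_def submodD elim: principalE)

lemma localize_mono: "N \<subseteq> N' \<Longrightarrow> localize g n N \<subseteq> localize g n N'"
  unfolding localize_def by blast

lemma localize_restrict:
  fixes N :: "('k::field R ^ 'n::finite) set"
  assumes N: "submod N" and g: "principal g" and h: "principal h"
  shows "localize g n N \<subseteq> localize (g * h) n N"
proof
  fix x assume x: "x \<in> localize g n N"
  obtain e where e: "g \<noteq> 0" "homog e g" "e > 0" using principalE[OF g] .
  obtain d where d: "h \<noteq> 0" "homog d h" "d > 0" using principalE[OF h] .
  obtain m j where m: "x = frv m (g ^ j)" "m \<in> N" "homogv (n + int j * e) m" using localizeE[OF x e(1,2)] .
  have "x = frv (h ^ j *s m) ((g * h) ^ j)"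
    using frv_cancel[of "h ^ j" m "g ^ j"] m(1) d(1) by (simp add: power_mult_distrib mult.commute)
  also have "\<dots> \<in> localize (g * h) n N"
  proof (rule localizeI[OF _ homog_mult[OF e(2) d(2)]])
    show "h ^ j *s m \<in> N" using submodD[OF N] m by blast
    show "homogv (n + int j * (e + d)) (h ^ j *s m)"
      using homogv_smult[OF homog_power[OF d(2)] m(3), of j] by (simp add: algebra_simps)
  qed
  finally show "x \<in> localize (g * h) n N" .
qed

section \<open>Sheaves and correspondences\<close>

definition stable :: "'k::field R \<Rightarrow> ('k R fract ^ 'n::finite) set \<Rightarrow> bool" where
  "stable g V \<longleftrightarrow> 0 \<in> V \<and> (\<forall>x\<in>V. \<forall>y\<in>V. x + y \<in> V) \<and> (\<forall>r\<in>structure_ring g. \<forall>x\<in>V. r *s x \<in> V)"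

lemma minus_in_structure_ring: "principal g \<Longrightarrow> - 1 \<in> structure_ring g"
  using const_in_structure_ring[of g "- 1"] by (simp add: const_uminus One_fract_def)

lemma stableD:
  assumes "stable g V"
  shows "0 \<in> V" "x \<in> V \<Longrightarrow> y \<in> V \<Longrightarrow> x + y \<in> V" "x \<in> V \<Longrightarrow> r \<in> structure_ring g \<Longrightarrow> r *s x \<in> V"
  using assms by (auto simp: stable_def)

lemma stable_subgrp:
  assumes "stable g V" "principal g"
  shows "subgrp V"
  unfolding subgrp_def
proof (intro conjI ballI)
  show "0 \<in> V" by (rule stableD[OF assms(1)])
  fix x y assume "x \<in> V" "y \<in> V"
  then have "x + (- 1) *s y \<in> V"
    by (intro stableD[OF assms(1)] minus_in_structure_ring assms(2))
  then show "x - y \<in> V" by (simp add: vector_sneg_minus1[symmetric])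
qed

lemma stable_kscale: "stable g V \<Longrightarrow> principal g \<Longrightarrow> x \<in> V \<Longrightarrow> kscale t x \<in> V"
  unfolding kscale_def by (intro stableD const_in_structure_ring)

text \<open>The conditions under which \<open>sections\<close> are quotients of modules over
  \<open>structure_ring g\<close> and enlarging a coset is a restriction map.\<close>

definition wf_sheaf :: "('k::field, 'n::finite) sheaf \<Rightarrow> bool" where
  "wf_sheaf E \<longleftrightarrow> (\<forall>g. principal g \<longrightarrow> stable g (fst (E g)) \<and> stable g (snd (E g)) \<and> snd (E g) \<subseteq> fst (E g) \<and>
     (\<forall>h. principal h \<longrightarrow> fst (E g) \<subseteq> fst (E (g * h)) \<and> snd (E g) \<subseteq> snd (E (g * h))))"

lemma wf_sheafD:
  assumes "wf_sheaf E" "principal g"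
  shows "stable g (fst (E g))" "stable g (snd (E g))" "x \<in> snd (E g) \<Longrightarrow> x \<in> fst (E g)"
    "principal h \<Longrightarrow> x \<in> fst (E g) \<Longrightarrow> x \<in> fst (E (g * h))"
    "principal h \<Longrightarrow> x \<in> snd (E g) \<Longrightarrow> x \<in> snd (E (g * h))"
  using assms unfolding wf_sheaf_def by blast+

lemma wf_subgrp:
  assumes "wf_sheaf E" "principal g"
  shows "subgrp (fst (E g))" "subgrp (snd (E g))"
  by (rule stable_subgrp[OF wf_sheafD(1)[OF assms] assms(2)],
      rule stable_subgrp[OF wf_sheafD(2)[OF assms] assms(2)])

lemma wf_tilde:
  assumes "submod (fst M)" "submod (snd M)" "snd M \<subseteq> fst M"
  shows "wf_sheaf (tilde M n)"
  unfolding wf_sheaf_def stable_def tilde_def fst_conv snd_conv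
  using assms by (intro allI impI conjI ballI localize_0 localize_add localize_smult localize_mono
      localize_restrict) auto

text \<open>An isomorphism of sheaves of subquotients, as the relation it induces between representatives.\<close>

definition sheaf_corr ::
  "('k::field, 'm::finite) sheaf \<Rightarrow> ('k, 'n::finite) sheaf
    \<Rightarrow> ('k R \<Rightarrow> (('k R fract ^ 'm) \<times> ('k R fract ^ 'n)) set) \<Rightarrow> bool" where
  "sheaf_corr E G \<Gamma> \<longleftrightarrow> (\<forall>g. principal g \<longrightarrow>
     (\<forall>(x, y)\<in>\<Gamma> g. x \<in> fst (E g) \<and> y \<in> fst (G g) \<and> (x \<in> snd (E g) \<longleftrightarrow> y \<in> snd (G g))) \<and>
     (\<forall>x\<in>fst (E g). \<exists>y. (x, y) \<in> \<Gamma> g) \<and> (\<forall>y\<in>fst (G g). \<exists>x. (x, y) \<in> \<Gamma> g) \<and>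
     (\<forall>x\<in>snd (E g). \<forall>y\<in>snd (G g). (x, y) \<in> \<Gamma> g) \<and>
     (\<forall>(x, y)\<in>\<Gamma> g. \<forall>(x', y')\<in>\<Gamma> g. (x + x', y + y') \<in> \<Gamma> g) \<and>
     (\<forall>r\<in>structure_ring g. \<forall>(x, y)\<in>\<Gamma> g. (r *s x, r *s y) \<in> \<Gamma> g) \<and>
     (\<forall>h. principal h \<longrightarrow> \<Gamma> g \<subseteq> \<Gamma> (g * h)))"

lemma sheaf_corrD:
  assumes "sheaf_corr E G \<Gamma>" "principal g"
  shows "(x, y) \<in> \<Gamma> g \<Longrightarrow> x \<in> fst (E g)" "(x, y) \<in> \<Gamma> g \<Longrightarrow> y \<in> fst (G g)"
    "(x, y) \<in> \<Gamma> g \<Longrightarrow> x \<in> snd (E g) \<longleftrightarrow> y \<in> snd (G g)"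
    "x \<in> fst (E g) \<Longrightarrow> \<exists>y. (x, y) \<in> \<Gamma> g" "y \<in> fst (G g) \<Longrightarrow> \<exists>x. (x, y) \<in> \<Gamma> g"
    "x \<in> snd (E g) \<Longrightarrow> y \<in> snd (G g) \<Longrightarrow> (x, y) \<in> \<Gamma> g"
    "(x, y) \<in> \<Gamma> g \<Longrightarrow> (x', y') \<in> \<Gamma> g \<Longrightarrow> (x + x', y + y') \<in> \<Gamma> g"
    "(x, y) \<in> \<Gamma> g \<Longrightarrow> r \<in> structure_ring g \<Longrightarrow> (r *s x, r *s y) \<in> \<Gamma> g"
    "principal h \<Longrightarrow> (x, y) \<in> \<Gamma> g \<Longrightarrow> (x, y) \<in> \<Gamma> (g * h)"
  using assms unfolding sheaf_corr_def by blast+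

lemma corr_diff:
  assumes "sheaf_corr E G \<Gamma>" "principal g" "(x, y) \<in> \<Gamma> g" "(x', y') \<in> \<Gamma> g"
  shows "(x - x', y - y') \<in> \<Gamma> g"
proof -
  have "(x + (- 1) *s x', y + (- 1) *s y') \<in> \<Gamma> g"
    by (intro sheaf_corrD(7,8)[OF assms(1,2)] minus_in_structure_ring assms)
  then show ?thesis by (simp add: vector_sneg_minus1[symmetric])
qed

lemma corr_converse:
  assumes "sheaf_corr E G \<Gamma>"
  shows "sheaf_corr G E (\<lambda>g. (\<Gamma> g)\<inverse>)"
  unfolding sheaf_corr_def
proof (intro allI impI, goal_cases)
  case (1 g)
  note C = sheaf_corrD[OF assms 1]
  show ?case
  proof (intro conjI)
    show "\<forall>(x, y)\<in>(\<Gamma> g)\<inverse>. x \<in> fst (G g) \<and> y \<in> fst (E g) \<and> (x \<in> snd (G g) \<longleftrightarrow> y \<in> snd (E g))"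
      using C(1-3) by auto
    show "\<forall>x\<in>fst (G g). \<exists>y. (x, y) \<in> (\<Gamma> g)\<inverse>" "\<forall>y\<in>fst (E g). \<exists>x. (x, y) \<in> (\<Gamma> g)\<inverse>"
      "\<forall>x\<in>snd (G g). \<forall>y\<in>snd (E g). (x, y) \<in> (\<Gamma> g)\<inverse>"
      using C(4-6) by auto
    show "\<forall>(x, y)\<in>(\<Gamma> g)\<inverse>. \<forall>(x', y')\<in>(\<Gamma> g)\<inverse>. (x + x', y + y') \<in> (\<Gamma> g)\<inverse>"
      "\<forall>r\<in>structure_ring g. \<forall>(x, y)\<in>(\<Gamma> g)\<inverse>. (r *s x, r *s y) \<in> (\<Gamma> g)\<inverse>"
      "\<forall>h. principal h \<longrightarrow> (\<Gamma> g)\<inverse> \<subseteq> (\<Gamma> (g * h))\<inverse>"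
      using C(7-9) by auto
  qed
qed

text \<open>Relations compose through a common middle representative; zero representatives at the
  two ends are joined through \<open>0\<close> in \<open>G\<close>.\<close>

lemma corr_comp:
  assumes 1: "sheaf_corr E G \<Gamma>" and 2: "sheaf_corr G H \<Delta>" and wf: "wf_sheaf G"
  shows "sheaf_corr E H (\<lambda>g. \<Gamma> g O \<Delta> g)"
  unfolding sheaf_corr_def
proof (intro allI impI conjI)
  fix g :: "'a R" assume g: "principal g"
  note 1 = sheaf_corrD[OF 1 g] and 2 = sheaf_corrD[OF 2 g]
  show "\<forall>(x, y)\<in>\<Gamma> g O \<Delta> g. x \<in> fst (E g) \<and> y \<in> fst (H g) \<and> (x \<in> snd (E g) \<longleftrightarrow> y \<in> snd (H g))"
    using 1(1,3) 2(2,3) by blast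
  show "\<forall>x\<in>fst (E g). \<exists>y. (x, y) \<in> \<Gamma> g O \<Delta> g" using 1(2,4) 2(4) by blast
  show "\<forall>y\<in>fst (H g). \<exists>x. (x, y) \<in> \<Gamma> g O \<Delta> g" using 1(5) 2(1,5) by blast
  have "0 \<in> snd (G g)" using stableD(1) wf_sheafD(2)[OF wf g] by blast
  then show "\<forall>x\<in>snd (E g). \<forall>y\<in>snd (H g). (x, y) \<in> \<Gamma> g O \<Delta> g" using 1(6) 2(6) by blast
  show "\<forall>(x, y)\<in>\<Gamma> g O \<Delta> g. \<forall>(x', y')\<in>\<Gamma> g O \<Delta> g. (x + x', y + y') \<in> \<Gamma> g O \<Delta> g"
    using 1(7) 2(7) by blast
  show "\<forall>r\<in>structure_ring g. \<forall>(x, y)\<in>\<Gamma> g O \<Delta> g. (r *s x, r *s y) \<in> \<Gamma> g O \<Delta> g"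
    using 1(8) 2(8) by blast
  show "\<Gamma> g O \<Delta> g \<subseteq> \<Gamma> (g * h) O \<Delta> (g * h)" if "principal h" for h
    using 1(9)[OF that] 2(9)[OF that] by blast
qed

lemma carrier_sections: "carrier (sections E g) = (\<lambda>x. x +o snd (E g)) ` fst (E g)"
  by (simp add: sections_def quot_space_def)

text \<open>Partners of two elements of one coset differ by a partner of a zero representative,
  which is again zero in \<open>G\<close>. Conversely any zero representative of \<open>G\<close> is
  a partner of \<open>0\<close> and may be added to \<open>y\<close>. So the relation induces a map
  of cosets.\<close>

lemma corr_image:
  assumes "sheaf_corr E G \<Gamma>" "principal g" "(x, y) \<in> \<Gamma> g"
    "wf_sheaf E" "wf_sheaf G"
  shows "\<Gamma> g `` (x +o snd (E g)) = y +o snd (G g)"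
proof (rule Set.set_eqI, rule iffI)
  fix z assume "z \<in> \<Gamma> g `` (x +o snd (E g))"
  then obtain w where w: "(w, z) \<in> \<Gamma> g" "w - x \<in> snd (E g)" by (auto simp: coset_mem)
  have "(w - x, z - y) \<in> \<Gamma> g" by (rule corr_diff[OF assms(1,2) w(1) assms(3)])
  then show "z \<in> y +o snd (G g)" using sheaf_corrD(3)[OF assms(1,2)] w(2) by (simp add: coset_mem)
next
  fix z assume "z \<in> y +o snd (G g)"
  then have z: "z - y \<in> snd (G g)" by (simp add: coset_mem)
  have 0: "0 \<in> snd (E g)" using subgrpD(1) wf_subgrp(2)[OF assms(4,2)] .
  have "(x + 0, y + (z - y)) \<in> \<Gamma> g"
    by (intro sheaf_corrD(7)[OF assms(1,2) assms(3)] sheaf_corrD(6)[OF assms(1,2)] 0 z)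
  then show "z \<in> \<Gamma> g `` (x +o snd (E g))" using 0 by (auto simp: coset_mem)
qed

lemma corr_iso:
  assumes \<Gamma>: "sheaf_corr E G \<Gamma>" and wf: "wf_sheaf E" "wf_sheaf G"
  shows "sheaf_iso E G (\<lambda>g X. \<Gamma> g `` X)"
  unfolding sheaf_iso_def
proof (intro allI impI conjI ballI)
  fix g :: "'a R" assume g: "principal g"
  note C = sheaf_corrD[OF \<Gamma> g] and im = corr_image[OF \<Gamma> g _ wf]
  note sE = wf_subgrp(2)[OF wf(1) g] and sG = wf_subgrp(2)[OF wf(2) g]
  have ex: "\<exists>x y. X = x +o snd (E g) \<and> (x, y) \<in> \<Gamma> g \<and> \<Gamma> g `` X = y +o snd (G g)"
    if "X \<in> carrier (sections E g)" for X
    using that im C(4) unfolding carrier_sections by blast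
  show "bij_betw (\<lambda>X. \<Gamma> g `` X) (carrier (sections E g)) (carrier (sections G g))"
    unfolding bij_betw_def
  proof
    show "inj_on (\<lambda>X. \<Gamma> g `` X) (carrier (sections E g))"
    proof (rule inj_onI)
      fix X Y assume XY: "X \<in> carrier (sections E g)" "Y \<in> carrier (sections E g)" "\<Gamma> g `` X = \<Gamma> g `` Y"
      obtain x x' where x: "X = x +o snd (E g)" "(x, x') \<in> \<Gamma> g" "\<Gamma> g `` X = x' +o snd (G g)" using ex[OF XY(1)] by blast
      obtain y y' where y: "Y = y +o snd (E g)" "(y, y') \<in> \<Gamma> g" "\<Gamma> g `` Y = y' +o snd (G g)" using ex[OF XY(2)] by blast
      have "x' - y' \<in> snd (G g)" using XY(3) x(3) y(3) coset_eq_iff[OF sG] by simp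
      then have "x - y \<in> snd (E g)" using C(3)[OF corr_diff[OF \<Gamma> g x(2) y(2)]] by blast
      then show "X = Y" using x(1) y(1) coset_eq_iff[OF sE] by simp
    qed
    show "(\<lambda>X. \<Gamma> g `` X) ` carrier (sections E g) = carrier (sections G g)"
    proof (intro equalityI subsetI)
      fix Y assume "Y \<in> (\<lambda>X. \<Gamma> g `` X) ` carrier (sections E g)"
      then obtain x y where "(x, y) \<in> \<Gamma> g" "Y = y +o snd (G g)" using ex by blast
      then show "Y \<in> carrier (sections G g)" using C(2) unfolding carrier_sections by blast
    next
      fix Y assume "Y \<in> carrier (sections G g)"
      then obtain y where y: "y \<in> fst (G g)" "Y = y +o snd (G g)" unfolding carrier_sections by blast
      obtain x where x: "(x, y) \<in> \<Gamma> g" using C(5)[OF y(1)] by blast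
      have "Y = \<Gamma> g `` (x +o snd (E g))" using im[OF x] y(2) by simp
      then show "Y \<in> (\<lambda>X. \<Gamma> g `` X) ` carrier (sections E g)"
        using C(1)[OF x] unfolding carrier_sections by blast
    qed
  qed
  fix X assume X: "X \<in> carrier (sections E g)"
  obtain x x' where x: "X = x +o snd (E g)" "(x, x') \<in> \<Gamma> g" "\<Gamma> g `` X = x' +o snd (G g)" using ex[OF X] by blast
  show "\<Gamma> g `` (X + Y) = \<Gamma> g `` X + \<Gamma> g `` Y" if Y: "Y \<in> carrier (sections E g)" for Y
  proof -
    obtain y y' where y: "Y = y +o snd (E g)" "(y, y') \<in> \<Gamma> g" "\<Gamma> g `` Y = y' +o snd (G g)" using ex[OF Y] by blast
    have "X + Y = (x + y) +o snd (E g)" unfolding x(1) y(1) by (rule coset_add[OF sE])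
    moreover have "\<Gamma> g `` ((x + y) +o snd (E g)) = (x' + y') +o snd (G g)"
      by (rule im[OF C(7)[OF x(2) y(2)]])
    ultimately show ?thesis unfolding x(3) y(3) coset_add[OF sG] by simp
  qed
  show "\<Gamma> g `` ((*s) t ` X + snd (E g)) = (*s) t ` (\<Gamma> g `` X) + snd (G g)" if t: "t \<in> structure_ring g" for t
  proof -
    have "(*s) t ` X + snd (E g) = (t *s x) +o snd (E g)"
      unfolding x(1) by (rule coset_smult[OF sE stableD(3)[OF wf_sheafD(2)[OF wf(1) g] _ t]])
    moreover have "(*s) t ` (\<Gamma> g `` X) + snd (G g) = (t *s x') +o snd (G g)"
      unfolding x(3) by (rule coset_smult[OF sG stableD(3)[OF wf_sheafD(2)[OF wf(2) g] _ t]])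
    ultimately show ?thesis using im[OF C(8)[OF x(2) t]] by simp
  qed
  fix h :: "'a R" assume h: "principal h"
  have gh: "principal (g * h)" by (rule principal_mult[OF g h])
  have "X + snd (E (g * h)) = x +o snd (E (g * h))" unfolding x(1)
    by (rule coset_add_subgrp[OF wf_subgrp(2)[OF wf(1) gh] _ subgrpD(1)[OF sE]])
      (use wf_sheafD(5)[OF wf(1) g h] in blast)
  moreover have "x' +o snd (G g) + snd (G (g * h)) = x' +o snd (G (g * h))"
    by (rule coset_add_subgrp[OF wf_subgrp(2)[OF wf(2) gh] _ subgrpD(1)[OF sG]])
      (use wf_sheafD(5)[OF wf(2) g h] in blast)
  moreover have "\<Gamma> (g * h) `` (x +o snd (E (g * h))) = x' +o snd (G (g * h))"
    by (rule corr_image[OF \<Gamma> gh C(9)[OF h x(2)] wf])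
  ultimately show "\<Gamma> (g * h) `` (X + snd (E (g * h))) = \<Gamma> g `` X + snd (G (g * h))"
    unfolding x(3) by simp
qed

text \<open>The converse of \<open>corr_iso\<close>, valid for every isomorphism. Through it the
  isomorphisms picked by choice in \<open>alpha_map\<close> can be handled on
  representatives.\<close>

lemma iso_corr:
  assumes iso: "sheaf_iso E G \<phi>" and wf: "wf_sheaf E" "wf_sheaf G"
  shows "sheaf_corr E G (\<lambda>g. {(x, y). x \<in> fst (E g) \<and> y \<in> fst (G g) \<and> \<phi> g (x +o snd (E g)) = y +o snd (G g)})"
  unfolding sheaf_corr_def
proof (intro allI impI, goal_cases)
  case (1 g)
  note g = 1
  note sE = wf_subgrp(2)[OF wf(1) g] and sG = wf_subgrp(2)[OF wf(2) g]
  note VE = wf_sheafD[OF wf(1) g] and VG = wf_sheafD[OF wf(2) g]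
  have iso': "bij_betw (\<phi> g) (carrier (sections E g)) (carrier (sections G g))"
    "X \<in> carrier (sections E g) \<Longrightarrow> Y \<in> carrier (sections E g) \<Longrightarrow> \<phi> g (X + Y) = \<phi> g X + \<phi> g Y"
    "r \<in> structure_ring g \<Longrightarrow> X \<in> carrier (sections E g) \<Longrightarrow> \<phi> g ((*s) r ` X + snd (E g)) = (*s) r ` (\<phi> g X) + snd (G g)"
    "principal h \<Longrightarrow> X \<in> carrier (sections E g) \<Longrightarrow> \<phi> (g * h) (X + snd (E (g * h))) = \<phi> g X + snd (G (g * h))"
    for X Y r h
    using iso g unfolding sheaf_iso_def by blast+
  have cs: "x \<in> fst (E g) \<Longrightarrow> x +o snd (E g) \<in> carrier (sections E g)" for x
    by (simp add: carrier_sections)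
  have cs': "x \<in> fst (G g) \<Longrightarrow> x +o snd (G g) \<in> carrier (sections G g)" for x
    by (simp add: carrier_sections)
  have E0: "0 \<in> snd (E g)" "0 \<in> fst (E g)" using subgrpD(1)[OF sE] VE(3) by auto
  have z: "\<phi> g (0 +o snd (E g)) = 0 +o snd (G g)"
  proof -
    obtain y where y: "y \<in> fst (G g)" "\<phi> g (0 +o snd (E g)) = y +o snd (G g)"
      using bij_betwE[OF iso'(1)] cs[OF E0(2)] unfolding carrier_sections by blast
    have "\<phi> g (0 +o snd (E g)) = \<phi> g (0 +o snd (E g)) + \<phi> g (0 +o snd (E g))"
      using iso'(2)[OF cs[OF E0(2)] cs[OF E0(2)]] unfolding coset_add[OF sE] by simp
    then have "y +o snd (G g) = (y + y) +o snd (G g)" unfolding y(2) coset_add[OF sG] .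
    then have "- y \<in> snd (G g)" unfolding coset_eq_iff[OF sG] by simp
    then have "y - 0 \<in> snd (G g)" using subgrpD(3)[OF sG, of "- y"] by simp
    then show ?thesis unfolding y(2) coset_eq_iff[OF sG] .
  qed
  have k: "x \<in> snd (E g) \<longleftrightarrow> y \<in> snd (G g)" if "x \<in> fst (E g)" "\<phi> g (x +o snd (E g)) = y +o snd (G g)" for x y
  proof -
    have "x \<in> snd (E g) \<longleftrightarrow> x +o snd (E g) = 0 +o snd (E g)" by (simp add: coset_eq_iff[OF sE] del: set_zero_plus)
    also have "\<dots> \<longleftrightarrow> \<phi> g (x +o snd (E g)) = \<phi> g (0 +o snd (E g))"
      using inj_on_eq_iff[OF bij_betw_imp_inj_on[OF iso'(1)] cs[OF that(1)] cs[OF E0(2)]] by simp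
    also have "\<dots> \<longleftrightarrow> y \<in> snd (G g)" unfolding that(2) z by (simp add: coset_eq_iff[OF sG] del: set_zero_plus)
    finally show ?thesis .
  qed
  show ?case
  proof (intro conjI)
    show "\<forall>x\<in>fst (E g). \<exists>y. (x, y) \<in> {(x, y). x \<in> fst (E g) \<and> y \<in> fst (G g) \<and> \<phi> g (x +o snd (E g)) = y +o snd (G g)}"
      using bij_betwE[OF iso'(1)] cs unfolding carrier_sections by blast
    show "\<forall>y\<in>fst (G g). \<exists>x. (x, y) \<in> {(x, y). x \<in> fst (E g) \<and> y \<in> fst (G g) \<and> \<phi> g (x +o snd (E g)) = y +o snd (G g)}"
    proof
      fix y assume y: "y \<in> fst (G g)"
      then have "y +o snd (G g) \<in> \<phi> g ` carrier (sections E g)"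
        unfolding bij_betw_imp_surj_on[OF iso'(1)] by (rule cs')
      then show "\<exists>x. (x, y) \<in> {(x, y). x \<in> fst (E g) \<and> y \<in> fst (G g) \<and> \<phi> g (x +o snd (E g)) = y +o snd (G g)}"
        using y unfolding carrier_sections by auto
    qed
    show "\<forall>x\<in>snd (E g). \<forall>y\<in>snd (G g). (x, y) \<in> {(x, y). x \<in> fst (E g) \<and> y \<in> fst (G g) \<and> \<phi> g (x +o snd (E g)) = y +o snd (G g)}"
    proof (intro ballI)
      fix x y assume "x \<in> snd (E g)" "y \<in> snd (G g)"
      then have "x +o snd (E g) = 0 +o snd (E g)" "y +o snd (G g) = 0 +o snd (G g)"
        by (simp_all add: coset_eq_iff[OF sE] coset_eq_iff[OF sG] del: set_zero_plus)
      then show "(x, y) \<in> {(x, y). x \<in> fst (E g) \<and> y \<in> fst (G g) \<and> \<phi> g (x +o snd (E g)) = y +o snd (G g)}"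
        using z VE(3) VG(3) \<open>x \<in> _\<close> \<open>y \<in> _\<close> by simp
    qed
    show "\<forall>(x, y)\<in>{(x, y). x \<in> fst (E g) \<and> y \<in> fst (G g) \<and> \<phi> g (x +o snd (E g)) = y +o snd (G g)}.
       \<forall>(x', y')\<in>{(x, y). x \<in> fst (E g) \<and> y \<in> fst (G g) \<and> \<phi> g (x +o snd (E g)) = y +o snd (G g)}.
       (x + x', y + y') \<in> {(x, y). x \<in> fst (E g) \<and> y \<in> fst (G g) \<and> \<phi> g (x +o snd (E g)) = y +o snd (G g)}"
      using iso'(2)[OF cs cs] stableD(2)[OF VE(1)] stableD(2)[OF VG(1)]
      by (auto simp: coset_add[OF sE] coset_add[OF sG])
    show "\<forall>r\<in>structure_ring g. \<forall>(x, y)\<in>{(x, y). x \<in> fst (E g) \<and> y \<in> fst (G g) \<and> \<phi> g (x +o snd (E g)) = y +o snd (G g)}.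
       (r *s x, r *s y) \<in> {(x, y). x \<in> fst (E g) \<and> y \<in> fst (G g) \<and> \<phi> g (x +o snd (E g)) = y +o snd (G g)}"
    proof (intro ballI, clarify)
      fix t x y assume t: "t \<in> structure_ring g" and x: "x \<in> fst (E g)" "y \<in> fst (G g)" "\<phi> g (x +o snd (E g)) = y +o snd (G g)"
      have "(*s) t ` (x +o snd (E g)) + snd (E g) = (t *s x) +o snd (E g)"
        by (rule coset_smult[OF sE stableD(3)[OF VE(2) _ t]])
      moreover have "(*s) t ` (y +o snd (G g)) + snd (G g) = (t *s y) +o snd (G g)"
        by (rule coset_smult[OF sG stableD(3)[OF VG(2) _ t]])
      ultimately have "\<phi> g ((t *s x) +o snd (E g)) = (t *s y) +o snd (G g)"
        using iso'(3)[OF t cs[OF x(1)]] x(3) by simp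
      then show "t *s x \<in> fst (E g) \<and> t *s y \<in> fst (G g) \<and> \<phi> g ((t *s x) +o snd (E g)) = (t *s y) +o snd (G g)"
        using stableD(3)[OF VE(1) x(1) t] stableD(3)[OF VG(1) x(2) t] by simp
    qed
    show "\<forall>h. principal h \<longrightarrow> {(x, y). x \<in> fst (E g) \<and> y \<in> fst (G g) \<and> \<phi> g (x +o snd (E g)) = y +o snd (G g)} \<subseteq>
       {(x, y). x \<in> fst (E (g * h)) \<and> y \<in> fst (G (g * h)) \<and> \<phi> (g * h) (x +o snd (E (g * h))) = y +o snd (G (g * h))}"
    proof (intro allI impI, clarify)
      fix h :: "'a R" and x y assume h: "principal h" and x: "x \<in> fst (E g)" "y \<in> fst (G g)" "\<phi> g (x +o snd (E g)) = y +o snd (G g)"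
      have gh: "principal (g * h)" by (rule principal_mult[OF g h])
      have "x +o snd (E g) + snd (E (g * h)) = x +o snd (E (g * h))"
        by (rule coset_add_subgrp[OF wf_subgrp(2)[OF wf(1) gh] _ subgrpD(1)[OF sE]]) (use VE(5)[OF h] in blast)
      moreover have "y +o snd (G g) + snd (G (g * h)) = y +o snd (G (g * h))"
        by (rule coset_add_subgrp[OF wf_subgrp(2)[OF wf(2) gh] _ subgrpD(1)[OF sG]]) (use VG(5)[OF h] in blast)
      ultimately have "\<phi> (g * h) (x +o snd (E (g * h))) = y +o snd (G (g * h))"
        using iso'(4)[OF h cs[OF x(1)]] x(3) by simp
      then show "x \<in> fst (E (g * h)) \<and> y \<in> fst (G (g * h)) \<and> \<phi> (g * h) (x +o snd (E (g * h))) = y +o snd (G (g * h))"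
        using VE(4)[OF h x(1)] VG(4)[OF h x(2)] by simp
    qed
  qed (use k in auto)
qed

section \<open>Determinant and rank in coordinates\<close>

text \<open>The axioms are inherited from the representatives in \<open>P\<close>, since every
  operation on \<open>V\<close> can be carried out there before applying
  \<open>\<pi>\<close>.\<close>

lemma vectorspace_image:
  fixes V :: "('k::field, 'w) module" and \<pi> :: "'v::ab_group_add \<Rightarrow> 'w"
  assumes P: "subgrp P" "\<And>t x. x \<in> P \<Longrightarrow> sc t x \<in> P"
    and sc: "\<And>t x y. sc t (x + y) = sc t x + sc t y" "\<And>s t x. sc (s + t) x = sc s x + sc t x"
      "\<And>s t x. sc (s * t) x = sc s (sc t x)" "\<And>x. sc 1 x = x"
    and V: "carrier V = \<pi> ` P" "zero V = \<pi> 0" "\<And>x y. x \<in> P \<Longrightarrow> y \<in> P \<Longrightarrow> add V (\<pi> x) (\<pi> y) = \<pi> (x + y)"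
      "\<And>t x. x \<in> P \<Longrightarrow> smult V t (\<pi> x) = \<pi> (sc t x)"
  shows "vectorspace class_ring V"
proof (rule vs_criteria)
  note S = subgrpD[OF P(1)]
  show "field (class_ring :: 'k ring)" by (rule class_field.field_axioms)
  show "\<zero>\<^bsub>V\<^esub> \<in> carrier V" using S V by auto
  show "\<forall>v w. v \<in> carrier V \<and> w \<in> carrier V \<longrightarrow> v \<oplus>\<^bsub>V\<^esub> w \<in> carrier V"
    using S V by auto
  show "\<forall>v\<in>carrier V. \<exists>n\<in>carrier V. v \<oplus>\<^bsub>V\<^esub> n = \<zero>\<^bsub>V\<^esub>"
  proof
    fix v assume "v \<in> carrier V"
    then obtain x where "x \<in> P" "v = \<pi> x" using V by auto
    then show "\<exists>n\<in>carrier V. v \<oplus>\<^bsub>V\<^esub> n = \<zero>\<^bsub>V\<^esub>"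
      using S(3)[of x] V by (intro bexI[of _ "\<pi> (- x)"]) auto
  qed
  show "\<forall>c v. c \<in> carrier class_ring \<and> v \<in> carrier V \<longrightarrow> c \<odot>\<^bsub>V\<^esub> v \<in> carrier V"
    using V P(2) by auto
  show "\<forall>v w. v \<in> carrier V \<and> w \<in> carrier V \<longrightarrow> v \<oplus>\<^bsub>V\<^esub> w = w \<oplus>\<^bsub>V\<^esub> v"
    using V by (auto simp: add.commute)
  show "\<forall>v w x. v \<in> carrier V \<and> w \<in> carrier V \<and> x \<in> carrier V \<longrightarrow> v \<oplus>\<^bsub>V\<^esub> w \<oplus>\<^bsub>V\<^esub> x = v \<oplus>\<^bsub>V\<^esub> (w \<oplus>\<^bsub>V\<^esub> x)"
    using V S(4) by (auto simp: add.assoc)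
  show "\<forall>v\<in>carrier V. v \<oplus>\<^bsub>V\<^esub> \<zero>\<^bsub>V\<^esub> = v" using V S(1) by auto
  show "\<forall>a b v. a \<in> carrier class_ring \<and> b \<in> carrier class_ring \<and> v \<in> carrier V \<longrightarrow>
      (a \<otimes>\<^bsub>class_ring\<^esub> b) \<odot>\<^bsub>V\<^esub> v = a \<odot>\<^bsub>V\<^esub> (b \<odot>\<^bsub>V\<^esub> v)"
    using V P(2) by (auto simp: sc)
  show "\<forall>v\<in>carrier V. \<one>\<^bsub>class_ring\<^esub> \<odot>\<^bsub>V\<^esub> v = v" using V by (auto simp: sc)
  show "\<forall>a b v. a \<in> carrier class_ring \<and> b \<in> carrier class_ring \<and> v \<in> carrier V \<longrightarrow>
      (a \<oplus>\<^bsub>class_ring\<^esub> b) \<odot>\<^bsub>V\<^esub> v = a \<odot>\<^bsub>V\<^esub> v \<oplus>\<^bsub>V\<^esub> b \<odot>\<^bsub>V\<^esub> v"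
    using V P(2) by (auto simp: sc)
  show "\<forall>a v w. a \<in> carrier class_ring \<and> v \<in> carrier V \<and> w \<in> carrier V \<longrightarrow>
      a \<odot>\<^bsub>V\<^esub> (v \<oplus>\<^bsub>V\<^esub> w) = a \<odot>\<^bsub>V\<^esub> v \<oplus>\<^bsub>V\<^esub> a \<odot>\<^bsub>V\<^esub> w"
    using V P(2) S(4) by (auto simp: sc)
qed

text \<open>The sum occurring in \<open>coordinates\<close>: coefficients are attached to positions
  in a list, as the columns and rows of the matrix in \<open>map_det\<close> are.\<close>

definition comb :: "('k::field, 'v) module \<Rightarrow> 'v list \<Rightarrow> (nat \<Rightarrow> 'k) \<Rightarrow> 'v" where
  "comb V bs c = finsum V (\<lambda>i. smult V (c i) (bs ! i)) {..<length bs}"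

context
  fixes V :: "('k::field, 'v) module"
  assumes V: "vectorspace class_ring V"
begin

interpretation V: vectorspace class_ring V by (rule V)

lemma comb_closed:
  assumes "set bs \<subseteq> carrier V"
  shows "comb V bs c \<in> carrier V"
proof -
  have b: "i < length bs \<Longrightarrow> bs ! i \<in> carrier V" for i using assms nth_mem by blast
  show ?thesis unfolding comb_def by (rule V.finsum_closed) (use b in auto)
qed

lemma comb_add:
  assumes "set bs \<subseteq> carrier V"
  shows "comb V bs (\<lambda>i. c i + d i) = add V (comb V bs c) (comb V bs d)"
proof -
  have b: "i < length bs \<Longrightarrow> bs ! i \<in> carrier V" for i using assms nth_mem by blast
  have "comb V bs (\<lambda>i. c i + d i) =
      finsum V (\<lambda>i. add V (smult V (c i) (bs ! i)) (smult V (d i) (bs ! i))) {..<length bs}"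
    unfolding comb_def
    by (rule V.finsum_cong') (use b V.smult_l_distr[simplified] in \<open>auto intro!: V.a_closed V.smult_closed\<close>)
  also have "\<dots> = add V (comb V bs c) (comb V bs d)"
    unfolding comb_def by (rule V.finsum_addf) (use b in \<open>auto intro!: V.smult_closed\<close>)
  finally show ?thesis .
qed

lemma comb_smult:
  assumes "set bs \<subseteq> carrier V"
  shows "comb V bs (\<lambda>i. t * c i) = smult V t (comb V bs c)"
proof -
  have b: "i < length bs \<Longrightarrow> bs ! i \<in> carrier V" for i using assms nth_mem by blast
  have "smult V t (comb V bs c) = finsum V (\<lambda>i. smult V t (smult V (c i) (bs ! i))) {..<length bs}"
    unfolding comb_def by (rule V.finsum_smult) (use b in \<open>auto intro!: V.smult_closed\<close>)
  also have "\<dots> = comb V bs (\<lambda>i. t * c i)"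
    unfolding comb_def
    by (rule V.finsum_cong') (use b V.smult_assoc1[simplified] in \<open>auto intro!: V.smult_closed\<close>)
  finally show ?thesis by simp
qed

lemma smult_0: "x \<in> carrier V \<Longrightarrow> smult V 0 x = zero V"
  using V.smult_l_null[simplified] by simp

lemma comb_cong:
  assumes "set bs \<subseteq> carrier V" "\<And>i. i < length bs \<Longrightarrow> c i = d i"
  shows "comb V bs c = comb V bs d"
proof -
  have b: "i < length bs \<Longrightarrow> bs ! i \<in> carrier V" for i using assms(1) nth_mem by blast
  show ?thesis unfolding comb_def by (rule V.finsum_cong') (use b assms(2) in auto)
qed

lemma comb_unit:
  assumes "set bs \<subseteq> carrier V" "j < length bs"
  shows "comb V bs (\<lambda>i. if j = i then 1 else 0) = bs ! j"
proof -
  have b: "i < length bs \<Longrightarrow> bs ! i \<in> carrier V" for i using assms nth_mem by blast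
  have "comb V bs (\<lambda>i. if j = i then 1 else 0) = finsum V (\<lambda>i. if j = i then bs ! i else zero V) {..<length bs}"
    unfolding comb_def
    by (rule V.finsum_cong') (use b V.smult_one[simplified] smult_0 in \<open>auto\<close>)
  also have "\<dots> = bs ! j" by (rule V.finsum_singleton) (use assms b in auto)
  finally show ?thesis .
qed

lemma comb_0: "set bs \<subseteq> carrier V \<Longrightarrow> comb V bs (\<lambda>i. 0) = zero V"
  using comb_smult[of bs 0 "\<lambda>_. 0"] smult_0 comb_closed by simp

lemma comb_lincomb:
  assumes "distinct bs" "set bs \<subseteq> carrier V"
  shows "V.lincomb f (set bs) = comb V bs (\<lambda>i. f (bs ! i))"
proof -
  have "bij_betw ((!) bs) {..<length bs} (set bs)" by (rule bij_betw_nth[OF assms(1)]) auto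
  then have e: "inj_on ((!) bs) {..<length bs}" "(!) bs ` {..<length bs} = set bs" by (auto simp: bij_betw_def)
  have "finsum V (\<lambda>v. f v \<odot>\<^bsub>V\<^esub> v) ((!) bs ` {..<length bs}) = comb V bs (\<lambda>i. f (bs ! i))"
    unfolding comb_def
    by (rule V.finsum_reindex[OF _ e(1)]) (use e(2) assms(2) in \<open>auto intro!: V.smult_closed\<close>)
  then show ?thesis unfolding V.lincomb_def e(2) .
qed

lemma ordered_basis_iff:
  "ordered_basis V bs \<longleftrightarrow> set bs \<subseteq> carrier V \<and> (\<forall>x\<in>carrier V. \<exists>c. x = comb V bs c) \<and>
     (\<forall>c. comb V bs c = zero V \<longrightarrow> (\<forall>i<length bs. c i = 0))"
proof (intro iffI conjI ballI allI impI)
  assume b: "ordered_basis V bs"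
  then have d: "distinct bs" and sub: "set bs \<subseteq> carrier V" and gen: "V.span (set bs) = carrier V"
    and li: "\<not> V.lin_dep (set bs)" by (auto simp: ordered_basis_def V.basis_def)
  show "set bs \<subseteq> carrier V" by (rule sub)
  show "\<exists>c. x = comb V bs c" if "x \<in> carrier V" for x
    using V.finite_in_span[OF _ sub, of x] that gen comb_lincomb[OF d sub] by auto
  fix c i assume c: "comb V bs c = zero V" and i: "i < length bs"
  \<comment> \<open>Transfers the coefficient at a position to the vector standing there, which is
    unambiguous in a list without repetitions.\<close>
  define f where "f v = c (THE j. j < length bs \<and> bs ! j = v)" for v
  have f: "f (bs ! j) = c j" if "j < length bs" for j
  proof -
    have "(THE k. k < length bs \<and> bs ! k = bs ! j) = j"
      by (rule the_equality) (use that d nth_eq_iff_index_eq in auto)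
    then show ?thesis by (simp add: f_def)
  qed
  have "V.lincomb f (set bs) = comb V bs c"
    unfolding comb_lincomb[OF d sub] by (rule comb_cong[OF sub]) (rule f)
  then have l0: "V.lincomb f (set bs) = zero V" using c by simp
  show "c i = 0"
  proof (rule ccontr)
    assume "c i \<noteq> 0"
    then have "f (bs ! i) \<noteq> \<zero>\<^bsub>class_ring\<^esub>" using f[OF i] by simp
    then have "V.lin_dep (set bs)"
      by (intro V.lin_dep_crit[of "set bs" "set bs" f "bs ! i"]) (use i l0 in auto)
    then show False using li by simp
  qed
next
  assume b: "set bs \<subseteq> carrier V \<and> (\<forall>x\<in>carrier V. \<exists>c. x = comb V bs c) \<and>
     (\<forall>c. comb V bs c = zero V \<longrightarrow> (\<forall>i<length bs. c i = 0))"
  then have sub: "set bs \<subseteq> carrier V" and gen: "\<And>x. x \<in> carrier V \<Longrightarrow> \<exists>c. x = comb V bs c"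
    and ind: "\<And>c i. comb V bs c = zero V \<Longrightarrow> i < length bs \<Longrightarrow> c i = 0" by blast+
  \<comment> \<open>Independence by positions excludes repetitions: if the entries at
    \<open>i\<close> and \<open>j\<close> are equal, the difference of the two unit families has
    combination zero but a nonzero coefficient.\<close>
  have d: "distinct bs"
    unfolding distinct_conv_nth
  proof (intro allI impI notI)
    fix i j assume ij: "i < length bs" "j < length bs" "i \<noteq> j" "bs ! i = bs ! j"
    let ?u = "\<lambda>j i. if j = i then 1 else (0::'k)"
    have "comb V bs (\<lambda>k. ?u i k + (- 1) * ?u j k) =
        add V (comb V bs (?u i)) (smult V (- 1) (comb V bs (?u j)))"
      unfolding comb_add[OF sub] comb_smult[OF sub] ..
    also have "\<dots> = add V (comb V bs (?u i)) (smult V (- 1) (comb V bs (?u i)))"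
      unfolding comb_unit[OF sub ij(1)] comb_unit[OF sub ij(2)] ij(4) ..
    also have "\<dots> = comb V bs (\<lambda>k. ?u i k + (- 1) * ?u i k)"
      unfolding comb_add[OF sub] comb_smult[OF sub] ..
    also have "\<dots> = zero V" using comb_0[OF sub] by simp
    finally show False using ind[of _ i] ij by fastforce
  qed
  have "V.basis (set bs)" unfolding V.basis_def
  proof (intro conjI sub)
    show "\<not> V.lin_dep (set bs)"
    proof (rule V.finite_lin_indpt2[OF _ sub])
      fix f assume "V.lincomb f (set bs) = zero V"
      then have "comb V bs (\<lambda>i. f (bs ! i)) = zero V" by (simp add: comb_lincomb[OF d sub])
      then show "\<forall>v\<in>set bs. f v = \<zero>\<^bsub>class_ring\<^esub>" using ind by (auto simp: in_set_conv_nth)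
    qed simp
    show "V.span (set bs) = carrier V"
    proof (intro equalityI subsetI)
      show "x \<in> carrier V" if "x \<in> V.span (set bs)" for x
        using V.span_is_subset2[OF sub] that by blast
    next
      fix x assume "x \<in> carrier V"
      then obtain c where c: "x = comb V bs c" using gen by blast
      define f where "f v = c (THE j. j < length bs \<and> bs ! j = v)" for v
      have f: "f (bs ! j) = c j" if "j < length bs" for j
      proof -
        have "(THE k. k < length bs \<and> bs ! k = bs ! j) = j"
          by (rule the_equality) (use that d nth_eq_iff_index_eq in auto)
        then show ?thesis by (simp add: f_def)
      qed
      have "x = V.lincomb f (set bs)"
        unfolding c comb_lincomb[OF d sub] by (rule comb_cong[OF sub]) (simp add: f)
      then show "x \<in> V.span (set bs)" unfolding V.span_def by auto
    qed
  qed
  then show "ordered_basis V bs" using d by (simp add: ordered_basis_def)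
qed

lemma ordered_basis_length:
  assumes "ordered_basis V bs" "ordered_basis V cs"
  shows "length bs = length cs"
  using assms V.dim_basis distinct_card unfolding ordered_basis_def by (metis List.finite_set)

end

lemma comb_hom:
  fixes V :: "('k::field, 'v) module" and W :: "('k, 'w) module"
  assumes V: "vectorspace class_ring V" and W: "vectorspace class_ring W"
    and T: "T \<in> module_hom class_ring V W" and sub: "set bs \<subseteq> carrier V"
  shows "T (comb V bs c) = comb W (map T bs) c"
proof -
  interpret V: vectorspace class_ring V by (rule V)
  interpret W: vectorspace class_ring W by (rule W)
  interpret T: linear_map class_ring V W T
    unfolding linear_map_def mod_hom_def mod_hom_axioms_def using V W T V.module_axioms W.module_axioms by auto
  have b: "i < length bs \<Longrightarrow> bs ! i \<in> carrier V" for i using sub nth_mem by blast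
  have "T (finsum V g S) = finsum W (\<lambda>i. T (g i)) S" if "finite S" "g \<in> S \<rightarrow> carrier V" for g :: "nat \<Rightarrow> 'v" and S
    using that
  proof (induction S rule: finite_induct)
    case (insert x S)
    have "T (finsum V g (insert x S)) = T (add V (g x) (finsum V g S))"
      using insert by (subst V.finsum_insert) auto
    also have "\<dots> = add W (T (g x)) (T (finsum V g S))"
      using insert.prems by (intro T.f_add V.finsum_closed) auto
    also have "\<dots> = finsum W (\<lambda>i. T (g i)) (insert x S)"
      using insert by (subst W.finsum_insert) (auto simp: Pi_def)
    finally show ?case .
  qed simp
  then have "T (comb V bs c) = finsum W (\<lambda>i. T (smult V (c i) (bs ! i))) {..<length bs}"
    unfolding comb_def using b by (auto intro!: V.smult_closed)
  also have "\<dots> = comb W (map T bs) c"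
    unfolding comb_def length_map
    by (rule W.finsum_cong') (use b in \<open>auto intro!: W.smult_closed\<close>)
  finally show ?thesis .
qed

text \<open>The given bases ensure that the bases chosen in \<open>map_det\<close> exist and have
  equal length. The matrix is then square and represents \<open>T\<close>, so its determinant
  vanishes exactly when some nonzero coordinate vector is sent to zero.\<close>

lemma map_det_eq_0_iff:
  fixes V :: "('k::field, 'v) module" and W :: "('k, 'w) module"
  assumes V: "vectorspace class_ring V" and W: "vectorspace class_ring W"
    and T: "T \<in> module_hom class_ring V W"
    and b: "ordered_basis V bs0" "ordered_basis W cs0" "length bs0 = length cs0"
  shows "map_det V W T = 0 \<longleftrightarrow> (\<exists>x\<in>carrier V. x \<noteq> zero V \<and> T x = zero W)"
proof -
  define bs where "bs = (SOME bs. ordered_basis V bs)"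
  define cs where "cs = (SOME cs. ordered_basis W cs)"
  have ob: "ordered_basis V bs" "ordered_basis W cs"
    unfolding bs_def cs_def using someI[of "ordered_basis V"] someI[of "ordered_basis W"] b by blast+
  define n where "n = length bs"
  have n: "length cs = n" "length bs = n"
    using ordered_basis_length[OF V ob(1) b(1)] ordered_basis_length[OF W ob(2) b(2)] b(3) by (simp_all add: n_def)
  define M where "M = Matrix.mat n n (\<lambda>(i, j). coordinates W cs (T (bs ! j)) i)"
  have M: "M \<in> carrier_mat n n" by (simp add: M_def)
  have det: "map_det V W T = Determinant.det M"
    unfolding map_det_def Let_def bs_def[symmetric] cs_def[symmetric] n M_def ..
  note BV = ob(1)[unfolded ordered_basis_iff[OF V]] and BW = ob(2)[unfolded ordered_basis_iff[OF W]]
  have subV: "set bs \<subseteq> carrier V" and subW: "set cs \<subseteq> carrier W" using BV BW by auto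
  have TV: "T x \<in> carrier W" if "x \<in> carrier V" for x using T that by (auto simp: module_hom_def)
  have TbW: "T (bs ! j) \<in> carrier W" if "j < n" for j
  proof (rule TV)
    have "bs ! j \<in> set bs" using that n(2) by simp
    then show "bs ! j \<in> carrier V" using subV by (rule subsetD[rotated])
  qed
  have Tb: "T (bs ! j) = comb W cs (\<lambda>i. coordinates W cs (T (bs ! j)) i)" if "j < n" for j
  proof -
    have "\<exists>c. T (bs ! j) = comb W cs c" using BW TbW[OF that] by (elim conjE) (rule bspec)
    then show ?thesis unfolding coordinates_def comb_def by (rule someI_ex)
  qed
  interpret W: vectorspace class_ring W by (rule W)
  have Tc: "T (comb V bs c) = comb W cs (\<lambda>i. \<Sum>j<n. c j * coordinates W cs (T (bs ! j)) i)" for c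
  proof -
    have "finsum W (\<lambda>j. smult W (c j) (T (bs ! j))) {..<m} =
        comb W cs (\<lambda>i. \<Sum>j<m. c j * coordinates W cs (T (bs ! j)) i)" if "m \<le> n" for m
      using that
    proof (induction m)
      case 0
      then show ?case using comb_0[OF W subW] by simp
    next
      case (Suc m)
      have m: "T (bs ! j) \<in> carrier W" if "j < Suc m" for j using TbW that Suc.prems by simp
      have "finsum W (\<lambda>j. smult W (c j) (T (bs ! j))) {..<Suc m} =
          add W (smult W (c m) (T (bs ! m))) (finsum W (\<lambda>j. smult W (c j) (T (bs ! j))) {..<m})"
        unfolding lessThan_Suc by (rule W.finsum_insert) (use m in \<open>auto intro!: W.smult_closed\<close>)
      also have "smult W (c m) (T (bs ! m)) = comb W cs (\<lambda>i. c m * coordinates W cs (T (bs ! m)) i)"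
        unfolding comb_smult[OF W subW] using Tb[of m] Suc.prems by simp
      also have "finsum W (\<lambda>j. smult W (c j) (T (bs ! j))) {..<m} =
          comb W cs (\<lambda>i. \<Sum>j<m. c j * coordinates W cs (T (bs ! j)) i)"
        using Suc by simp
      finally show ?case unfolding comb_add[OF W subW, symmetric] by (simp add: add.commute)
    qed
    from this[of n] show ?thesis
      unfolding comb_hom[OF V W T subV] unfolding comb_def[of W "map T bs"]
      using TbW n
      by (subst W.finsum_cong'[of "{..<length (map T bs)}" "{..<n}" "\<lambda>j. smult W (c j) (T (bs ! j))"])
        (auto intro!: W.smult_closed)
  qed
  have zero: "T (comb V bs c) = zero W \<longleftrightarrow> (\<forall>i<n. (\<Sum>j<n. c j * coordinates W cs (T (bs ! j)) i) = 0)" for c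
  proof
    assume "T (comb V bs c) = zero W"
    then show "\<forall>i<n. (\<Sum>j<n. c j * coordinates W cs (T (bs ! j)) i) = 0" using BW unfolding Tc n by blast
  next
    assume "\<forall>i<n. (\<Sum>j<n. c j * coordinates W cs (T (bs ! j)) i) = 0"
    then show "T (comb V bs c) = zero W" unfolding Tc comb_0[OF W subW, symmetric]
      by (intro comb_cong[OF W subW]) (simp add: n)
  qed
  have Mv: "M *\<^sub>v v = 0\<^sub>v n \<longleftrightarrow> (\<forall>i<n. (\<Sum>j<n. Matrix.vec_index v j * coordinates W cs (T (bs ! j)) i) = 0)"
    if "v \<in> carrier_vec n" for v
  proof -
    have "Matrix.vec_index (M *\<^sub>v v) i = (\<Sum>j<n. Matrix.vec_index v j * coordinates W cs (T (bs ! j)) i)" if "i < n" for i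
      using that \<open>v \<in> _\<close> by (simp add: M_def scalar_prod_def mult.commute atLeast0LessThan)
    then show ?thesis using M by (auto simp: Matrix.vec_eq_iff)
  qed
  show ?thesis unfolding det det_0_iff_vec_prod_zero[OF M]
  proof
    assume "\<exists>v. v \<in> carrier_vec n \<and> v \<noteq> 0\<^sub>v n \<and> M *\<^sub>v v = 0\<^sub>v n"
    then obtain v where v: "v \<in> carrier_vec n" "v \<noteq> 0\<^sub>v n" "M *\<^sub>v v = 0\<^sub>v n" by blast
    let ?x = "comb V bs (Matrix.vec_index v)"
    have "T ?x = zero W" using v(1,3) Mv zero by blast
    moreover have "?x \<noteq> zero V" using BV v(1,2) n by (metis Matrix.vec_eq_iff carrier_vecD index_zero_vec)
    ultimately show "\<exists>x\<in>carrier V. x \<noteq> zero V \<and> T x = zero W" using comb_closed[OF V subV] by blast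
  next
    assume "\<exists>x\<in>carrier V. x \<noteq> zero V \<and> T x = zero W"
    then obtain x where x: "x \<in> carrier V" "x \<noteq> zero V" "T x = zero W" by blast
    obtain c where c: "x = comb V bs c" using BV x(1) by blast
    let ?v = "Matrix.vec n c"
    have "comb V bs (Matrix.vec_index ?v) = x" unfolding c by (rule comb_cong[OF V subV]) (simp add: n)
    then have 1: "T (comb V bs (Matrix.vec_index ?v)) = zero W" "comb V bs (Matrix.vec_index ?v) \<noteq> zero V" using x by auto
    have "M *\<^sub>v ?v = 0\<^sub>v n" using 1(1) zero Mv by simp
    moreover have "?v \<noteq> 0\<^sub>v n"
    proof
      assume "?v = 0\<^sub>v n"
      then have "comb V bs (Matrix.vec_index ?v) = comb V bs (\<lambda>_. 0)"
        by (intro comb_cong[OF V subV]) (simp add: n)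
      then show False using 1(2) comb_0[OF V subV] by simp
    qed
    ultimately show "\<exists>v. v \<in> carrier_vec n \<and> v \<noteq> 0\<^sub>v n \<and> M *\<^sub>v v = 0\<^sub>v n" by (intro exI[of _ ?v]) simp
  qed
qed

text \<open>By rank-nullity the defect \<open>length bs - map_rank V W T\<close> is the dimension of
  the kernel; the work lies in showing that dimension \<open>0\<close> means a trivial
  kernel.\<close>

lemma map_rank_less_iff:
  fixes V :: "('k::field, 'v) module" and W :: "('k, 'w) module"
  assumes V: "vectorspace class_ring V" and W: "vectorspace class_ring W"
    and T: "T \<in> module_hom class_ring V W" and b: "ordered_basis V bs"
  shows "map_rank V W T < length bs \<longleftrightarrow> (\<exists>x\<in>carrier V. x \<noteq> zero V \<and> T x = zero W)"
proof -
  interpret V: vectorspace class_ring V by (rule V)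
  interpret W: vectorspace class_ring W by (rule W)
  interpret T: linear_map class_ring V W T
    unfolding linear_map_def mod_hom_def mod_hom_axioms_def using V W T V.module_axioms W.module_axioms by auto
  have B: "V.basis (set bs)" "distinct bs" using b by (auto simp: ordered_basis_def)
  have fd: "V.fin_dim" using B(1) unfolding V.fin_dim_def V.basis_def by blast
  have dim: "V.dim = length bs" using V.dim_basis[OF _ B(1)] distinct_card[OF B(2)] by simp
  have rk: "map_rank V W T = vectorspace.dim class_ring (W.vs T.imT)"
    by (simp add: map_rank_def T.im_def)
  let ?d = "vectorspace.dim class_ring (V.vs T.kerT)"
  have sum: "map_rank V W T + ?d = length bs" using T.rank_nullity[OF fd] rk dim by simp
  have "?d = 0 \<longleftrightarrow> \<not> (\<exists>x\<in>carrier V. x \<noteq> zero V \<and> T x = zero W)"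
  proof
    assume d: "?d = 0"
    interpret K: vectorspace class_ring "V.vs T.kerT" by (rule V.subspace_is_vs[OF T.kerT_is_subspace])
    have li: "K.lin_dep S = V.lin_dep S" if "S \<subseteq> T.kerT" for S
      using V.span_li_not_depend(2)[OF that T.ker_is_submodule] by simp
    \<comment> \<open>\<open>dim\<close> is a least cardinality and says nothing unless a finite
      generating set exists. So the kernel is first shown to be finite dimensional: its independent
      sets are independent in \<open>V\<close>, hence of bounded size.\<close>
    have "\<exists>S. finite S \<and> maximal S (\<lambda>S. S \<subseteq> carrier (V.vs T.kerT) \<and> K.lin_indpt S)"
    proof (rule maximal_exists[where N = "V.dim" and B = "{}"])
      fix S assume S: "S \<subseteq> carrier (V.vs T.kerT) \<and> K.lin_indpt S"
      then have "S \<subseteq> T.kerT" by simp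
      moreover from this have "S \<subseteq> carrier V" by (auto simp: T.ker_def)
      ultimately show "finite S \<and> card S \<le> V.dim" using V.li_le_dim[OF fd] S li by blast
    qed (simp add: K.lin_dep_def)
    then have "K.fin_dim" using K.max_li_is_basis unfolding K.fin_dim_def K.basis_def by blast
    then have "\<exists>n A. finite A \<and> card A = n \<and> A \<subseteq> carrier (V.vs T.kerT) \<and> K.gen_set A"
      unfolding K.fin_dim_def by blast
    then have "\<exists>A. finite A \<and> card A = K.dim \<and> A \<subseteq> carrier (V.vs T.kerT) \<and> K.gen_set A"
      unfolding K.dim_def by (rule LeastI_ex)
    then have "K.gen_set {}" using d by auto
    then have "carrier (V.vs T.kerT) = {zero V}" by (simp add: K.span_empty)
    then show "\<not> (\<exists>x\<in>carrier V. x \<noteq> zero V \<and> T x = zero W)" by (auto simp: T.ker_def)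
  next
    assume "\<not> (\<exists>x\<in>carrier V. x \<noteq> zero V \<and> T x = zero W)"
    then have "carrier (V.vs T.kerT) = {zero V}" by (auto simp: T.ker_def)
    then show "?d = 0" using T.inj_imp_dim_ker0[OF T.Ke0_imp_inj] by simp
  qed
  then show ?thesis using sum by linarith
qed

section \<open>Kernel and image sheaves of the restriction sequence\<close>

text \<open>Two descriptions of a sheaf are compared at principal \<open>g\<close> only; values
  elsewhere carry no meaning.\<close>

lemma sheaf_corr_cong:
  assumes "\<And>g. principal g \<Longrightarrow> E g = E' g" "sheaf_corr E' G \<Gamma>"
  shows "sheaf_corr E G \<Gamma>"
  using assms(2) unfolding sheaf_corr_def by (simp add: assms(1))

lemma wf_sheaf_cong:
  assumes "\<And>g. principal g \<Longrightarrow> E g = E' g" "wf_sheaf E'"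
  shows "wf_sheaf E"
  using assms(2) unfolding wf_sheaf_def by (simp add: assms(1) principal_mult)

lemma homogv_hcompv: "homogv e (hcompv e x)"
  by (simp add: homogv_def hcompv_def)

lemma hcompv_homogv: "homogv e x \<Longrightarrow> hcompv e x = x"
  by (simp add: homogv_def hcompv_def Finite_Cartesian_Product.vec_eq_iff hcomp_homog)

lemma submod_scale_image:
  assumes "submod N"
  shows "submod ((*s) a ` N)"
  unfolding submod_def
proof (intro conjI ballI allI)
  show "0 \<in> (*s) a ` N" using submodD(1)[OF assms] by (intro image_eqI[of _ _ 0]) simp_all
next
  fix x y assume "x \<in> (*s) a ` N" "y \<in> (*s) a ` N"
  then obtain x' y' where "x = a *s x'" "y = a *s y'" "x' \<in> N" "y' \<in> N" by blast
  then show "x + y \<in> (*s) a ` N"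
    using submodD(2)[OF assms] by (intro image_eqI[of _ _ "x' + y'"]) (simp_all add: vector_add_ldistrib)
next
  fix r x assume "x \<in> (*s) a ` N"
  then obtain x' where "x = a *s x'" "x' \<in> N" by blast
  then show "r *s x \<in> (*s) a ` N"
    using submodD(3)[OF assms] by (intro image_eqI[of _ _ "r *s x'"]) (simp_all add: vector_smult_assoc mult.commute)
qed

lemma submod_plus:
  assumes "submod N" "submod N'"
  shows "submod (N + N')"
  unfolding submod_def
proof (intro conjI ballI allI)
  show "0 \<in> N + N'" using set_plus_intro[OF submodD(1)[OF assms(1)] submodD(1)[OF assms(2)]] by simp
next
  fix x y assume "x \<in> N + N'" "y \<in> N + N'"
  then obtain a b c d where "x = a + b" "y = c + d" "a \<in> N" "c \<in> N" "b \<in> N'" "d \<in> N'"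
    by (auto elim!: set_plus_elim)
  moreover from this have "(a + c) + (b + d) \<in> N + N'"
    using submodD[OF assms(1)] submodD[OF assms(2)] by (intro set_plus_intro)
  ultimately show "x + y \<in> N + N'" by (simp add: algebra_simps)
next
  fix r x assume "x \<in> N + N'"
  then obtain a b where "x = a + b" "a \<in> N" "b \<in> N'" by (auto elim!: set_plus_elim)
  then show "r *s x \<in> N + N'"
    using submodD[OF assms(1)] submodD[OF assms(2)] by (auto simp: vector_add_ldistrib intro!: set_plus_intro)
qed

lemma submod_UNIV: "submod UNIV" by (simp add: submod_def)
lemma submod_euler: "submod (range (\<lambda>f. f *s euler))"
proof -
  have "f *s euler + h *s euler = (f + h) *s (euler :: 'a R ^ 3)" for f h by (simp add: vector_sadd_rdistrib)
  moreover have "0 \<in> range (\<lambda>f. f *s (euler :: 'a R ^ 3))" by (rule range_eqI[of _ _ 0]) simp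
  ultimately show ?thesis unfolding submod_def by (auto simp: vector_smult_assoc)
qed

section \<open>Line bundles on the line as quotients of graded modules\<close>

lemma wf_O_line: "wf_sheaf (O_line L m)"
  unfolding O_line_def mod_form_def free_mod_def
  by (rule wf_tilde) (simp_all add: submod_UNIV submod_plus submod_scale_image)

lemma fst_O_line: "fst (O_line L m g) = localize g m UNIV"
  by (simp add: O_line_def mod_form_def free_mod_def tilde_def)

lemma snd_O_line: "snd (O_line L m g) = localize g m ((*s) (line_form L) ` UNIV)"
  by (simp add: O_line_def mod_form_def free_mod_def tilde_def set_zero_plus[unfolded set_zero])

definition vec1 :: "'a \<Rightarrow> 'a ^ 1" where
  "vec1 t = (\<chi> i. t)"

lemma vec1_simps: "vec1 s + vec1 t = vec1 (s + t)" "h *s vec1 t = vec1 (h * t)" "vec1 s = vec1 t \<longleftrightarrow> s = t"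
  by (simp_all add: vec1_def Finite_Cartesian_Product.vec_eq_iff)

lemma homogv_vec1: "homogv d (vec1 t) \<longleftrightarrow> homog d t"
  by (simp add: homogv_def vec1_def)

lemma vec1_cases: obtains t where "x = vec1 t"
proof
  show "x = vec1 (x $ 1)" by (simp add: vec1_def Finite_Cartesian_Product.vec_eq_iff forall_1)
qed

lemma dvd_power_cancel: "prime_elem a \<Longrightarrow> \<not> a dvd f \<Longrightarrow> a dvd f * (x :: 'k::field R) \<Longrightarrow> a dvd x"
  using prime_elem_dvd_multD by blast

context line_frame
begin

lemma O_lineE:
  assumes "y \<in> fst (O_line L m g)" "g \<noteq> 0" "homog e g"
  obtains t j where "y = frv (vec1 t) (g ^ j)" "homog (m + int j * e) t"
  using localizeE[OF assms(1)[unfolded fst_O_line] assms(2,3)] vec1_cases homogv_vec1 by metis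

lemma O_lineI:
  assumes "homog e g" "homog (m + int j * e) t"
  shows "frv (vec1 t) (g ^ j) \<in> fst (O_line L m g)"
  unfolding fst_O_line by (rule localizeI[OF _ assms(1)]) (simp_all add: homogv_vec1 assms)

text \<open>The power \<open>g ^ i\<close> accounts for the case that \<open>\<alpha>\<close>
  divides \<open>g\<close>: then the open set misses the line and every section over it is
  zero.\<close>

lemma O_line_zeroI:
  assumes "g \<noteq> 0" "homog e g" "homog (m + int j * e) t" "\<alpha> dvd g ^ i * t"
  shows "frv (vec1 t) (g ^ j) \<in> snd (O_line L m g)"
proof -
  obtain z where z: "g ^ i * t = \<alpha> * z" using assms(4) ..
  have "frv (vec1 t) (g ^ j) = frv (g ^ i *s vec1 t) (g ^ (i + j))" by (rule frv_raise[OF assms(1)])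
  also have "g ^ i *s vec1 t = \<alpha> *s vec1 z" by (simp add: vec1_simps z)
  also have "frv (\<alpha> *s vec1 z) (g ^ (i + j)) \<in> localize g m ((*s) \<alpha> ` UNIV)"
  proof (rule localizeI[OF _ assms(2)])
    have "homog (int i * e + (m + int j * e)) (\<alpha> * z)" unfolding z[symmetric] by (intro homog_mult homog_power assms)
    moreover have "int i * e + (m + int j * e) = m + int (i + j) * e" by (simp add: algebra_simps)
    ultimately show "homogv (m + int (i + j) * e) (\<alpha> *s vec1 z)"
      by (simp add: vec1_simps homogv_vec1)
  qed simp
  finally show ?thesis by (simp add: snd_O_line line_form_L)
qed

lemma O_line_zeroE:
  assumes "frv (vec1 t) (g ^ j) \<in> snd (O_line L m g)" "g \<noteq> 0" "homog e g"
  obtains i where "\<alpha> dvd g ^ i * t"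
proof -
  obtain w i where w: "frv (vec1 t) (g ^ j) = frv w (g ^ i)" "w \<in> (*s) \<alpha> ` UNIV"
    using localizeE[OF assms(1)[unfolded snd_O_line line_form_L] assms(2,3)] by metis
  then obtain v where v: "w = \<alpha> *s v" by blast
  obtain z where z: "v = vec1 z" by (rule vec1_cases)
  have "g ^ i *s vec1 t = g ^ j *s w" using w(1) assms(2) by (simp add: frv_eq_iff)
  then have "g ^ i * t = g ^ j * (\<alpha> * z)" by (simp add: v z vec1_simps)
  then have "\<alpha> dvd g ^ i * t" by simp
  then show ?thesis using that by blast
qed

text \<open>A graded module \<open>N\<close> with a homogeneous linear form \<open>\<mu>\<close> whose values are multiples of \<open>f\<close>
  modulo \<open>\<alpha>\<close>, and generate \<open>f\<close> locally on the line, has \<open>\<O>\<^sub>L(n + \<delta> - e)\<close> as the associated sheaf of \<open>\<mu>(N) mod \<alpha>\<close>.\<close>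

lemma quotient_corr:
  fixes N :: "('k R ^ 3) set" and \<mu> :: "'k R ^ 3 \<Rightarrow> 'k R"
  assumes N: "submod N" "graded N"
    and add: "\<And>x y. \<mu> (x + y) = \<mu> x + \<mu> y" and smult: "\<And>h x. \<mu> (h *s x) = h * \<mu> x"
    and hc: "\<And>d x. hcomp (d + \<delta>) (\<mu> x) = \<mu> (hcompv d x)"
    and f: "homog e f" "\<not> \<alpha> dvd f"
    and div: "\<And>\<theta>. \<theta> \<in> N \<Longrightarrow> \<exists>y. \<alpha> dvd \<mu> \<theta> - f * y"
    and gen: "\<And>g. Poly_Mapping.lookup g 0 = 0 \<Longrightarrow> \<exists>k. \<exists>\<theta>\<in>N. \<alpha> dvd \<mu> \<theta> - f * g ^ k"
  shows "\<exists>\<Gamma>. sheaf_corr (tilde (N, {\<theta> \<in> N. \<alpha> dvd \<mu> \<theta>}) n) (O_line L (n + \<delta> - e)) \<Gamma>"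
proof -
  let ?N0 = "{\<theta> \<in> N. \<alpha> dvd \<mu> \<theta>}" and ?m = "n + \<delta> - e"
  \<comment> \<open>A numerator \<open>\<theta>\<close> is related to a numerator \<open>t\<close>
    over the same denominator if \<open>t\<close> is the quotient of \<open>\<mu> \<theta>\<close>
    by \<open>f\<close> modulo \<open>\<alpha>\<close>; the degree of \<open>t\<close> is forced by
    those of \<open>\<theta>\<close>, \<open>\<mu>\<close> and \<open>f\<close>.\<close>
  define Q where "Q g d j \<theta> t \<longleftrightarrow> \<theta> \<in> N \<and> homogv (n + int j * d) \<theta> \<and> homog (?m + int j * d) t \<and> \<alpha> dvd \<mu> \<theta> - f * t"
    for g :: "'k R" and d j \<theta> t
  define \<Gamma> where "\<Gamma> g = {(x, y). \<exists>\<theta> t j d. homog d g \<and> x = frv \<theta> (g ^ j) \<and> y = frv (vec1 t) (g ^ j) \<and> Q g d j \<theta> t}" for g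
  have \<Gamma>I: "homog d g \<Longrightarrow> Q g d j \<theta> t \<Longrightarrow> (frv \<theta> (g ^ j), frv (vec1 t) (g ^ j)) \<in> \<Gamma> g" for g d j \<theta> t
    unfolding \<Gamma>_def by blast
  have \<mu>h: "homog (d + \<delta>) (\<mu> x)" if "homogv d x" for d x
    using hc[of d x] hcompv_homogv[OF that] by (metis homog_hcomp)
  have N0: "submod ?N0"
    unfolding submod_def using submodD[OF N(1)] smult[of 0 0] by (auto simp: add smult)
  have "sheaf_corr (tilde (N, ?N0) n) (O_line L ?m) \<Gamma>"
    unfolding sheaf_corr_def
  proof (intro allI impI)
    fix g :: "'k R" assume g: "principal g"
    obtain d where d: "g \<noteq> 0" "homog d g" "d > 0" using principalE[OF g] .
    have \<Gamma>E: "\<exists>\<theta> t j. x = frv \<theta> (g ^ j) \<and> y = frv (vec1 t) (g ^ j) \<and> Q g d j \<theta> t" if "(x, y) \<in> \<Gamma> g" for x y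
      using that homog_unique[OF _ d(2,1)] unfolding \<Gamma>_def by blast
    have raise: "Q g d (i + j) (g ^ i *s \<theta>) (g ^ i * t)" if "Q g d j \<theta> t" for i j \<theta> t
    proof -
      have "\<mu> (g ^ i *s \<theta>) - f * (g ^ i * t) = g ^ i * (\<mu> \<theta> - f * t)" by (simp add: smult algebra_simps)
      then have "\<alpha> dvd \<mu> (g ^ i *s \<theta>) - f * (g ^ i * t)" using that by (simp add: Q_def)
      moreover have "homogv (int i * d + (n + int j * d)) (g ^ i *s \<theta>)" "homog (int i * d + (?m + int j * d)) (g ^ i * t)"
        using that d unfolding Q_def by (auto intro: homogv_smult homog_power homog_mult)
      ultimately show ?thesis using that submodD(3)[OF N(1)] unfolding Q_def by (simp add: algebra_simps)
    qed
    have Qadd: "Q g d j (\<theta> + \<theta>') (t + t')" if "Q g d j \<theta> t" "Q g d j \<theta>' t'" for j \<theta> t \<theta>' t'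
    proof -
      have "\<mu> (\<theta> + \<theta>') - f * (t + t') = (\<mu> \<theta> - f * t) + (\<mu> \<theta>' - f * t')" by (simp add: add algebra_simps)
      then show ?thesis using that submodD(2)[OF N(1)] unfolding Q_def by (auto intro: homogv_add homog_add)
    qed
    show "(\<forall>(x, y)\<in>\<Gamma> g. x \<in> fst (tilde (N, ?N0) n g) \<and> y \<in> fst (O_line L ?m g) \<and>
            (x \<in> snd (tilde (N, ?N0) n g) \<longleftrightarrow> y \<in> snd (O_line L ?m g))) \<and>
     (\<forall>x\<in>fst (tilde (N, ?N0) n g). \<exists>y. (x, y) \<in> \<Gamma> g) \<and> (\<forall>y\<in>fst (O_line L ?m g). \<exists>x. (x, y) \<in> \<Gamma> g) \<and>
     (\<forall>x\<in>snd (tilde (N, ?N0) n g). \<forall>y\<in>snd (O_line L ?m g). (x, y) \<in> \<Gamma> g) \<and>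
     (\<forall>(x, y)\<in>\<Gamma> g. \<forall>(x', y')\<in>\<Gamma> g. (x + x', y + y') \<in> \<Gamma> g) \<and>
     (\<forall>r\<in>structure_ring g. \<forall>(x, y)\<in>\<Gamma> g. (r *s x, r *s y) \<in> \<Gamma> g) \<and>
     (\<forall>h. principal h \<longrightarrow> \<Gamma> g \<subseteq> \<Gamma> (g * h))"
    proof (intro conjI ballI)
      fix xy assume "xy \<in> \<Gamma> g"
      then obtain x y where xy: "xy = (x, y)" "(x, y) \<in> \<Gamma> g" by (cases xy) auto
      obtain \<theta> t j where xyq: "x = frv \<theta> (g ^ j)" "y = frv (vec1 t) (g ^ j)" "Q g d j \<theta> t"
        using \<Gamma>E[OF xy(2)] by blast
      have q: "\<theta> \<in> N" "homogv (n + int j * d) \<theta>" "homog (?m + int j * d) t" "\<alpha> dvd \<mu> \<theta> - f * t"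
        using xyq(3) by (auto simp: Q_def)
      \<comment> \<open>As \<open>f\<close> is prime to \<open>\<alpha>\<close>, the values
        \<open>\<mu> \<theta>\<close> and \<open>t\<close> become multiples of
        \<open>\<alpha>\<close> after the same powers of \<open>g\<close>. This matches the zero
        representatives of both sides.\<close>
      have gi: "\<alpha> dvd g ^ i * \<mu> \<theta> \<longleftrightarrow> \<alpha> dvd g ^ i * t" for i
      proof -
        have "g ^ i * \<mu> \<theta> = g ^ i * (\<mu> \<theta> - f * t) + f * (g ^ i * t)" by (simp add: algebra_simps)
        moreover have "\<alpha> dvd g ^ i * (\<mu> \<theta> - f * t)" using q(4) by simp
        ultimately have "\<alpha> dvd g ^ i * \<mu> \<theta> \<longleftrightarrow> \<alpha> dvd f * (g ^ i * t)" by (simp only: dvd_add_right_iff)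
        also have "\<dots> \<longleftrightarrow> \<alpha> dvd g ^ i * t"
          by (rule iffI, erule dvd_power_cancel[OF prime_\<alpha> f(2)], erule dvd_mult)
        finally show ?thesis .
      qed
      have "x \<in> localize g n N" unfolding xyq by (rule localizeI[OF q(1) d(2) q(2)])
      moreover have "y \<in> fst (O_line L ?m g)" unfolding xyq by (rule O_lineI[OF d(2) q(3)])
      moreover have "x \<in> localize g n ?N0 \<longleftrightarrow> y \<in> snd (O_line L ?m g)"
      proof
        assume "x \<in> localize g n ?N0"
        then obtain \<eta> i where \<eta>: "x = frv \<eta> (g ^ i)" "\<alpha> dvd \<mu> \<eta>"
          using localizeE[OF _ d(1,2)] by (metis (no_types, lifting) mem_Collect_eq)
        then have "g ^ i *s \<theta> = g ^ j *s \<eta>" using xyq(1) d(1) by (simp add: frv_eq_iff)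
        then have "g ^ i * \<mu> \<theta> = g ^ j * \<mu> \<eta>" by (metis smult)
        then have "\<alpha> dvd g ^ i * \<mu> \<theta>" using \<eta>(2) by simp
        then show "y \<in> snd (O_line L ?m g)" unfolding xyq gi by (rule O_line_zeroI[OF d(1,2) q(3)])
      next
        assume "y \<in> snd (O_line L ?m g)"
        then obtain i where i: "\<alpha> dvd g ^ i * t" using O_line_zeroE[OF _ d(1,2)] unfolding xyq by blast
        have "x = frv (g ^ i *s \<theta>) (g ^ (i + j))" unfolding xyq by (rule frv_raise[OF d(1)])
        also have "\<dots> \<in> localize g n ?N0"
        proof (rule localizeI[OF _ d(2)])
          show "g ^ i *s \<theta> \<in> ?N0" using i gi submodD(3)[OF N(1) q(1)] by (simp add: smult)
          show "homogv (n + int (i + j) * d) (g ^ i *s \<theta>)" using raise[OF xyq(3)] by (simp add: Q_def)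
        qed
        finally show "x \<in> localize g n ?N0" .
      qed
      ultimately show "case xy of (x, y) \<Rightarrow> x \<in> fst (tilde (N, ?N0) n g) \<and> y \<in> fst (O_line L ?m g) \<and>
            (x \<in> snd (tilde (N, ?N0) n g) \<longleftrightarrow> y \<in> snd (O_line L ?m g))"
        unfolding xy(1) tilde_def by simp
      have "(x + x', y + y') \<in> \<Gamma> g" if xy': "(x', y') \<in> \<Gamma> g" for x' y'
      proof -
        obtain \<theta>' t' j' where xyq': "x' = frv \<theta>' (g ^ j')" "y' = frv (vec1 t') (g ^ j')" "Q g d j' \<theta>' t'"
          using \<Gamma>E[OF xy'] by blast
        have "Q g d (j + j') (g ^ j' *s \<theta> + g ^ j *s \<theta>') (g ^ j' * t + g ^ j * t')"
          using raise[OF xyq(3), of j'] raise[OF xyq'(3), of j] by (intro Qadd) (simp_all add: add.commute)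
        then have "(frv (g ^ j' *s \<theta> + g ^ j *s \<theta>') (g ^ (j + j')), frv (vec1 (g ^ j' * t + g ^ j * t')) (g ^ (j + j'))) \<in> \<Gamma> g"
          by (rule \<Gamma>I[OF d(2)])
        moreover have "x + x' = frv (g ^ j' *s \<theta> + g ^ j *s \<theta>') (g ^ (j + j'))"
          unfolding xyq xyq' power_add using d(1) by (intro frv_add) auto
        moreover have "y + y' = frv (vec1 (g ^ j' * t + g ^ j * t')) (g ^ (j + j'))"
          unfolding xyq xyq' power_add using d(1) by (subst frv_add) (auto simp: vec1_simps)
        ultimately show ?thesis by simp
      qed
      then show "case xy of (x, y) \<Rightarrow> \<forall>(x', y')\<in>\<Gamma> g. (x + x', y + y') \<in> \<Gamma> g"
        unfolding xy(1) by auto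
    next
      fix x assume "x \<in> fst (tilde (N, ?N0) n g)"
      then obtain \<theta> j where x: "x = frv \<theta> (g ^ j)" "\<theta> \<in> N" "homogv (n + int j * d) \<theta>"
        using localizeE[OF _ d(1,2)] unfolding tilde_def fst_conv by metis
      obtain y z where z: "\<mu> \<theta> - f * y = \<alpha> * z" using div[OF x(2)] by (auto simp: dvd_def)
      \<comment> \<open>The quotient \<open>y\<close> need not be homogeneous. Taking components of
        the identity in the degree of \<open>\<mu> \<theta>\<close> replaces it by its component of
        the required degree.\<close>
      have "hcomp (n + int j * d + \<delta>) (\<mu> \<theta> - f * y) = \<alpha> * hcomp (n + int j * d + \<delta> - 1) z"
        unfolding z by (rule hcomp_mult[OF homog_linear_form])
      then have "\<mu> \<theta> - f * hcomp (n + int j * d + \<delta> - e) y = \<alpha> * hcomp (n + int j * d + \<delta> - 1) z"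
        unfolding hcomp_diff hc hcompv_homogv[OF x(3)] hcomp_mult[OF f(1)] .
      moreover have "homog (?m + int j * d) (hcomp (n + int j * d + \<delta> - e) y)"
        using homog_hcomp[of "n + int j * d + \<delta> - e" y] by (simp add: algebra_simps)
      ultimately have "Q g d j \<theta> (hcomp (n + int j * d + \<delta> - e) y)" using x by (simp add: Q_def)
      then show "\<exists>y. (x, y) \<in> \<Gamma> g" using \<Gamma>I[OF d(2)] x(1) by blast
    next
      fix y assume "y \<in> fst (O_line L ?m g)"
      then obtain t j where y: "y = frv (vec1 t) (g ^ j)" "homog (?m + int j * d) t"
        using O_lineE[OF _ d(1,2)] by blast
      \<comment> \<open>After multiplying \<open>t\<close> and its denominator by
        \<open>g ^ k\<close>, the derivation \<open>t *s \<theta>0\<close> attains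
        \<open>f * g ^ k * t\<close>. As \<open>\<theta>0\<close> need not be homogeneous, a
        component of that multiple is used.\<close>
      obtain k \<theta>0 where \<theta>0: "\<theta>0 \<in> N" "\<alpha> dvd \<mu> \<theta>0 - f * g ^ k" using gen[OF principal_no_constant[OF g]] by blast
      let ?D = "n + int (k + j) * d"
      obtain z where z: "\<mu> \<theta>0 - f * g ^ k = \<alpha> * z" using \<theta>0(2) ..
      have ht: "homog (int k * d + (?m + int j * d)) (g ^ k * t)" by (intro homog_mult homog_power d y)
      have hf: "homog (e + (int k * d + (?m + int j * d))) (f * (g ^ k * t))" by (intro homog_mult f ht)
      have "\<mu> (t *s \<theta>0) - f * (g ^ k * t) = t * (\<mu> \<theta>0 - f * g ^ k)" by (simp add: smult algebra_simps)
      then have "\<mu> (t *s \<theta>0) - f * (g ^ k * t) = \<alpha> * (t * z)" unfolding z by (simp add: ac_simps)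
      then have "hcomp (?D + \<delta>) (\<mu> (t *s \<theta>0) - f * (g ^ k * t)) = \<alpha> * hcomp (?D + \<delta> - 1) (t * z)"
        by (simp only: hcomp_mult[OF homog_linear_form])
      moreover have "hcomp (?D + \<delta>) (f * (g ^ k * t)) = f * (g ^ k * t)"
        by (rule hcomp_homog) (use hf in \<open>simp add: algebra_simps\<close>)
      ultimately have "\<mu> (hcompv ?D (t *s \<theta>0)) - f * (g ^ k * t) = \<alpha> * hcomp (?D + \<delta> - 1) (t * z)"
        unfolding hcomp_diff hc by simp
      moreover have "hcompv ?D (t *s \<theta>0) \<in> N" using N(2) submodD(3)[OF N(1) \<theta>0(1)] by (auto simp: graded_def)
      moreover have "homog (?m + int (k + j) * d) (g ^ k * t)" using ht by (simp add: algebra_simps)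
      ultimately have "Q g d (k + j) (hcompv ?D (t *s \<theta>0)) (g ^ k * t)"
        unfolding Q_def using homogv_hcompv by simp
      moreover have "y = frv (vec1 (g ^ k * t)) (g ^ (k + j))"
        unfolding y vec1_simps(2)[symmetric] by (rule frv_raise[OF d(1)])
      ultimately show "\<exists>x. (x, y) \<in> \<Gamma> g" using \<Gamma>I[OF d(2)] by blast
    next
      fix x y assume "x \<in> snd (tilde (N, ?N0) n g)" "y \<in> snd (O_line L ?m g)"
      then have xW: "x \<in> localize g n ?N0" and yW: "y \<in> snd (O_line L ?m g)" by (simp_all add: tilde_def)
      obtain \<theta> j where x: "x = frv \<theta> (g ^ j)" "\<theta> \<in> ?N0" "homogv (n + int j * d) \<theta>" using localizeE[OF xW d(1,2)] .
      obtain t i where y: "y = frv (vec1 t) (g ^ i)" "homog (?m + int i * d) t"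
        using O_lineE[OF wf_sheafD(3)[OF wf_O_line g yW] d(1,2)] .
      obtain l where l: "\<alpha> dvd g ^ l * t" using O_line_zeroE[OF yW[unfolded y] d(1,2)] .
      \<comment> \<open>Both numerators are brought over the denominator
        \<open>g ^ (l + i + j)\<close>. The surplus \<open>g ^ l\<close> makes \<open>?t\<close> a
        multiple of \<open>\<alpha>\<close>, so both sides of the required congruence
        vanish.\<close>
      let ?\<theta> = "g ^ (l + i) *s \<theta>" and ?t = "g ^ j * (g ^ l * t)"
      have "\<alpha> dvd \<mu> ?\<theta> - f * ?t" using x(2) l by (auto simp: smult intro!: dvd_diff)
      moreover have "homogv (int (l + i) * d + (n + int j * d)) ?\<theta>"
        by (intro homogv_smult homog_power d x)
      moreover have "homog (int j * d + (int l * d + (?m + int i * d))) ?t"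
        by (intro homog_mult homog_power d y)
      ultimately have "Q g d (l + i + j) ?\<theta> ?t"
        unfolding Q_def using x(2) submodD(3)[OF N(1)] by (simp add: algebra_simps)
      moreover have "x = frv ?\<theta> (g ^ (l + i + j))" unfolding x by (rule frv_raise[OF d(1)])
      moreover have "y = frv (vec1 ?t) (g ^ (l + i + j))"
        unfolding y using frv_raise[OF d(1), of "vec1 t" i "j + l"] by (simp add: vec1_simps power_add ac_simps)
      ultimately show "(x, y) \<in> \<Gamma> g" using \<Gamma>I[OF d(2)] by simp
    next
      fix s xy assume s: "s \<in> structure_ring g" and "xy \<in> \<Gamma> g"
      then obtain x y where xy: "xy = (x, y)" "(x, y) \<in> \<Gamma> g" by (cases xy) auto
      obtain \<theta> t j where xyq: "x = frv \<theta> (g ^ j)" "y = frv (vec1 t) (g ^ j)" "Q g d j \<theta> t"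
        using \<Gamma>E[OF xy(2)] by blast
      obtain h i where h: "s = Fract h (g ^ i)" "homog (int i * d) h" using structure_ringE[OF s d(1,2)] .
      have "\<mu> (h *s \<theta>) - f * (h * t) = h * (\<mu> \<theta> - f * t)" by (simp add: smult algebra_simps)
      then have "\<alpha> dvd \<mu> (h *s \<theta>) - f * (h * t)" using xyq(3) by (simp add: Q_def)
      moreover have "homogv (int i * d + (n + int j * d)) (h *s \<theta>)" "homog (int i * d + (?m + int j * d)) (h * t)"
        using xyq(3) h(2) unfolding Q_def by (auto intro: homogv_smult homog_mult)
      ultimately have "Q g d (i + j) (h *s \<theta>) (h * t)"
        using xyq(3) submodD(3)[OF N(1)] unfolding Q_def by (simp add: algebra_simps)
      then have "(frv (h *s \<theta>) (g ^ (i + j)), frv (vec1 (h * t)) (g ^ (i + j))) \<in> \<Gamma> g" by (rule \<Gamma>I[OF d(2)])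
      then show "case xy of (x, y) \<Rightarrow> (s *s x, s *s y) \<in> \<Gamma> g"
        unfolding xy h xyq by (simp add: frv_smult vec1_simps power_add)
    next
      show "\<forall>h. principal h \<longrightarrow> \<Gamma> g \<subseteq> \<Gamma> (g * h)"
      proof (intro allI impI subsetI)
        fix h :: "'k R" and xy assume h: "principal h" and "xy \<in> \<Gamma> g"
        then obtain x y where xy: "xy = (x, y)" "(x, y) \<in> \<Gamma> g" by (cases xy) auto
        obtain b where b: "h \<noteq> 0" "homog b h" "b > 0" using principalE[OF h] .
        obtain \<theta> t j where xyq: "x = frv \<theta> (g ^ j)" "y = frv (vec1 t) (g ^ j)" "Q g d j \<theta> t"
          using \<Gamma>E[OF xy(2)] by blast
        have "\<mu> (h ^ j *s \<theta>) - f * (h ^ j * t) = h ^ j * (\<mu> \<theta> - f * t)" by (simp add: smult algebra_simps)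
        then have "\<alpha> dvd \<mu> (h ^ j *s \<theta>) - f * (h ^ j * t)" using xyq(3) by (simp add: Q_def)
        moreover have "homogv (int j * b + (n + int j * d)) (h ^ j *s \<theta>)" "homog (int j * b + (?m + int j * d)) (h ^ j * t)"
          using xyq(3) b unfolding Q_def by (auto intro: homogv_smult homog_mult homog_power)
        ultimately have "Q (g * h) (d + b) j (h ^ j *s \<theta>) (h ^ j * t)"
          using xyq(3) submodD(3)[OF N(1)] unfolding Q_def by (simp add: algebra_simps)
        then have "(frv (h ^ j *s \<theta>) ((g * h) ^ j), frv (vec1 (h ^ j * t)) ((g * h) ^ j)) \<in> \<Gamma> (g * h)"
          by (rule \<Gamma>I[OF homog_mult[OF d(2) b(2)]])
        moreover have "frv (h ^ j *s \<theta>) ((g * h) ^ j) = x" "frv (vec1 (h ^ j * t)) ((g * h) ^ j) = y"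
          using b(1) frv_cancel[of "h ^ j" \<theta> "g ^ j"] frv_cancel[of "h ^ j" "vec1 t" "g ^ j"]
          by (simp_all add: xyq power_mult_distrib mult.commute vec1_simps)
        ultimately show "xy \<in> \<Gamma> (g * h)" by (simp add: xy)
      qed
    qed
  qed
  then show ?thesis by blast
qed

end

lemma stable_plus:
  assumes "stable g X" "stable g Y"
  shows "stable g (X + Y)"
  unfolding stable_def
proof (intro conjI ballI)
  show "0 \<in> X + Y" using set_plus_intro[OF stableD(1)[OF assms(1)] stableD(1)[OF assms(2)]] by simp
next
  fix x y assume "x \<in> X + Y" "y \<in> X + Y"
  then obtain a b c d where "x = a + b" "y = c + d" "a \<in> X" "c \<in> X" "b \<in> Y" "d \<in> Y"
    by (auto elim!: set_plus_elim)
  moreover from this have "(a + c) + (b + d) \<in> X + Y"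
    using stableD[OF assms(1)] stableD[OF assms(2)] by (intro set_plus_intro)
  ultimately show "x + y \<in> X + Y" by (simp add: algebra_simps)
next
  fix r x assume "r \<in> structure_ring g" "x \<in> X + Y"
  then obtain a b where "x = a + b" "a \<in> X" "b \<in> Y" by (auto elim!: set_plus_elim)
  then show "r *s x \<in> X + Y"
    using stableD[OF assms(1)] stableD[OF assms(2)] \<open>r \<in> _\<close> by (auto simp: vector_add_ldistrib intro!: set_plus_intro)
qed

lemma stable_scale_image:
  assumes "stable g X"
  shows "stable g ((*s) a ` X)"
  unfolding stable_def
proof (intro conjI ballI allI)
  show "0 \<in> (*s) a ` X" using stableD(1)[OF assms] by (intro image_eqI[of _ _ 0]) simp_all
next
  fix x y assume "x \<in> (*s) a ` X" "y \<in> (*s) a ` X"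
  then obtain x' y' where "x = a *s x'" "y = a *s y'" "x' \<in> X" "y' \<in> X" by blast
  then show "x + y \<in> (*s) a ` X"
    using stableD(2)[OF assms] by (intro image_eqI[of _ _ "x' + y'"]) (simp_all add: vector_add_ldistrib)
next
  fix r x assume r: "r \<in> structure_ring g" "x \<in> (*s) a ` X"
  then obtain x' where "x = a *s x'" "x' \<in> X" by blast
  then show "r *s x \<in> (*s) a ` X"
    using stableD(3)[OF assms _ r(1)] by (intro image_eqI[of _ _ "r *s x'"]) (simp_all add: vector_smult_assoc mult.commute)
qed

lemma wf_image_sheaf:
  assumes E: "wf_sheaf E" and G: "wf_sheaf G"
  shows "wf_sheaf (image_sheaf ((*s) a) E G)"
  unfolding wf_sheaf_def image_sheaf_def fst_conv snd_conv
proof (intro allI impI conjI)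
  fix g :: "'a R" assume g: "principal g"
  note E = wf_sheafD[OF E g] and G = wf_sheafD[OF G g]
  show "stable g ((*s) a ` fst (E g) + snd (G g))" "stable g (snd (G g))"
    using E G by (auto intro: stable_plus stable_scale_image)
  show "snd (G g) \<subseteq> (*s) a ` fst (E g) + snd (G g)"
    using set_plus_intro[OF stableD(1)[OF stable_scale_image[OF E(1)]]] by fastforce
  fix h :: "'a R" assume h: "principal h"
  show "(*s) a ` fst (E g) + snd (G g) \<subseteq> (*s) a ` fst (E (g * h)) + snd (G (g * h))"
    by (rule set_plus_mono2) (use E(4)[OF h] G(5)[OF h] in blast)+
  show "snd (G g) \<subseteq> snd (G (g * h))" using G(5)[OF h] by blast
qed

section \<open>Kernel and image of multiplication by \<open>\<alpha>\<close>\<close>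

context arr_frame
begin

lemma der_on_line_simps:
  "fst (der_on_line L A n g) = localize g n (D A)"
  "snd (der_on_line L A n g) = localize g n (range (\<lambda>f. f *s euler) + (*s) \<alpha> ` D A)"
  "fst (der_on_line L (insert L A) n g) = localize g n (D (insert L A))"
  "snd (der_on_line L (insert L A) n g) = localize g n (range (\<lambda>f. f *s euler) + (*s) \<alpha> ` D (insert L A))"
  by (simp_all add: der_on_line_def tilde_def mod_form_def der_mod_def line_form_L)

lemma euler_in_D: "arrangement B \<Longrightarrow> f *s euler \<in> D B"
  by (simp add: D_iff pair_smult pair_euler line_form_covec)

lemma wf_der: "wf_sheaf (der_on_line L B n)" if "arrangement B"
  unfolding der_on_line_def mod_form_def der_mod_def fst_conv snd_conv
proof (rule wf_tilde)
  show "snd (D B, range (\<lambda>f. f *s euler) + (*s) (line_form L) ` D B) \<subseteq> fst (D B, range (\<lambda>f. f *s euler) + (*s) (line_form L) ` D B)"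
    using submodD[OF submod_D[OF that]] euler_in_D[OF that] by (auto elim!: set_plus_elim)
qed (simp_all add: submod_D that submod_plus submod_euler submod_scale_image)

abbreviation "scale_\<alpha> \<equiv> (*s) (Fract \<alpha> 1) :: 'k R fract ^ 3 \<Rightarrow> 'k R fract ^ 3"

text \<open>This identifies the Tor term. An identity \<open>g ^ i *s (\<alpha> *s \<theta>) = g ^ j
  *s (h *s euler + \<alpha> *s \<eta>)\<close> forces \<open>\<alpha>\<close> to divide
  \<open>g ^ j * h\<close>; cancelling it expresses \<open>g ^ i *s \<theta>\<close> by
  \<open>euler\<close> and \<open>\<eta>\<close>, which satisfy the condition for
  \<open>L\<close>.\<close>

lemma kernel_iff:
  assumes g: "principal g" and x: "x \<in> localize g n (D A)"
  shows "scale_\<alpha> x \<in> localize g (n + 1) (range (\<lambda>f. f *s euler) + (*s) \<alpha> ` D (insert L A)) \<longleftrightarrow>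
    x \<in> localize g n (D (insert L A))"
proof
  obtain d where d: "g \<noteq> 0" "homog d g" "d > 0" using principalE[OF g] .
  {
    assume "x \<in> localize g n (D (insert L A))"
    then obtain \<theta> j where \<theta>: "x = frv \<theta> (g ^ j)" "\<theta> \<in> D (insert L A)" "homogv (n + int j * d) \<theta>"
      using localizeE[OF _ d(1,2)] by blast
    have "scale_\<alpha> x = frv (\<alpha> *s \<theta>) (g ^ j)" unfolding \<theta> frv_smult by simp
    also have "\<dots> \<in> localize g (n + 1) (range (\<lambda>f. f *s euler) + (*s) \<alpha> ` D (insert L A))"
    proof (rule localizeI[OF _ d(2)])
      have "0 *s euler + \<alpha> *s \<theta> \<in> range (\<lambda>f. f *s euler) + (*s) \<alpha> ` D (insert L A)"
        using \<theta>(2) by (intro set_plus_intro) auto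
      then show "\<alpha> *s \<theta> \<in> range (\<lambda>f. f *s euler) + (*s) \<alpha> ` D (insert L A)" by simp
      show "homogv (n + 1 + int j * d) (\<alpha> *s \<theta>)"
        using homogv_smult[OF homog_linear_form \<theta>(3)] by (simp add: algebra_simps)
    qed
    finally show "scale_\<alpha> x \<in> localize g (n + 1) (range (\<lambda>f. f *s euler) + (*s) \<alpha> ` D (insert L A))" .
  }
  assume "scale_\<alpha> x \<in> localize g (n + 1) (range (\<lambda>f. f *s euler) + (*s) \<alpha> ` D (insert L A))"
  then obtain m i where m: "scale_\<alpha> x = frv m (g ^ i)" "m \<in> range (\<lambda>f. f *s euler) + (*s) \<alpha> ` D (insert L A)"
    using localizeE[OF _ d(1,2)] by blast
  then obtain h \<eta> where h: "m = h *s euler + \<alpha> *s \<eta>" "\<eta> \<in> D (insert L A)" by (auto elim!: set_plus_elim)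
  obtain \<theta> j where \<theta>: "x = frv \<theta> (g ^ j)" "\<theta> \<in> D A" "homogv (n + int j * d) \<theta>"
    using localizeE[OF x d(1,2)] .
  have "frv (\<alpha> *s \<theta>) (g ^ j) = frv m (g ^ i)" using m(1) unfolding \<theta> frv_smult by simp
  then have eq: "g ^ i *s (\<alpha> *s \<theta>) = g ^ j *s m" using d(1) by (simp add: frv_eq_iff)
  have \<eta>D: "\<eta> \<in> D A" "\<alpha> dvd pair c \<eta>" using h(2) by (auto simp: D_insert)
  have "\<alpha> * (g ^ i * pair c \<theta>) = pair c (g ^ i *s (\<alpha> *s \<theta>))" by (simp add: pair_smult ac_simps)
  have eqi: "g ^ i * (\<alpha> * \<theta> $ k) = g ^ j * (h * var k + \<alpha> * \<eta> $ k)" for k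
  proof -
    have "(g ^ i *s (\<alpha> *s \<theta>)) $ k = (g ^ j *s m) $ k" by (rule arg_cong[OF eq])
    then show ?thesis by (simp add: h euler_def)
  qed
  have ak: "\<alpha> dvd (g ^ j * h) * var k" for k
  proof -
    have "(g ^ j * h) * var k = \<alpha> * (g ^ i * \<theta> $ k) - \<alpha> * (g ^ j * \<eta> $ k)"
      using eqi[of k] by (simp add: algebra_simps)
    then show ?thesis by simp
  qed
  have "\<alpha> dvd (g ^ j * h) * linear_form a"
  proof -
    have "(g ^ j * h) * linear_form a = (\<Sum>k\<in>UNIV. const (a $ k) * ((g ^ j * h) * var k))"
      by (simp only: linear_form_def sum_distrib_left mult.left_commute)
    also have "\<alpha> dvd \<dots>" by (intro dvd_sum dvd_mult ak)
    finally show ?thesis .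
  qed
  moreover have "\<not> \<alpha> dvd linear_form a"
    using toL_frame(1) prime_elem_not_zeroI[OF prime_elem_linear_form[of "axis 1 (1::'k)"]]
    by (simp add: dvd_iff_toL linear_form_axis axis_eq_0_iff)
  ultimately have "\<alpha> dvd g ^ j * h" using prime_elem_dvd_multD[OF prime_\<alpha>] by blast
  then obtain h' where h': "g ^ j * h = \<alpha> * h'" ..
  have \<alpha>0: "\<alpha> \<noteq> 0" by (rule prime_elem_not_zeroI[OF prime_\<alpha>])
  have "g ^ i *s \<theta> = h' *s euler + g ^ j *s \<eta>"
  proof -
    have "(g ^ i *s \<theta>) $ k = (h' *s euler + g ^ j *s \<eta>) $ k" for k
    proof -
      have "\<alpha> * (g ^ i * \<theta> $ k) = g ^ i * (\<alpha> * \<theta> $ k)" by (simp only: ac_simps)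
      also have "\<dots> = (g ^ j * h) * var k + \<alpha> * (g ^ j * \<eta> $ k)" unfolding eqi by (simp only: ring_distribs ac_simps)
      also have "\<dots> = \<alpha> * (h' * var k + g ^ j * \<eta> $ k)" unfolding h' by (simp only: ring_distribs ac_simps)
      finally show ?thesis using \<alpha>0 by (simp add: euler_def)
    qed
    then show ?thesis by (simp add: Finite_Cartesian_Product.vec_eq_iff)
  qed
  then have "g ^ i *s \<theta> \<in> D (insert L A)"
    using submodD[OF submod_D[OF arr_insert]] euler_in_D[OF arr_insert] h(2) by auto
  moreover have "x = frv (g ^ i *s \<theta>) (g ^ (i + j))" unfolding \<theta> by (rule frv_raise[OF d(1)])
  moreover have "homogv (n + int (i + j) * d) (g ^ i *s \<theta>)"
    using homogv_smult[OF homog_power[OF d(2)] \<theta>(3), of i] by (simp add: algebra_simps)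
  ultimately show "x \<in> localize g n (D (insert L A))" using localizeI[OF _ d(2)] by blast
qed

lemma hcomp_lam: "hcomp (d + 1) (lam x) = lam (hcompv d x)"
proof -
  have "hcomp (d + 1) (pair v x * linear_form w) = pair v (hcompv d x) * linear_form w" for v w
    unfolding mult.commute[of _ "linear_form w"] hcomp_mult[OF homog_linear_form]
    by (simp add: hcomp_pair hcompv_def)
  then show ?thesis by (simp add: lam_def hcomp_diff)
qed

text \<open>By \<open>kernel_iff\<close> and \<open>lam_kernel\<close> the kernel sheaf is that of
  \<open>D (insert L A)\<close> modulo the derivations on which \<open>lam\<close> vanishes along
  \<open>L\<close>. The twist arises because \<open>lam\<close> raises degrees by \<open>1\<close>
  and \<open>Q2\<close> has degree \<open>card (restriction A L)\<close>.\<close>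

lemma kernel_corr:
  "\<exists>\<Gamma>. sheaf_corr (kernel_sheaf scale_\<alpha> (der_on_line L A n) (der_on_line L (insert L A) (n + 1)))
     (O_line L (n + 1 - int (card (restriction A L)))) \<Gamma>"
  "wf_sheaf (kernel_sheaf scale_\<alpha> (der_on_line L A n) (der_on_line L (insert L A) (n + 1)))"
proof -
  let ?K = "kernel_sheaf scale_\<alpha> (der_on_line L A n) (der_on_line L (insert L A) (n + 1))"
  let ?T = "tilde (D (insert L A), {\<theta> \<in> D (insert L A). \<alpha> dvd lam \<theta>}) n"
  have eq: "?K g = ?T g" if g: "principal g" for g
  proof -
    have sub: "localize g n (D (insert L A)) \<subseteq> localize g n (D A)"
      by (rule localize_mono) (auto simp: D_insert)
    have "{x \<in> localize g n (D A). scale_\<alpha> x \<in> localize g (n + 1) (range (\<lambda>f. f *s euler) + (*s) \<alpha> ` D (insert L A))}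
        = localize g n (D (insert L A))"
      using kernel_iff[OF g] sub by blast
    then show ?thesis by (simp add: kernel_sheaf_def der_on_line_simps tilde_def lam_kernel)
  qed
  have "\<exists>\<Gamma>. sheaf_corr ?T (O_line L (n + 1 - int (card (restriction A L)))) \<Gamma>"
    by (rule quotient_corr[where f = Q2 and \<mu> = lam])
      (simp_all add: submod_D graded_D arr_insert lam_add lam_smult hcomp_lam homog_Q2 Q2_ndvd lam_division lam_generation)
  then show "\<exists>\<Gamma>. sheaf_corr ?K (O_line L (n + 1 - int (card (restriction A L)))) \<Gamma>"
    using sheaf_corr_cong[where E = ?K and E' = ?T, OF eq] by blast
  have "submod {\<theta> \<in> D (insert L A). \<alpha> dvd lam \<theta>}"
    unfolding lam_kernel by (intro submod_plus submod_euler submod_scale_image submod_D arr)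
  then have "wf_sheaf ?T" by (intro wf_tilde) (auto simp: submod_D arr_insert)
  then show "wf_sheaf ?K" using wf_sheaf_cong[where E = ?K and E' = ?T, OF eq] by blast
qed

text \<open>A section of the image is \<open>scale_\<alpha> x\<close> up to a zero representative,
  and by \<open>kernel_iff\<close> it vanishes exactly when \<open>x\<close> comes from
  \<open>D (insert L A)\<close>. So \<open>\<Delta>\<close> identifies
  \<open>D A / D (insert L A)\<close> with the image; on this quotient \<open>pair c\<close>
  preserves degrees, and the degree of \<open>Q1\<close> is subtracted.\<close>

lemma image_corr:
  "\<exists>\<Gamma>. sheaf_corr (O_line L (n + int (card (restriction A L)) - int (card A)))
     (image_sheaf scale_\<alpha> (der_on_line L A n) (der_on_line L (insert L A) (n + 1))) \<Gamma>"
  "wf_sheaf (image_sheaf scale_\<alpha> (der_on_line L A n) (der_on_line L (insert L A) (n + 1)))"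
proof -
  let ?E = "der_on_line L A n" and ?G = "der_on_line L (insert L A) (n + 1)"
  let ?I = "image_sheaf scale_\<alpha> ?E ?G"
  let ?T = "tilde (D A, {\<theta> \<in> D A. \<alpha> dvd pair c \<theta>}) n"
  show wfI: "wf_sheaf ?I" by (intro wf_image_sheaf wf_der arr arr_insert)
  have wfG: "wf_sheaf ?G" by (intro wf_der arr_insert)
  have wfE: "wf_sheaf ?E" by (intro wf_der arr)
  have "\<exists>\<Gamma>. sheaf_corr ?T (O_line L (n + 0 - (int (card A) - int (card (restriction A L))))) \<Gamma>"
    by (rule quotient_corr[where f = Q1 and \<mu> = "pair c"])
      (simp_all add: submod_D graded_D arr pair_add pair_smult hcomp_pair hcompv_def homog_Q1 Q1_ndvd c_division c_generation)
  then obtain \<Gamma> where \<Gamma>: "sheaf_corr ?T (O_line L (n + int (card (restriction A L)) - int (card A))) \<Gamma>"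
    by (auto simp: algebra_simps)
  define \<Delta> where "\<Delta> g = {(x, z). x \<in> fst (?E g) \<and> z - scale_\<alpha> x \<in> snd (?G g)}" for g
  have T: "submod {\<theta> \<in> D A. \<alpha> dvd pair c \<theta>}" using submod_D[OF arr_insert] by (simp add: D_insert)
  have wfT: "wf_sheaf ?T" by (rule wf_tilde) (use T submod_D[OF arr] in auto)
  have \<Delta>: "sheaf_corr ?T ?I \<Delta>"
    unfolding sheaf_corr_def
  proof (intro allI impI)
    fix g :: "'k R" assume g: "principal g"
    note sG = wf_subgrp(2)[OF wfG g] and VG = wf_sheafD[OF wfG g] and VE = wf_sheafD[OF wfE g]
    have T1: "fst (?T g) = fst (?E g)" by (simp add: tilde_def der_on_line_simps)
    have T2: "x \<in> snd (?T g) \<longleftrightarrow> scale_\<alpha> x \<in> snd (?G g)" if "x \<in> fst (?E g)" for x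
      using kernel_iff[OF g that[unfolded der_on_line_simps]] by (simp add: tilde_def der_on_line_simps D_insert)
    have I: "fst (?I g) = scale_\<alpha> ` fst (?E g) + snd (?G g)" "snd (?I g) = snd (?G g)"
      by (simp_all add: image_sheaf_def)
    have z: "z = scale_\<alpha> x + (z - scale_\<alpha> x)" for x z by simp
    show "(\<forall>(x, y)\<in>\<Delta> g. x \<in> fst (?T g) \<and> y \<in> fst (?I g) \<and> (x \<in> snd (?T g) \<longleftrightarrow> y \<in> snd (?I g))) \<and>
     (\<forall>x\<in>fst (?T g). \<exists>y. (x, y) \<in> \<Delta> g) \<and> (\<forall>y\<in>fst (?I g). \<exists>x. (x, y) \<in> \<Delta> g) \<and>
     (\<forall>x\<in>snd (?T g). \<forall>y\<in>snd (?I g). (x, y) \<in> \<Delta> g) \<and>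
     (\<forall>(x, y)\<in>\<Delta> g. \<forall>(x', y')\<in>\<Delta> g. (x + x', y + y') \<in> \<Delta> g) \<and>
     (\<forall>r\<in>structure_ring g. \<forall>(x, y)\<in>\<Delta> g. (r *s x, r *s y) \<in> \<Delta> g) \<and>
     (\<forall>h. principal h \<longrightarrow> \<Delta> g \<subseteq> \<Delta> (g * h))"
    proof (intro conjI ballI)
      fix xy assume "xy \<in> \<Delta> g"
      then obtain x y where xy: "xy = (x, y)" "x \<in> fst (?E g)" "y - scale_\<alpha> x \<in> snd (?G g)"
        by (cases xy) (auto simp: \<Delta>_def)
      have "y \<in> fst (?I g)" unfolding I by (subst z[of y x]) (intro set_plus_intro imageI xy)
      moreover have "scale_\<alpha> x \<in> snd (?G g) \<longleftrightarrow> y \<in> snd (?G g)"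
      proof
        assume "scale_\<alpha> x \<in> snd (?G g)"
        from subgrpD(4)[OF sG this xy(3)] show "y \<in> snd (?G g)" unfolding z[of y x, symmetric] .
      next
        assume "y \<in> snd (?G g)"
        from subgrpD(2)[OF sG this xy(3)] show "scale_\<alpha> x \<in> snd (?G g)" unfolding diff_diff_eq2 add_diff_cancel_left' .
      qed
      ultimately show "case xy of (x, y) \<Rightarrow> x \<in> fst (?T g) \<and> y \<in> fst (?I g) \<and> (x \<in> snd (?T g) \<longleftrightarrow> y \<in> snd (?I g))"
        using xy T1 T2[OF xy(2)] I(2) by simp
      have "(x + x', y + y') \<in> \<Delta> g" if "(x', y') \<in> \<Delta> g" for x' y'
      proof -
        have xy': "x' \<in> fst (?E g)" "y' - scale_\<alpha> x' \<in> snd (?G g)" using that by (auto simp: \<Delta>_def)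
        have "y + y' - scale_\<alpha> (x + x') = (y - scale_\<alpha> x) + (y' - scale_\<alpha> x')"
          by (simp add: vector_add_ldistrib)
        then have "y + y' - scale_\<alpha> (x + x') \<in> snd (?G g)" using subgrpD(4)[OF sG xy(3) xy'(2)] by (simp only:)
        then show ?thesis
          using stableD(2)[OF VE(1) xy(2) xy'(1)] by (simp add: \<Delta>_def)
      qed
      then show "case xy of (x, y) \<Rightarrow> \<forall>(x', y')\<in>\<Delta> g. (x + x', y + y') \<in> \<Delta> g"
        unfolding xy(1) by auto
    next
      fix x assume "x \<in> fst (?T g)"
      then show "\<exists>y. (x, y) \<in> \<Delta> g"
        using subgrpD(1)[OF sG] T1 by (intro exI[of _ "scale_\<alpha> x"]) (simp add: \<Delta>_def)
    next
      fix y assume "y \<in> fst (?I g)"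
      then obtain x w where "y = scale_\<alpha> x + w" "x \<in> fst (?E g)" "w \<in> snd (?G g)"
        unfolding I by (auto elim!: set_plus_elim)
      then show "\<exists>x. (x, y) \<in> \<Delta> g" by (intro exI[of _ x]) (simp add: \<Delta>_def)
    next
      fix x y assume xy: "x \<in> snd (?T g)" "y \<in> snd (?I g)"
      then have x: "x \<in> fst (?E g)" using wf_sheafD(3)[OF wfT g] T1 by blast
      then show "(x, y) \<in> \<Delta> g" using T2[OF x] xy I subgrpD(2)[OF sG] by (simp add: \<Delta>_def)
    next
      fix s xy assume s: "s \<in> structure_ring g" and "xy \<in> \<Delta> g"
      then obtain x y where xy: "xy = (x, y)" "x \<in> fst (?E g)" "y - scale_\<alpha> x \<in> snd (?G g)"
        by (cases xy) (auto simp: \<Delta>_def)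
      have "s *s (y - scale_\<alpha> x) = s *s y - scale_\<alpha> (s *s x)"
        by (simp add: vector_ssub_ldistrib vector_smult_assoc mult.commute)
      then have "s *s y - scale_\<alpha> (s *s x) \<in> snd (?G g)" using stableD(3)[OF VG(2) xy(3) s] by (simp only:)
      then show "case xy of (x, y) \<Rightarrow> (s *s x, s *s y) \<in> \<Delta> g"
        using stableD(3)[OF VE(1) xy(2) s] by (simp add: xy \<Delta>_def)
    next
      show "\<forall>h. principal h \<longrightarrow> \<Delta> g \<subseteq> \<Delta> (g * h)"
        using VE(4) VG(5) unfolding \<Delta>_def by blast
    qed
  qed
  show "\<exists>\<Gamma>. sheaf_corr (O_line L (n + int (card (restriction A L)) - int (card A))) ?I \<Gamma>"
    using corr_comp[OF corr_converse[OF \<Gamma>] \<Delta> wfT] by blast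
qed

end

section \<open>Cech cohomology and the connecting homomorphism\<close>

text \<open>A vector space given by representatives \<open>P\<close> and the passage
  \<open>\<pi>\<close> to classes. Both cohomology groups have this form, with cocycles and with
  sections on the overlap as representatives, so bases can be verified on representatives.\<close>

locale vs_image =
  fixes V :: "('k::field, 'w) module" and \<pi> :: "'v::ab_group_add \<Rightarrow> 'w" and P :: "'v set" and sc :: "'k \<Rightarrow> 'v \<Rightarrow> 'v"
  assumes P: "subgrp P" and scP: "\<And>t x. x \<in> P \<Longrightarrow> sc t x \<in> P"
    and sc: "\<And>t x y. sc t (x + y) = sc t x + sc t y" "\<And>s t x. sc (s + t) x = sc s x + sc t x"
      "\<And>s t x. sc (s * t) x = sc s (sc t x)" "\<And>x. sc 1 x = x"
    and carrier: "carrier V = \<pi> ` P" and zero: "zero V = \<pi> 0"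
    and add: "\<And>x y. x \<in> P \<Longrightarrow> y \<in> P \<Longrightarrow> add V (\<pi> x) (\<pi> y) = \<pi> (x + y)"
    and smult: "\<And>t x. x \<in> P \<Longrightarrow> smult V t (\<pi> x) = \<pi> (sc t x)"
begin

lemma vs: "vectorspace class_ring V"
  by (rule vectorspace_image[OF P scP sc carrier zero add smult])

lemma sum_in_P: "(\<And>i. i < n \<Longrightarrow> b i \<in> P) \<Longrightarrow> (\<Sum>i<(n::nat). sc (c i) (b i)) \<in> P"
proof (induction n)
  case (Suc n)
  then show ?case using subgrpD(4)[OF P] scP by simp
qed (simp add: subgrpD(1)[OF P])

lemma comb_image:
  assumes "\<And>i. i < n \<Longrightarrow> b i \<in> P"
  shows "comb V (map (\<lambda>i. \<pi> (b i)) [0..<n]) c = \<pi> (\<Sum>i<n. sc (c i) (b i))"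
proof -
  interpret V: vectorspace class_ring V by (rule vs)
  have "finsum V (\<lambda>i. smult V (c i) (\<pi> (b i))) {..<m} = \<pi> (\<Sum>i<m. sc (c i) (b i))" if "m \<le> n" for m
    using that
  proof (induction m)
    case 0
    show ?case by (simp add: zero)
  next
    case (Suc m)
    have b: "b i \<in> P" if "i < Suc m" for i using assms[of i] that Suc.prems by simp
    have cl: "smult V (c i) (\<pi> (b i)) \<in> carrier V" if "i < Suc m" for i
      using b[OF that] by (simp add: smult scP carrier)
    have "finsum V (\<lambda>i. smult V (c i) (\<pi> (b i))) {..<Suc m} =
        add V (smult V (c m) (\<pi> (b m))) (finsum V (\<lambda>i. smult V (c i) (\<pi> (b i))) {..<m})"
      unfolding lessThan_Suc by (rule V.finsum_insert) (use cl in auto)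
    also have "\<dots> = add V (\<pi> (sc (c m) (b m))) (\<pi> (\<Sum>i<m. sc (c i) (b i)))"
      using Suc b by (simp add: smult)
    also have "\<dots> = \<pi> (sc (c m) (b m) + (\<Sum>i<m. sc (c i) (b i)))"
      by (rule add) (use b scP sum_in_P in auto)
    finally show ?case by (simp add: add.commute)
  qed
  from this[of n] have "finsum V (\<lambda>i. smult V (c i) (\<pi> (b i))) {..<n} = \<pi> (\<Sum>i<n. sc (c i) (b i))" by simp
  moreover have "comb V (map (\<lambda>i. \<pi> (b i)) [0..<n]) c = finsum V (\<lambda>i. smult V (c i) (\<pi> (b i))) {..<n}"
    unfolding comb_def by (rule V.finsum_cong') (use assms in \<open>auto simp: smult scP carrier\<close>)
  ultimately show ?thesis by simp
qed

lemma image_basis: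
  assumes b: "\<And>i. i < n \<Longrightarrow> b i \<in> P"
    and gen: "\<And>x. x \<in> P \<Longrightarrow> \<exists>c. \<pi> x = \<pi> (\<Sum>i<n. sc (c i) (b i))"
    and ind: "\<And>c i. \<pi> (\<Sum>i<n. sc (c i) (b i)) = \<pi> 0 \<Longrightarrow> i < n \<Longrightarrow> c i = 0"
  shows "ordered_basis V (map (\<lambda>i. \<pi> (b i)) [0..<n])"
proof -
  have ci: "comb V (map (\<lambda>i. \<pi> (b i)) [0..<n]) c = \<pi> (\<Sum>i<n. sc (c i) (b i))" for c
    by (rule comb_image[OF b])
  show ?thesis
    unfolding ordered_basis_iff[OF vs] ci zero carrier
    using gen ind b by auto
qed

end

lemma kscale_laws:
  fixes x y :: "'k::field R fract ^ 'n::finite"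
  shows "kscale t (x + y) = kscale t x + kscale t y" "kscale (s + t) x = kscale s x + kscale t x"
    "kscale (s * t) x = kscale s (kscale t x)" "kscale 1 x = x"
proof -
  have "Fract (const (s + t)) 1 = Fract (const s) 1 + Fract (const t) (1 :: 'k R)"
    "Fract (const (s * t)) 1 = Fract (const s) 1 * Fract (const t) (1 :: 'k R)"
    "Fract (const 1) (1 :: 'k R) = 1"
    by (simp_all add: const_add const_mult One_fract_def)
  then show "kscale t (x + y) = kscale t x + kscale t y" "kscale (s + t) x = kscale s x + kscale t x"
    "kscale (s * t) x = kscale s (kscale t x)" "kscale 1 x = x"
    by (simp_all add: kscale_def vector_add_ldistrib vector_sadd_rdistrib vector_smult_assoc del: mult_fract add_fract)
qed

lemma kscale_frv: "kscale t (frv m s) = frv (const t *s m) s"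
  by (simp add: kscale_def frv_smult)

section \<open>Cech classes through representatives\<close>

locale cech =
  fixes L :: "('k::field ^ 3) set"
  assumes pu: "principal (coord_u L)" and pv: "principal (coord_v L)"
begin

abbreviation "u \<equiv> coord_u L"
abbreviation "v \<equiv> coord_v L"
abbreviation "w \<equiv> coord_uv L"

lemma w: "w = u * v" "w = v * u" by (simp_all add: coord_uv_def mult.commute)

lemma pw: "principal w" unfolding w(1) by (rule principal_mult[OF pu pv])

lemma to_w:
  assumes "wf_sheaf E"
  shows "x \<in> fst (E u) \<Longrightarrow> x \<in> fst (E w)" "x \<in> fst (E v) \<Longrightarrow> x \<in> fst (E w)"
    "x \<in> snd (E u) \<Longrightarrow> x \<in> snd (E w)" "x \<in> snd (E v) \<Longrightarrow> x \<in> snd (E w)"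
  using wf_sheafD(4,5)[OF assms pu pv] wf_sheafD(4,5)[OF assms pv pu] by (simp_all add: w(1) mult.commute[of v u])

lemma corr_to_w:
  assumes "sheaf_corr E G \<Gamma>"
  shows "z \<in> \<Gamma> u \<Longrightarrow> z \<in> \<Gamma> w" "z \<in> \<Gamma> v \<Longrightarrow> z \<in> \<Gamma> w"
  using sheaf_corrD(9)[OF assms pu pv] sheaf_corrD(9)[OF assms pv pu]
  by (cases z, simp add: w(1) mult.commute[of v u])+

definition cocycles :: "('k, 'n::finite) sheaf \<Rightarrow> (('k R fract ^ 'n) \<times> ('k R fract ^ 'n)) set" where
  "cocycles E = {(x, y). x \<in> fst (E u) \<and> y \<in> fst (E v) \<and> x - y \<in> snd (E w)}"

definition H0_class :: "('k, 'n::finite) sheaf \<Rightarrow> ('k R fract ^ 'n) \<times> ('k R fract ^ 'n) \<Rightarrow>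
    ('k R fract ^ 'n) set \<times> ('k R fract ^ 'n) set" where
  "H0_class E = (\<lambda>(x, y). (x +o snd (E u), y +o snd (E v)))"

definition H1_class :: "('k, 'n::finite) sheaf \<Rightarrow> ('k R fract ^ 'n) \<Rightarrow> ('k R fract ^ 'n) set" where
  "H1_class E z = z +o coboundaries L E"

text \<open>Two cosets agree after enlargement to the overlap exactly when their representatives
  differ by a zero representative there, so global sections are the classes of
  \<open>cocycles\<close>.\<close>

lemma H0_vs_image:
  assumes E: "wf_sheaf E"
  shows "vs_image (H0 L E) (H0_class E) (cocycles E) (\<lambda>t (x, y). (kscale t x, kscale t y))"
proof -
  note gu = wf_subgrp[OF E pu] and gv = wf_subgrp[OF E pv] and gw = wf_subgrp[OF E pw]
  have kd: "kscale t x - kscale t y = kscale t (x - y)" for t and x y :: "'k R fract ^ 'a"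
    using kscale_laws(1)[of t "x - y" y] by simp
  have add0: "add (sections E g) = (+)" "smult (sections E g) = (\<lambda>c X. kscale c ` X + snd (E g))" "zero (sections E g) = snd (E g)" for g
    by (simp_all add: sections_def quot_space_def)
  have ks: "kscale t ` (x +o snd (E g)) + snd (E g) = kscale t x +o snd (E g)" if "principal g" for g t x
    unfolding kscale_def
    by (rule coset_smult[OF wf_subgrp(2)[OF E that]])
      (rule stableD(3)[OF wf_sheafD(2)[OF E that] _ const_in_structure_ring[OF that]])
  show ?thesis
  proof
    show "subgrp (cocycles E)"
      unfolding subgrp_def
    proof (intro conjI ballI)
      show "0 \<in> cocycles E"
        using subgrpD(1)[OF gu(1)] subgrpD(1)[OF gv(1)] subgrpD(1)[OF gw(2)] by (simp add: cocycles_def zero_prod_def)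
      fix p q assume "p \<in> cocycles E" "q \<in> cocycles E"
      then obtain x y x' y' where pq: "p = (x, y)" "q = (x', y')" "x \<in> fst (E u)" "x' \<in> fst (E u)"
        "y \<in> fst (E v)" "y' \<in> fst (E v)" "x - y \<in> snd (E w)" "x' - y' \<in> snd (E w)"
        by (auto simp: cocycles_def)
      have "(x - y) - (x' - y') \<in> snd (E w)" by (rule subgrpD(2)[OF gw(2) pq(7,8)])
      then have "(x - x') - (y - y') \<in> snd (E w)" by (simp add: algebra_simps)
      then show "p - q \<in> cocycles E"
        using subgrpD(2)[OF gu(1) pq(3,4)] subgrpD(2)[OF gv(1) pq(5,6)] by (simp add: cocycles_def pq(1,2))
    qed
    show "(case p of (x, y) \<Rightarrow> (kscale t x, kscale t y)) \<in> cocycles E" if "p \<in> cocycles E" for t p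
      using that stable_kscale[OF wf_sheafD(1)[OF E pu] pu] stable_kscale[OF wf_sheafD(1)[OF E pv] pv]
        stable_kscale[OF wf_sheafD(2)[OF E pw] pw]
      by (auto simp: cocycles_def kd)
    show "carrier (H0 L E) = H0_class E ` cocycles E"
    proof (intro equalityI subsetI)
      fix Z assume "Z \<in> carrier (H0 L E)"
      then obtain x y where Z: "Z = (x +o snd (E u), y +o snd (E v))" "x \<in> fst (E u)" "y \<in> fst (E v)"
        "(x +o snd (E u)) + snd (E w) = (y +o snd (E v)) + snd (E w)"
        by (auto simp: H0_def Let_def carrier_sections)
      have "(x +o snd (E u)) + snd (E w) = x +o snd (E w)" "(y +o snd (E v)) + snd (E w) = y +o snd (E w)"
        using to_w(3,4)[OF E] subgrpD(1)[OF gu(2)] subgrpD(1)[OF gv(2)]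
        by (intro coset_add_subgrp gw subsetI, simp_all)+
      then have "x +o snd (E w) = y +o snd (E w)" using Z(4) by (simp only:)
      then have "x - y \<in> snd (E w)" by (rule iffD1[OF coset_eq_iff[OF gw(2)]])
      then show "Z \<in> H0_class E ` cocycles E" using Z by (auto simp: H0_class_def cocycles_def intro!: image_eqI[of _ _ "(x, y)"])
    next
      fix Z assume "Z \<in> H0_class E ` cocycles E"
      then obtain x y where Z: "Z = (x +o snd (E u), y +o snd (E v))" "x \<in> fst (E u)" "y \<in> fst (E v)" "x - y \<in> snd (E w)"
        by (auto simp: H0_class_def cocycles_def)
      have "(x +o snd (E u)) + snd (E w) = x +o snd (E w)" "(y +o snd (E v)) + snd (E w) = y +o snd (E w)"
        using to_w(3,4)[OF E] subgrpD(1)[OF gu(2)] subgrpD(1)[OF gv(2)]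
        by (intro coset_add_subgrp gw subsetI, simp_all)+
      then show "Z \<in> carrier (H0 L E)"
        using Z coset_eq_iff[OF gw(2), of x y] by (auto simp: H0_def Let_def carrier_sections)
    qed
    show "zero (H0 L E) = H0_class E 0"
      by (simp add: H0_def Let_def H0_class_def zero_prod_def add0)
    show "add (H0 L E) (H0_class E p) (H0_class E q) = H0_class E (p + q)" for p q
      by (cases p; cases q) (simp add: H0_def Let_def H0_class_def add0 coset_add[OF gu(2)] coset_add[OF gv(2)])
    show "smult (H0 L E) t (H0_class E p) = H0_class E (case p of (x, y) \<Rightarrow> (kscale t x, kscale t y))" for t p
      by (cases p) (simp add: H0_def Let_def H0_class_def add0 ks[OF pu] ks[OF pv])
  qed (auto simp: kscale_laws split: prod.splits)
qed

lemma coboundaries_stable: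
  assumes E: "wf_sheaf E"
  shows "subgrp (coboundaries L E)" "x \<in> coboundaries L E \<Longrightarrow> kscale t x \<in> coboundaries L E"
    "x \<in> fst (E u) \<Longrightarrow> y \<in> fst (E v) \<Longrightarrow> z \<in> snd (E w) \<Longrightarrow> x + y + z \<in> coboundaries L E"
    "coboundaries L E \<subseteq> fst (E w)"
    "z \<in> snd (E w) \<Longrightarrow> z \<in> coboundaries L E" "x \<in> fst (E u) \<Longrightarrow> x \<in> coboundaries L E" "x \<in> fst (E v) \<Longrightarrow> x \<in> coboundaries L E"
proof -
  note gu = wf_subgrp[OF E pu] and gv = wf_subgrp[OF E pv] and gw = wf_subgrp[OF E pw]
  show "subgrp (coboundaries L E)" unfolding coboundaries_def by (intro subgrp_plus gu gv gw)
  show i: "x + y + z \<in> coboundaries L E" if "x \<in> fst (E u)" "y \<in> fst (E v)" "z \<in> snd (E w)" for x y z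
    unfolding coboundaries_def by (intro set_plus_intro that)
  show "kscale t x \<in> coboundaries L E" if x: "x \<in> coboundaries L E" for x
  proof -
    obtain a b d where "x = a + b + d" "a \<in> fst (E u)" "b \<in> fst (E v)" "d \<in> snd (E w)"
      using x unfolding coboundaries_def by (auto elim!: set_plus_elim)
    then show ?thesis
      using stable_kscale[OF wf_sheafD(1)[OF E pu] pu] stable_kscale[OF wf_sheafD(1)[OF E pv] pv]
        stable_kscale[OF wf_sheafD(2)[OF E pw] pw] by (auto simp: kscale_laws intro!: i)
  qed
  show "coboundaries L E \<subseteq> fst (E w)"
  proof
    fix x assume "x \<in> coboundaries L E"
    then obtain a b d where "x = a + b + d" "a \<in> fst (E u)" "b \<in> fst (E v)" "d \<in> snd (E w)"
      unfolding coboundaries_def by (auto elim!: set_plus_elim)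
    then show "x \<in> fst (E w)" using to_w(1,2)[OF E] wf_sheafD(3)[OF E pw] subgrpD(4)[OF gw(1)] by blast
  qed
  note z = subgrpD(1)[OF gu(1)] subgrpD(1)[OF gv(1)] subgrpD(1)[OF gw(2)]
  show "z \<in> coboundaries L E" if "z \<in> snd (E w)" using i[OF z(1,2) that] by simp
  show "x \<in> coboundaries L E" if "x \<in> fst (E u)" using i[OF that z(2,3)] by simp
  show "x \<in> coboundaries L E" if "x \<in> fst (E v)" using i[OF z(1) that z(3)] by simp
qed

lemma H1_vs_image:
  assumes E: "wf_sheaf E"
  shows "vs_image (H1 L E) (H1_class E) (fst (E w)) kscale"
proof
  note B = coboundaries_stable[OF E]
  show "subgrp (fst (E w))" by (rule wf_subgrp[OF E pw])
  show "kscale t x \<in> fst (E w)" if "x \<in> fst (E w)" for t x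
    by (rule stable_kscale[OF wf_sheafD(1)[OF E pw] pw that])
  show "carrier (H1 L E) = H1_class E ` fst (E w)" "zero (H1 L E) = H1_class E 0"
    by (simp_all add: H1_def quot_space_def H1_class_def)
  show "add (H1 L E) (H1_class E x) (H1_class E y) = H1_class E (x + y)" for x y
    by (simp add: H1_def quot_space_def H1_class_def coset_add[OF B(1)])
  show "smult (H1 L E) t (H1_class E x) = H1_class E (kscale t x)" for t x
    using coset_smult[OF B(1), of "Fract (const t) 1" x] B(2)[unfolded kscale_def]
    by (simp add: H1_def quot_space_def H1_class_def kscale_def)
qed (simp_all add: kscale_laws)

lemma H1_class_eq_0: "wf_sheaf E \<Longrightarrow> H1_class E z = H1_class E 0 \<longleftrightarrow> z \<in> coboundaries L E"
  unfolding H1_class_def by (simp add: coset_eq_iff[OF coboundaries_stable(1)] del: set_zero_plus)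

lemma H0_class_eq_0:
  assumes E: "wf_sheaf E"
  shows "H0_class E (x, y) = H0_class E 0 \<longleftrightarrow> x \<in> snd (E u) \<and> y \<in> snd (E v)"
  unfolding H0_class_def zero_prod_def
  by (simp add: coset_eq_iff[OF wf_subgrp(2)[OF E pu]] coset_eq_iff[OF wf_subgrp(2)[OF E pv]] del: set_zero_plus)

text \<open>Split the coboundary over the two open sets and take partners \<open>k'\<close>,
  \<open>l'\<close> of the parts. Their sum is related to the same element \<open>d\<close> as
  \<open>z\<close>, so the difference is a zero representative. Hence a correspondence acts on
  \<open>H1\<close>.\<close>

lemma corr_coboundary_imp:
  assumes \<Gamma>: "sheaf_corr E G \<Gamma>" and E: "wf_sheaf E" and G: "wf_sheaf G"
    and dz: "(d, z) \<in> \<Gamma> w" "d \<in> coboundaries L E"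
  shows "z \<in> coboundaries L G"
proof -
  obtain k l m where d: "d = k + l + m" "k \<in> fst (E u)" "l \<in> fst (E v)" "m \<in> snd (E w)"
    using dz(2) unfolding coboundaries_def by (auto elim!: set_plus_elim)
  obtain k' where k: "(k, k') \<in> \<Gamma> u" using sheaf_corrD(4)[OF \<Gamma> pu d(2)] by blast
  obtain l' where l: "(l, l') \<in> \<Gamma> v" using sheaf_corrD(4)[OF \<Gamma> pv d(3)] by blast
  have 0: "0 \<in> snd (G w)" "0 \<in> snd (E w)" using subgrpD(1) wf_subgrp(2)[OF _ pw] E G by blast+
  have "(k + l + m, k' + l' + 0) \<in> \<Gamma> w"
    by (intro sheaf_corrD(7)[OF \<Gamma> pw] corr_to_w[OF \<Gamma>] k l sheaf_corrD(6)[OF \<Gamma> pw] d 0)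
  then have "(d - d, z - (k' + l' + 0)) \<in> \<Gamma> w" unfolding d(1)[symmetric] by (rule corr_diff[OF \<Gamma> pw dz(1)])
  then have "z - (k' + l' + 0) \<in> snd (G w)" using sheaf_corrD(3)[OF \<Gamma> pw] 0 by fastforce
  then have "k' + l' + (z - (k' + l' + 0)) \<in> coboundaries L G"
    using sheaf_corrD(2)[OF \<Gamma> pu k] sheaf_corrD(2)[OF \<Gamma> pv l] by (intro coboundaries_stable(3)[OF G])
  then show ?thesis by simp
qed

lemma corr_coboundary:
  assumes \<Gamma>: "sheaf_corr E G \<Gamma>" and E: "wf_sheaf E" and G: "wf_sheaf G" and dz: "(d, z) \<in> \<Gamma> w"
  shows "d \<in> coboundaries L E \<longleftrightarrow> z \<in> coboundaries L G"
  using corr_coboundary_imp[OF \<Gamma> E G dz] corr_coboundary_imp[OF corr_converse[OF \<Gamma>] G E, of z d] dz by auto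

end

section \<open>The long exact sequence for arbitrary identifications\<close>

locale connecting_setup = cech L for L :: "('k::field ^ 3) set" +
  fixes E G :: "('k, 3) sheaf" and a :: "'k R fract" and O1 O2 :: "('k, 1) sheaf" and \<psi> \<phi>
  assumes wfE: "wf_sheaf E" and wfG: "wf_sheaf G" and wf1: "wf_sheaf O1" and wf2: "wf_sheaf O2"
    and wfK: "wf_sheaf (kernel_sheaf ((*s) a) E G)" and wfI: "wf_sheaf (image_sheaf ((*s) a) E G)"
    and iso\<psi>: "sheaf_iso O1 (image_sheaf ((*s) a) E G) \<psi>" and iso\<phi>: "sheaf_iso (kernel_sheaf ((*s) a) E G) O2 \<phi>"
begin

abbreviation "f \<equiv> (*s) a :: 'k R fract ^ 3 \<Rightarrow> 'k R fract ^ 3"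
abbreviation "K \<equiv> kernel_sheaf f E G"
abbreviation "I \<equiv> image_sheaf f E G"

lemma f_hom: "f (x + y) = f x + f y" "f (x - y) = f x - f y" "f (r *s x) = r *s f x"
  by (simp_all add: vector_add_ldistrib vector_ssub_ldistrib vector_smult_assoc mult.commute)

definition \<Psi> where "\<Psi> g = {(x, y). x \<in> fst (O1 g) \<and> y \<in> fst (I g) \<and> \<psi> g (x +o snd (O1 g)) = y +o snd (I g)}"
definition \<Phi> where "\<Phi> g = {(x, y). x \<in> fst (K g) \<and> y \<in> fst (O2 g) \<and> \<phi> g (x +o snd (K g)) = y +o snd (O2 g)}"

lemma \<Psi>: "sheaf_corr O1 I \<Psi>" using iso_corr[OF iso\<psi> wf1 wfI] unfolding \<Psi>_def .
lemma \<Phi>: "sheaf_corr K O2 \<Phi>" using iso_corr[OF iso\<phi> wfK wf2] unfolding \<Phi>_def .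

lemma K: "x \<in> fst (K g) \<longleftrightarrow> x \<in> fst (E g) \<and> f x \<in> snd (G g)" "snd (K g) = snd (E g)"
  by (simp_all add: kernel_sheaf_def)
lemma I: "fst (I g) = f ` fst (E g) + snd (G g)" "snd (I g) = snd (G g)"
  by (simp_all add: image_sheaf_def)

lemma f_snd: "principal g \<Longrightarrow> x \<in> snd (E g) \<Longrightarrow> f x \<in> snd (G g)"
  using wf_sheafD(3)[OF wfK] K by blast

text \<open>The whole path of the connecting map on representatives: transport \<open>x\<close>,
  \<open>y\<close> to the image sheaf, lift along \<open>f\<close> to \<open>x2\<close>,
  \<open>y2\<close>, and transport the difference of the lifts from the kernel sheaf to
  \<open>z\<close>.\<close>

definition rel where
  "rel x y z \<longleftrightarrow> (\<exists>x1 y1 x2 y2. (x, x1) \<in> \<Psi> u \<and> (y, y1) \<in> \<Psi> v \<and> x2 \<in> fst (E u) \<and> y2 \<in> fst (E v) \<and>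
     f x2 - x1 \<in> snd (G u) \<and> f y2 - y1 \<in> snd (G v) \<and> (y2 - x2, z) \<in> \<Phi> w)"

definition alpha where "alpha = H1_map L K O2 \<phi> \<circ> connecting L f E G \<circ> H0_map L \<psi>"

text \<open>Two lifts of one section over an open set differ by a section of the kernel sheaf there,
  so the class of the difference is unique and the description by \<open>THE\<close> is met.\<close>

lemma connecting_value:
  assumes "x2 \<in> fst (E u)" "y2 \<in> fst (E v)" "f x2 - x1 \<in> snd (G u)" "f y2 - y1 \<in> snd (G v)"
  shows "connecting L f E G (x1 +o snd (I u), y1 +o snd (I v)) = (y2 - x2) +o coboundaries L K"
  unfolding connecting_def prod.case
proof (rule the_equality)
  show "\<exists>x\<in>fst (E u). \<exists>y\<in>fst (E v). f x \<in> x1 +o snd (I u) \<and> f y \<in> y1 +o snd (I v) \<and>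
      (y2 - x2) +o coboundaries L K = (y - x) +o coboundaries L K"
    using assms by (intro bexI[of _ x2] bexI[of _ y2]) (simp_all add: coset_mem I(2))
  fix Z assume "\<exists>x\<in>fst (E u). \<exists>y\<in>fst (E v). f x \<in> x1 +o snd (I u) \<and> f y \<in> y1 +o snd (I v) \<and>
      Z = (y - x) +o coboundaries L K"
  then obtain x y where xy: "x \<in> fst (E u)" "y \<in> fst (E v)" "f x - x1 \<in> snd (G u)" "f y - y1 \<in> snd (G v)"
    "Z = (y - x) +o coboundaries L K" by (auto simp: coset_mem I(2))
  have "f (x - x2) = (f x - x1) - (f x2 - x1)" "f (y - y2) = (f y - y1) - (f y2 - y1)" by (simp_all add: f_hom)
  then have "f (x - x2) \<in> snd (G u)" "f (y - y2) \<in> snd (G v)"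
    using subgrpD(2)[OF wf_subgrp(2)[OF wfG pu] xy(3) assms(3)] subgrpD(2)[OF wf_subgrp(2)[OF wfG pv] xy(4) assms(4)]
    by (simp_all only:)
  then have k: "x - x2 \<in> fst (K u)" "y - y2 \<in> fst (K v)"
    using subgrpD(2)[OF wf_subgrp(1)[OF wfE pu] xy(1) assms(1)] subgrpD(2)[OF wf_subgrp(1)[OF wfE pv] xy(2) assms(2)]
    by (simp_all only: K)
  have "(y - y2) - (x - x2) \<in> coboundaries L K"
    by (intro subgrpD(2)[OF coboundaries_stable(1)[OF wfK]] coboundaries_stable(6,7)[OF wfK] k)
  moreover have "(y - y2) - (x - x2) = (y - x) - (y2 - x2)" by simp
  ultimately show "Z = (y2 - x2) +o coboundaries L K"
    unfolding xy(5) coset_eq_iff[OF coboundaries_stable(1)[OF wfK]] by (simp only:)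
qed

lemma H1_map_value:
  assumes dz: "(d, z) \<in> \<Phi> w"
  shows "H1_map L K O2 \<phi> (d +o coboundaries L K) = H1_class O2 z"
proof -
  note B2 = coboundaries_stable[OF wf2]
  have val: "\<phi> w (d' +o snd (K w)) + coboundaries L O2 = z' +o coboundaries L O2" if "(d', z') \<in> \<Phi> w" for d' z'
  proof -
    have "\<phi> w (d' +o snd (K w)) = z' +o snd (O2 w)" using that by (simp add: \<Phi>_def)
    then show ?thesis using coset_add_subgrp[OF B2(1) _ subgrpD(1)[OF wf_subgrp(2)[OF wf2 pw]]] B2(5) by auto
  qed
  show ?thesis unfolding H1_map_def H1_class_def
  proof (rule the_equality)
    have "d \<in> d +o coboundaries L K"
      using subgrpD(1)[OF coboundaries_stable(1)[OF wfK]] by (simp add: coset_mem)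
    then show "\<exists>x\<in>fst (K w). x \<in> d +o coboundaries L K \<and>
        z +o coboundaries L O2 = \<phi> w (x +o snd (K w)) + coboundaries L O2"
      using sheaf_corrD(1)[OF \<Phi> pw dz] val[OF dz] by (intro bexI[of _ d]) auto
    fix Z assume "\<exists>x\<in>fst (K w). x \<in> d +o coboundaries L K \<and> Z = \<phi> w (x +o snd (K w)) + coboundaries L O2"
    then obtain x where x: "x \<in> fst (K w)" "x - d \<in> coboundaries L K" "Z = \<phi> w (x +o snd (K w)) + coboundaries L O2"
      by (auto simp: coset_mem)
    obtain z' where z': "(x, z') \<in> \<Phi> w" using sheaf_corrD(4)[OF \<Phi> pw x(1)] by blast
    have "z' - z \<in> coboundaries L O2"
      using corr_coboundary[OF \<Phi> wfK wf2 corr_diff[OF \<Phi> pw z' dz]] x(2) by blast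
    then show "Z = z +o coboundaries L O2" unfolding x(3) val[OF z'] coset_eq_iff[OF B2(1)] .
  qed
qed

lemma alpha_value:
  assumes "rel x y z"
  shows "alpha (H0_class O1 (x, y)) = H1_class O2 z"
proof -
  obtain x1 y1 x2 y2 where r: "(x, x1) \<in> \<Psi> u" "(y, y1) \<in> \<Psi> v" "x2 \<in> fst (E u)" "y2 \<in> fst (E v)"
     "f x2 - x1 \<in> snd (G u)" "f y2 - y1 \<in> snd (G v)" "(y2 - x2, z) \<in> \<Phi> w"
    using assms unfolding rel_def by blast
  have "H0_map L \<psi> (H0_class O1 (x, y)) = (x1 +o snd (I u), y1 +o snd (I v))"
    using r(1,2) by (simp add: H0_map_def H0_class_def \<Psi>_def)
  then show ?thesis
    by (simp add: alpha_def connecting_value[OF r(3-6)] H1_map_value[OF r(7)])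
qed

text \<open>Sections of the image sheaf are \<open>f\<close>-images up to zero representatives
  \<open>p\<close>, \<open>q\<close>, which yields the lifts. Since \<open>x - y\<close> vanishes on
  the overlap, so does \<open>f (y2 - x2)\<close>, and the difference lies in the kernel
  sheaf.\<close>

lemma rel_exists:
  assumes "(x, y) \<in> cocycles O1"
  shows "\<exists>z. rel x y z"
proof -
  have xy: "x \<in> fst (O1 u)" "y \<in> fst (O1 v)" "x - y \<in> snd (O1 w)" using assms by (auto simp: cocycles_def)
  obtain x1 where x1: "(x, x1) \<in> \<Psi> u" using sheaf_corrD(4)[OF \<Psi> pu xy(1)] by blast
  obtain y1 where y1: "(y, y1) \<in> \<Psi> v" using sheaf_corrD(4)[OF \<Psi> pv xy(2)] by blast
  obtain x2 p where x2: "x1 = f x2 + p" "x2 \<in> fst (E u)" "p \<in> snd (G u)"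
    using sheaf_corrD(2)[OF \<Psi> pu x1] unfolding I by (auto elim!: set_plus_elim)
  obtain y2 q where y2: "y1 = f y2 + q" "y2 \<in> fst (E v)" "q \<in> snd (G v)"
    using sheaf_corrD(2)[OF \<Psi> pv y1] unfolding I by (auto elim!: set_plus_elim)
  note gG = wf_subgrp(2)[OF wfG pw]
  have p: "p \<in> snd (G w)" "q \<in> snd (G w)" using to_w[OF wfG] x2(3) y2(3) by blast+
  have "(x - y, x1 - y1) \<in> \<Psi> w" by (intro corr_diff[OF \<Psi> pw] corr_to_w[OF \<Psi>] x1 y1)
  then have "x1 - y1 \<in> snd (G w)" using sheaf_corrD(3)[OF \<Psi> pw] xy(3) I(2) by metis
  then have "q - p - (x1 - y1) - (q - p) - (q - p) \<in> snd (G w)" using p subgrpD(2)[OF gG] by blast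
  moreover have "f (y2 - x2) = p - q - (x1 - y1)" by (simp add: f_hom x2 y2)
  moreover have "p - q - (x1 - y1) \<in> snd (G w)" using p \<open>x1 - y1 \<in> _\<close> subgrpD(2)[OF gG] by blast
  ultimately have "f (y2 - x2) \<in> snd (G w)" by (simp only:)
  moreover have "y2 - x2 \<in> fst (E w)"
    by (intro subgrpD(2)[OF wf_subgrp(1)[OF wfE pw]] to_w(1,2)[OF wfE] x2 y2)
  ultimately have "y2 - x2 \<in> fst (K w)" by (simp only: K)
  then obtain z where z: "(y2 - x2, z) \<in> \<Phi> w" using sheaf_corrD(4)[OF \<Phi> pw] by blast
  have "f x2 - x1 \<in> snd (G u)" "f y2 - y1 \<in> snd (G v)"
    using subgrpD(3)[OF wf_subgrp(2)[OF wfG pu] x2(3)] subgrpD(3)[OF wf_subgrp(2)[OF wfG pv] y2(3)]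
    by (simp_all add: x2 y2)
  then show ?thesis unfolding rel_def using x1 y1 x2(2) y2(2) z by blast
qed

lemma rel_add:
  assumes "rel x y z" "rel x' y' z'"
  shows "rel (x + x') (y + y') (z + z')"
proof -
  obtain x1 y1 x2 y2 where r: "(x, x1) \<in> \<Psi> u" "(y, y1) \<in> \<Psi> v" "x2 \<in> fst (E u)" "y2 \<in> fst (E v)"
     "f x2 - x1 \<in> snd (G u)" "f y2 - y1 \<in> snd (G v)" "(y2 - x2, z) \<in> \<Phi> w"
    using assms(1) unfolding rel_def by blast
  obtain x1' y1' x2' y2' where r': "(x', x1') \<in> \<Psi> u" "(y', y1') \<in> \<Psi> v" "x2' \<in> fst (E u)" "y2' \<in> fst (E v)"
     "f x2' - x1' \<in> snd (G u)" "f y2' - y1' \<in> snd (G v)" "(y2' - x2', z') \<in> \<Phi> w"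
    using assms(2) unfolding rel_def by blast
  have e: "f (x2 + x2') - (x1 + x1') = (f x2 - x1) + (f x2' - x1')"
    "f (y2 + y2') - (y1 + y1') = (f y2 - y1) + (f y2' - y1')" by (simp_all add: f_hom)
  have e': "(y2 + y2') - (x2 + x2') = (y2 - x2) + (y2' - x2')" by simp
  show ?thesis unfolding rel_def
  proof (rule exI[of _ "x1 + x1'"], rule exI[of _ "y1 + y1'"], rule exI[of _ "x2 + x2'"], rule exI[of _ "y2 + y2'"], intro conjI)
    show "(x + x', x1 + x1') \<in> \<Psi> u" "(y + y', y1 + y1') \<in> \<Psi> v"
      by (rule sheaf_corrD(7)[OF \<Psi> pu r(1) r'(1)], rule sheaf_corrD(7)[OF \<Psi> pv r(2) r'(2)])
    show "x2 + x2' \<in> fst (E u)" "y2 + y2' \<in> fst (E v)"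
      by (rule subgrpD(4)[OF wf_subgrp(1)[OF wfE pu] r(3) r'(3)], rule subgrpD(4)[OF wf_subgrp(1)[OF wfE pv] r(4) r'(4)])
    show "f (x2 + x2') - (x1 + x1') \<in> snd (G u)" "f (y2 + y2') - (y1 + y1') \<in> snd (G v)"
      unfolding e by (rule subgrpD(4)[OF wf_subgrp(2)[OF wfG pu] r(5) r'(5)], rule subgrpD(4)[OF wf_subgrp(2)[OF wfG pv] r(6) r'(6)])
    show "(y2 + y2' - (x2 + x2'), z + z') \<in> \<Phi> w" unfolding e' by (rule sheaf_corrD(7)[OF \<Phi> pw r(7) r'(7)])
  qed
qed

lemma rel_kscale:
  assumes "rel x y z"
  shows "rel (kscale t x) (kscale t y) (kscale t z)"
proof -
  obtain x1 y1 x2 y2 where r: "(x, x1) \<in> \<Psi> u" "(y, y1) \<in> \<Psi> v" "x2 \<in> fst (E u)" "y2 \<in> fst (E v)"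
     "f x2 - x1 \<in> snd (G u)" "f y2 - y1 \<in> snd (G v)" "(y2 - x2, z) \<in> \<Phi> w"
    using assms(1) unfolding rel_def by blast
  have kd: "kscale t x - kscale t y = kscale t (x - y)" for x y :: "'k R fract ^ 3"
    using kscale_laws(1)[of t "x - y" y] by simp
  have kf: "f (kscale t x) = kscale t (f x)" for x by (simp add: kscale_def f_hom)
  show ?thesis unfolding rel_def
  proof (rule exI[of _ "kscale t x1"], rule exI[of _ "kscale t y1"], rule exI[of _ "kscale t x2"], rule exI[of _ "kscale t y2"], intro conjI)
    show "(kscale t x, kscale t x1) \<in> \<Psi> u" "(kscale t y, kscale t y1) \<in> \<Psi> v" unfolding kscale_def
      by (rule sheaf_corrD(8)[OF \<Psi> pu r(1) const_in_structure_ring[OF pu]],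
          rule sheaf_corrD(8)[OF \<Psi> pv r(2) const_in_structure_ring[OF pv]])
    show "kscale t x2 \<in> fst (E u)" "kscale t y2 \<in> fst (E v)"
      by (rule stable_kscale[OF wf_sheafD(1)[OF wfE pu] pu r(3)], rule stable_kscale[OF wf_sheafD(1)[OF wfE pv] pv r(4)])
    show "f (kscale t x2) - kscale t x1 \<in> snd (G u)" "f (kscale t y2) - kscale t y1 \<in> snd (G v)"
      unfolding kf kd
      by (rule stable_kscale[OF wf_sheafD(2)[OF wfG pu] pu r(5)], rule stable_kscale[OF wf_sheafD(2)[OF wfG pv] pv r(6)])
    show "(kscale t y2 - kscale t x2, kscale t z) \<in> \<Phi> w"
      unfolding kd unfolding kscale_def by (rule sheaf_corrD(8)[OF \<Phi> pw r(7) const_in_structure_ring[OF pw]])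
  qed
qed

lemma alpha_hom: "alpha \<in> module_hom class_ring (H0 L O1) (H1 L O2)"
proof -
  interpret H0: vs_image "H0 L O1" "H0_class O1" "cocycles O1" "\<lambda>t (x, y). (kscale t x, kscale t y)"
    by (rule H0_vs_image[OF wf1])
  interpret H1: vs_image "H1 L O2" "H1_class O2" "fst (O2 w)" kscale
    by (rule H1_vs_image[OF wf2])
  have relw: "z \<in> fst (O2 w)" if "rel x y z" for x y z
    using that sheaf_corrD(2)[OF \<Phi> pw] unfolding rel_def by blast
  have ex: "\<exists>x y z. Z = H0_class O1 (x, y) \<and> (x, y) \<in> cocycles O1 \<and> rel x y z \<and> alpha Z = H1_class O2 z"
    if "Z \<in> carrier (H0 L O1)" for Z
    using that rel_exists alpha_value unfolding H0.carrier by fast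
  show ?thesis unfolding module_hom_def
  proof (intro CollectI conjI allI impI)
    show "alpha \<in> carrier (H0 L O1) \<rightarrow> carrier (H1 L O2)"
    proof
      fix Z assume "Z \<in> carrier (H0 L O1)"
      then obtain z where "z \<in> fst (O2 w)" "alpha Z = H1_class O2 z" using ex relw by blast
      then show "alpha Z \<in> carrier (H1 L O2)" unfolding H1.carrier by blast
    qed
    fix X Y assume "X \<in> carrier (H0 L O1) \<and> Y \<in> carrier (H0 L O1)"
    then have XY: "X \<in> carrier (H0 L O1)" "Y \<in> carrier (H0 L O1)" by auto
    obtain x y z where x: "X = H0_class O1 (x, y)" "(x, y) \<in> cocycles O1" "rel x y z" "alpha X = H1_class O2 z"
      using ex[OF XY(1)] by blast
    obtain x' y' z' where x': "Y = H0_class O1 (x', y')" "(x', y') \<in> cocycles O1" "rel x' y' z'" "alpha Y = H1_class O2 z'"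
      using ex[OF XY(2)] by blast
    have "add (H0 L O1) X Y = H0_class O1 (x + x', y + y')" unfolding x(1) x'(1) using H0.add[OF x(2) x'(2)] by simp
    then show "alpha (add (H0 L O1) X Y) = add (H1 L O2) (alpha X) (alpha Y)"
      using alpha_value[OF rel_add[OF x(3) x'(3)]] H1.add[OF relw[OF x(3)] relw[OF x'(3)]] x(4) x'(4) by simp
  next
    fix t :: 'k and X assume "t \<in> carrier class_ring \<and> X \<in> carrier (H0 L O1)"
    then have X: "X \<in> carrier (H0 L O1)" by simp
    obtain x y z where x: "X = H0_class O1 (x, y)" "(x, y) \<in> cocycles O1" "rel x y z" "alpha X = H1_class O2 z"
      using ex[OF X] by blast
    have "smult (H0 L O1) t X = H0_class O1 (kscale t x, kscale t y)" unfolding x(1) using H0.smult[OF x(2)] by simp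
    then show "alpha (smult (H0 L O1) t X) = smult (H1 L O2) t (alpha X)"
      using alpha_value[OF rel_kscale[OF x(3)]] H1.smult[OF relw[OF x(3)]] x(4) by simp
  qed
qed

definition trivial_H0 :: "('k, 'n::finite) sheaf \<Rightarrow> bool" where
  "trivial_H0 F \<longleftrightarrow> (\<forall>(x, y)\<in>cocycles F. x \<in> snd (F u) \<and> y \<in> snd (F v))"

lemma trivial_H0_iff: "wf_sheaf F \<Longrightarrow> carrier (H0 L F) = {zero (H0 L F)} \<longleftrightarrow> trivial_H0 F"
proof -
  assume F: "wf_sheaf F"
  interpret vs_image "H0 L F" "H0_class F" "cocycles F" "\<lambda>t (x, y). (kscale t x, kscale t y)"
    by (rule H0_vs_image[OF F])
  have "carrier (H0 L F) = {zero (H0 L F)} \<longleftrightarrow> (\<forall>p\<in>cocycles F. H0_class F p = H0_class F 0)"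
    unfolding carrier zero using subgrpD(1)[OF P] by auto
  then show ?thesis unfolding trivial_H0_def using H0_class_eq_0[OF F] by auto
qed

text \<open>If the connecting class is zero, kernel sections \<open>k\<close>, \<open>l\<close>
  correct the lifts to \<open>x2 + k\<close> and \<open>y2 - l\<close>, which agree on the overlap.
  They form a global section of \<open>E\<close>, hence vanish, and so does the section of the image
  that they lift.\<close>

lemma trivial_imp_injective:
  assumes triv: "trivial_H0 E" and xy: "(x, y) \<in> cocycles O1" and r: "rel x y z" and z: "z \<in> coboundaries L O2"
  shows "x \<in> snd (O1 u) \<and> y \<in> snd (O1 v)"
proof -
  obtain x1 y1 x2 y2 where r: "(x, x1) \<in> \<Psi> u" "(y, y1) \<in> \<Psi> v" "x2 \<in> fst (E u)" "y2 \<in> fst (E v)"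
     "f x2 - x1 \<in> snd (G u)" "f y2 - y1 \<in> snd (G v)" "(y2 - x2, z) \<in> \<Phi> w"
    using r unfolding rel_def by blast
  have "y2 - x2 \<in> coboundaries L K" using corr_coboundary[OF \<Phi> wfK wf2 r(7)] z by blast
  then obtain k l m where d: "y2 - x2 = k + l + m" "k \<in> fst (K u)" "l \<in> fst (K v)" "m \<in> snd (E w)"
    unfolding coboundaries_def K(2) by (auto elim!: set_plus_elim)
  note gu = wf_subgrp(2)[OF wfG pu] and gv = wf_subgrp(2)[OF wfG pv]
  have "x2 + k \<in> fst (E u)" "y2 - l \<in> fst (E v)"
    using d(2,3) subgrpD(4)[OF wf_subgrp(1)[OF wfE pu] r(3)] subgrpD(2)[OF wf_subgrp(1)[OF wfE pv] r(4)] by (simp_all only: K)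
  moreover have "(x2 + k) - (y2 - l) = - m" using d(1) by (simp add: algebra_simps)
  then have "(x2 + k) - (y2 - l) \<in> snd (E w)" using subgrpD(3)[OF wf_subgrp(2)[OF wfE pw] d(4)] by (simp only:)
  ultimately have "(x2 + k, y2 - l) \<in> cocycles E" by (simp add: cocycles_def)
  then have s: "x2 + k \<in> snd (E u)" "y2 - l \<in> snd (E v)" using triv unfolding trivial_H0_def by blast+
  have fs: "f (x2 + k) \<in> snd (G u)" "f (y2 - l) \<in> snd (G v)"
    by (rule f_snd[OF pu s(1)], rule f_snd[OF pv s(2)])
  have kl: "f k \<in> snd (G u)" "f l \<in> snd (G v)" using d(2,3) by (simp_all only: K)
  have "x1 = f (x2 + k) - f k - (f x2 - x1)" "y1 = f (y2 - l) + f l - (f y2 - y1)" by (simp_all add: f_hom)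
  then have "x1 \<in> snd (G u)" "y1 \<in> snd (G v)"
    using subgrpD(2)[OF gu subgrpD(2)[OF gu fs(1) kl(1)] r(5)] subgrpD(2)[OF gv subgrpD(4)[OF gv fs(2) kl(2)] r(6)]
    by (simp_all only:)
  then show ?thesis using sheaf_corrD(3)[OF \<Psi> pu r(1)] sheaf_corrD(3)[OF \<Psi> pv r(2)] by (simp only: I)
qed

text \<open>A global section of \<open>E\<close> is a lift of its own image, so the image has
  connecting class zero and vanishes by injectivity. The section then lies in the kernel sheaf,
  which has no nonzero global sections.\<close>

lemma injective_imp_trivial:
  assumes triv: "trivial_H0 O2"
    and inj: "\<And>x y z. (x, y) \<in> cocycles O1 \<Longrightarrow> rel x y z \<Longrightarrow> z \<in> coboundaries L O2 \<Longrightarrow> x \<in> snd (O1 u) \<and> y \<in> snd (O1 v)"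
  shows "trivial_H0 E"
  unfolding trivial_H0_def
proof (intro ballI, clarify)
  fix x3 y3 assume "(x3, y3) \<in> cocycles E"
  then have 3: "x3 \<in> fst (E u)" "y3 \<in> fst (E v)" "x3 - y3 \<in> snd (E w)" by (auto simp: cocycles_def)
  have 0: "0 \<in> snd (G u)" "0 \<in> snd (G v)"
    by (rule subgrpD(1)[OF wf_subgrp(2)[OF wfG pu]], rule subgrpD(1)[OF wf_subgrp(2)[OF wfG pv]])
  have "f x3 + 0 \<in> fst (I u)" "f y3 + 0 \<in> fst (I v)"
    unfolding I by (intro set_plus_intro imageI 3 0)+
  then obtain x y where xy: "(x, f x3) \<in> \<Psi> u" "(y, f y3) \<in> \<Psi> v"
    using sheaf_corrD(5)[OF \<Psi> pu] sheaf_corrD(5)[OF \<Psi> pv] by (metis add.right_neutral)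
  have "(x - y, f x3 - f y3) \<in> \<Psi> w" by (intro corr_diff[OF \<Psi> pw] corr_to_w[OF \<Psi>] xy)
  moreover have "f x3 - f y3 \<in> snd (I w)" unfolding f_hom(2)[symmetric] I by (rule f_snd[OF pw 3(3)])
  ultimately have "x - y \<in> snd (O1 w)" using sheaf_corrD(3)[OF \<Psi> pw] by blast
  then have coc: "(x, y) \<in> cocycles O1"
    using sheaf_corrD(1)[OF \<Psi> pu xy(1)] sheaf_corrD(1)[OF \<Psi> pv xy(2)] by (simp add: cocycles_def)
  have "- (x3 - y3) \<in> snd (E w)" by (rule subgrpD(3)[OF wf_subgrp(2)[OF wfE pw] 3(3)])
  then have yx: "y3 - x3 \<in> snd (K w)" by (simp add: K)
  then obtain z where z: "(y3 - x3, z) \<in> \<Phi> w" using sheaf_corrD(4)[OF \<Phi> pw] wf_sheafD(3)[OF wfK pw] by blast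
  have "z \<in> coboundaries L O2"
    using sheaf_corrD(3)[OF \<Phi> pw z] yx coboundaries_stable(5)[OF wf2] by blast
  moreover have "rel x y z" unfolding rel_def
    using xy 3 z 0 by (intro exI[of _ "f x3"] exI[of _ "f y3"] exI[of _ x3] exI[of _ y3]) simp
  ultimately have "x \<in> snd (O1 u)" "y \<in> snd (O1 v)" using inj[OF coc] by blast+
  then have "f x3 \<in> snd (G u)" "f y3 \<in> snd (G v)"
    using sheaf_corrD(3)[OF \<Psi> pu xy(1)] sheaf_corrD(3)[OF \<Psi> pv xy(2)] by (simp_all only: I)
  then have k: "x3 \<in> fst (K u)" "y3 \<in> fst (K v)" using 3 by (simp_all only: K)
  obtain x4 where x4: "(x3, x4) \<in> \<Phi> u" using sheaf_corrD(4)[OF \<Phi> pu k(1)] by blast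
  obtain y4 where y4: "(y3, y4) \<in> \<Phi> v" using sheaf_corrD(4)[OF \<Phi> pv k(2)] by blast
  have "(x3 - y3, x4 - y4) \<in> \<Phi> w" by (intro corr_diff[OF \<Phi> pw] corr_to_w[OF \<Phi>] x4 y4)
  then have "x4 - y4 \<in> snd (O2 w)" using sheaf_corrD(3)[OF \<Phi> pw] 3(3) K(2) by metis
  then have "(x4, y4) \<in> cocycles O2"
    using sheaf_corrD(2)[OF \<Phi> pu x4] sheaf_corrD(2)[OF \<Phi> pv y4] by (simp add: cocycles_def)
  then have "x4 \<in> snd (O2 u)" "y4 \<in> snd (O2 v)" using triv unfolding trivial_H0_def by blast+
  then show "x3 \<in> snd (E u) \<and> y3 \<in> snd (E v)"
    using sheaf_corrD(3)[OF \<Phi> pu x4] sheaf_corrD(3)[OF \<Phi> pv y4] by (simp only: K)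
qed

lemma trivial_imp_kernel_trivial:
  assumes triv: "trivial_H0 E"
  shows "trivial_H0 O2"
  unfolding trivial_H0_def
proof (intro ballI, clarify)
  fix x4 y4 assume "(x4, y4) \<in> cocycles O2"
  then have 4: "x4 \<in> fst (O2 u)" "y4 \<in> fst (O2 v)" "x4 - y4 \<in> snd (O2 w)" by (auto simp: cocycles_def)
  obtain x3 where x3: "(x3, x4) \<in> \<Phi> u" using sheaf_corrD(5)[OF \<Phi> pu 4(1)] by blast
  obtain y3 where y3: "(y3, y4) \<in> \<Phi> v" using sheaf_corrD(5)[OF \<Phi> pv 4(2)] by blast
  have "(x3 - y3, x4 - y4) \<in> \<Phi> w" by (intro corr_diff[OF \<Phi> pw] corr_to_w[OF \<Phi>] x3 y3)
  then have "x3 - y3 \<in> snd (E w)" using sheaf_corrD(3)[OF \<Phi> pw] 4(3) K(2) by metis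
  then have "(x3, y3) \<in> cocycles E"
    using sheaf_corrD(1)[OF \<Phi> pu x3] sheaf_corrD(1)[OF \<Phi> pv y3] by (simp add: cocycles_def K)
  then have "x3 \<in> snd (E u)" "y3 \<in> snd (E v)" using triv unfolding trivial_H0_def by blast+
  then show "x4 \<in> snd (O2 u) \<and> y4 \<in> snd (O2 v)"
    using sheaf_corrD(3)[OF \<Phi> pu x3] sheaf_corrD(3)[OF \<Phi> pv y3] by (simp only: K)
qed

text \<open>The long exact sequence up to \<open>H1\<close> of the kernel: the global sections of
  \<open>E\<close> vanish exactly if those of the kernel vanish and the connecting map is
  injective.\<close>

theorem nontrivial_iff:
  "carrier (H0 L E) \<noteq> {zero (H0 L E)} \<longleftrightarrow> carrier (H0 L O2) \<noteq> {zero (H0 L O2)} \<or>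
     (\<exists>X\<in>carrier (H0 L O1). X \<noteq> zero (H0 L O1) \<and> alpha X = zero (H1 L O2))"
proof -
  interpret H0: vs_image "H0 L O1" "H0_class O1" "cocycles O1" "\<lambda>t (x, y). (kscale t x, kscale t y)"
    by (rule H0_vs_image[OF wf1])
  interpret H1: vs_image "H1 L O2" "H1_class O2" "fst (O2 w)" kscale
    by (rule H1_vs_image[OF wf2])
  have ker: "(\<exists>X\<in>carrier (H0 L O1). X \<noteq> zero (H0 L O1) \<and> alpha X = zero (H1 L O2)) \<longleftrightarrow>
     \<not> (\<forall>x y z. (x, y) \<in> cocycles O1 \<longrightarrow> rel x y z \<longrightarrow> z \<in> coboundaries L O2 \<longrightarrow> x \<in> snd (O1 u) \<and> y \<in> snd (O1 v))"
  proof
    assume "\<exists>X\<in>carrier (H0 L O1). X \<noteq> zero (H0 L O1) \<and> alpha X = zero (H1 L O2)"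
    then obtain x y where xy: "(x, y) \<in> cocycles O1" "H0_class O1 (x, y) \<noteq> H0_class O1 0"
      "alpha (H0_class O1 (x, y)) = H1_class O2 0" unfolding H0.carrier H0.zero H1.zero by force
    obtain z where z: "rel x y z" using rel_exists[OF xy(1)] by blast
    then have "z \<in> coboundaries L O2" using xy(3) alpha_value[OF z] H1_class_eq_0[OF wf2] by simp
    then show "\<not> (\<forall>x y z. (x, y) \<in> cocycles O1 \<longrightarrow> rel x y z \<longrightarrow> z \<in> coboundaries L O2 \<longrightarrow> x \<in> snd (O1 u) \<and> y \<in> snd (O1 v))"
      using xy z H0_class_eq_0[OF wf1] by blast
  next
    assume "\<not> (\<forall>x y z. (x, y) \<in> cocycles O1 \<longrightarrow> rel x y z \<longrightarrow> z \<in> coboundaries L O2 \<longrightarrow> x \<in> snd (O1 u) \<and> y \<in> snd (O1 v))"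
    then obtain x y z where xy: "(x, y) \<in> cocycles O1" "rel x y z" "z \<in> coboundaries L O2" "\<not> (x \<in> snd (O1 u) \<and> y \<in> snd (O1 v))"
      by blast
    then show "\<exists>X\<in>carrier (H0 L O1). X \<noteq> zero (H0 L O1) \<and> alpha X = zero (H1 L O2)"
      unfolding H0.carrier H0.zero H1.zero
      using alpha_value[OF xy(2)] H1_class_eq_0[OF wf2] H0_class_eq_0[OF wf1] by blast
  qed
  show ?thesis
    unfolding ker trivial_H0_iff[OF wfE] trivial_H0_iff[OF wf2]
    using trivial_imp_injective injective_imp_trivial trivial_imp_kernel_trivial by blast
qed

end

section \<open>Cohomology of line bundles on a line\<close>

lemma lookup_single_mult_add:
  fixes s :: "'k::comm_ring_1 R"
  shows "Poly_Mapping.lookup (Poly_Mapping.single m 1 * s) (m + k) = Poly_Mapping.lookup s k"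
proof (induction s rule: R_induct)
  case (single n c)
  show ?case by (simp add: mult_single lookup_single)
qed (simp add: ring_distribs lookup_add)

lemma lookup_single_mult_less:
  fixes s :: "'k::comm_ring_1 R"
  assumes "Poly_Mapping.lookup k i < Poly_Mapping.lookup m i"
  shows "Poly_Mapping.lookup (Poly_Mapping.single m 1 * s) k = 0"
proof (induction s rule: R_induct)
  case (single n c)
  have "m + n \<noteq> k" using assms by (auto simp: lookup_add)
  then show ?case by (simp add: mult_single lookup_single)
qed (simp add: ring_distribs lookup_add)

lemma var_power: "var i ^ n = Poly_Mapping.single (Poly_Mapping.single i n) (1 :: 'k::comm_ring_1)"
  by (induction n) (simp_all add: var_def mult_single single_add[symmetric])

definition mon :: "nat \<Rightarrow> nat \<Rightarrow> 3 \<Rightarrow>\<^sub>0 nat" where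
  "mon i j = Poly_Mapping.single 1 i + Poly_Mapping.single 2 j"

lemma lookup_mon: "Poly_Mapping.lookup (mon i j) 1 = i" "Poly_Mapping.lookup (mon i j) 2 = j"
  "Poly_Mapping.lookup (mon i j) 3 = 0"
  by (simp_all add: mon_def lookup_add lookup_single)

lemma mdeg_mon: "mdeg (mon i j) = i + j"
  by (simp add: mdeg_def sum_3 lookup_mon)

lemma mon_eq_iff: "mon i j = mon i' j' \<longleftrightarrow> i = i' \<and> j = j'"
  using lookup_mon by metis

lemma mon_add: "mon i j + mon i' j' = mon (i + i') (j + j')"
  by (simp add: mon_def single_add ac_simps)

lemma var_powers: "var 1 ^ i * var 2 ^ j = Poly_Mapping.single (mon i j) (1 :: 'k::comm_ring_1)"
  by (simp add: var_power mult_single mon_def)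

lemma mon_cases:
  assumes "Poly_Mapping.lookup m 3 = (0::nat)"
  shows "m = mon (Poly_Mapping.lookup m 1) (Poly_Mapping.lookup m 2)"
proof (rule poly_mapping_eqI)
  fix k :: 3
  show "Poly_Mapping.lookup m k = Poly_Mapping.lookup (mon (Poly_Mapping.lookup m 1) (Poly_Mapping.lookup m 2)) k"
    using exhaust_3[of k] assms lookup_mon by auto
qed

locale line_coh = line_frame a b c p q r L for a b c p q r :: "'k::field ^ 3" and L +
  assumes ab: "coord_u L = linear_form a" "coord_v L = linear_form b"
begin

sublocale cech L
proof
  have "a \<noteq> 0" "b \<noteq> 0" by (metis dot_0_left duals(1) zero_neq_one, metis dot_0_left duals(5) zero_neq_one)
  then show "principal (coord_u L)" "principal (coord_v L)" unfolding ab by (auto intro: principal_linear_form)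
qed

text \<open>The coefficient of \<open>u ^ i * v ^ j\<close> in the restriction to \<open>L\<close>,
  since \<open>toL\<close> sends \<open>u\<close>, \<open>v\<close> to \<open>var 1\<close>,
  \<open>var 2\<close>.\<close>

definition coef :: "nat \<Rightarrow> nat \<Rightarrow> 'k R \<Rightarrow> 'k" where
  "coef i j t = Poly_Mapping.lookup (toL t) (mon i j)"

lemma coef_hom: "coef i j (s + t) = coef i j s + coef i j t" "coef i j (s - t) = coef i j s - coef i j t"
  "coef i j 0 = 0" "coef i j (sum F S) = (\<Sum>x\<in>S. coef i j (F x))"
  by (simp_all add: coef_def toL_hom lookup_add lookup_minus lookup_sum)

lemma const_mult_lookup: "Poly_Mapping.lookup (const x * s) k = x * Poly_Mapping.lookup (s :: 'k R) k"
  by (induction s rule: R_induct) (simp_all add: const_def mult_single lookup_single when_def ring_distribs lookup_add)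

lemma coef_const: "coef i j (const x * t) = x * coef i j t"
  by (simp add: coef_def toL_hom const_mult_lookup)

lemma toL_uv: "toL u = var 1" "toL v = var 2" by (simp_all add: ab)

lemma coef_mult:
  "coef (M + i) (N + j) (u ^ M * v ^ N * t) = coef i j t"
  "i < M \<or> j < N \<Longrightarrow> coef i j (u ^ M * v ^ N * t) = 0"
proof -
  have e: "toL (u ^ M * v ^ N * t) = Poly_Mapping.single (mon M N) 1 * toL t"
    by (simp add: toL_hom toL_uv var_powers)
  show "coef (M + i) (N + j) (u ^ M * v ^ N * t) = coef i j t"
    unfolding coef_def e mon_add[symmetric] by (rule lookup_single_mult_add)
  show "coef i j (u ^ M * v ^ N * t) = 0" if "i < M \<or> j < N"
    unfolding coef_def e using that lookup_mon
    by (elim disjE) (rule lookup_single_mult_less[where i = 1], simp, rule lookup_single_mult_less[where i = 2], simp)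
qed

lemma coef_mon: "coef i j (u ^ M * v ^ N) = (if i = M \<and> j = N then 1 else 0)"
  by (auto simp: coef_def toL_hom toL_uv var_powers lookup_single when_def mon_eq_iff)

text \<open>The parametrization of \<open>L\<close> involves only \<open>var 1\<close> and
  \<open>var 2\<close>. Hence the coefficients \<open>coef i j\<close> determine a restriction
  completely.\<close>

lemma no_third: "Poly_Mapping.lookup (toL t) k \<noteq> 0 \<Longrightarrow> Poly_Mapping.lookup k 3 = 0"
proof (induction t arbitrary: k rule: poly_induct_ring)
  case (const x)
  then have "Poly_Mapping.lookup (const x) k \<noteq> 0" by simp
  then show ?case by (simp add: const_def lookup_single when_def split: if_splits)
next
  case (var i)
  have "toL (var i) = const (p $ i) * var 1 + const (q $ i) * var 2" by (simp add: toL_def)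
  then have "Poly_Mapping.lookup (const (p $ i) * var 1 + const (q $ i) * var 2) k \<noteq> 0" using var by simp
  then have "k = Poly_Mapping.single 1 1 \<or> k = Poly_Mapping.single 2 1"
    by (auto simp: lookup_add const_mult_lookup var_def lookup_single when_def split: if_splits)
  then show ?case by (auto simp: lookup_single)
next
  case (add s t)
  then show ?case by (metis add.right_neutral lookup_add toL_hom(1))
next
  case (mult s t)
  then have "k \<in> Poly_Mapping.keys (toL s * toL t)" by (simp add: toL_hom in_keys_iff)
  then obtain k1 k2 where "k = k1 + k2" "k1 \<in> Poly_Mapping.keys (toL s)" "k2 \<in> Poly_Mapping.keys (toL t)"
    using keys_mult by blast
  then show ?case using mult.IH by (simp add: in_keys_iff lookup_add)
qed

lemma dvd_iff_coef: "\<alpha> dvd t \<longleftrightarrow> (\<forall>i j. coef i j t = 0)"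
proof -
  have "toL t = 0 \<longleftrightarrow> (\<forall>i j. coef i j t = 0)"
  proof
    assume z: "\<forall>i j. coef i j t = 0"
    show "toL t = 0"
    proof (rule poly_mapping_eqI, rule ccontr)
      fix k assume k: "Poly_Mapping.lookup (toL t) k \<noteq> Poly_Mapping.lookup 0 k"
      then have "k = mon (Poly_Mapping.lookup k 1) (Poly_Mapping.lookup k 2)"
        by (intro mon_cases no_third[of t]) simp
      moreover have "Poly_Mapping.lookup (toL t) (mon (Poly_Mapping.lookup k 1) (Poly_Mapping.lookup k 2)) = 0"
        using z by (simp add: coef_def)
      ultimately show False using k by simp
    qed
  qed (simp add: coef_def)
  then show ?thesis by (simp add: dvd_iff_toL)
qed

lemma coef_homog: "homog n t \<Longrightarrow> coef i j t \<noteq> 0 \<Longrightarrow> int (i + j) = n"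
  using homog_toL[of n t] unfolding homog_iff coef_def by (auto simp: mdeg_mon)

lemma homog_uv: "homog 1 u" "homog 1 v" "homog 2 w"
  using homog_mult[OF homog_linear_form homog_linear_form, of a b] by (simp_all add: ab w(1))

lemma uv_nz: "u \<noteq> 0" "v \<noteq> 0" "w \<noteq> 0" using pu pv pw by (auto simp: principal_def)

lemma homog_uvN: "homog (int i + int j) (u ^ i * v ^ j)"
  using homog_mult[OF homog_power[OF homog_uv(1)] homog_power[OF homog_uv(2)], of i j] by simp

lemma \<alpha>_ndvd: "\<not> \<alpha> dvd u ^ i * v ^ j"
proof
  assume "\<alpha> dvd u ^ i * v ^ j"
  then have "coef i j (u ^ i * v ^ j) = 0" using dvd_iff_coef by blast
  then show False by (simp add: coef_mon)
qed

lemma \<alpha>_dvd_cancel: "\<alpha> dvd u ^ i * v ^ j * t \<longleftrightarrow> \<alpha> dvd t"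
  using prime_elem_dvd_multD[OF prime_\<alpha>, of "u ^ i * v ^ j" t] \<alpha>_ndvd by auto

lemma expansion:
  assumes "homog (int n) t"
  shows "\<alpha> dvd t - (\<Sum>i\<le>n. const (coef i (n - i) t) * (u ^ i * v ^ (n - i)))"
  unfolding dvd_iff_coef
proof (intro allI)
  fix i j
  have "coef i j (\<Sum>k\<le>n. const (coef k (n - k) t) * (u ^ k * v ^ (n - k))) =
      (\<Sum>k\<le>n. if k = i then (if j = n - i then coef i (n - i) t else 0) else 0)"
    unfolding coef_hom coef_const by (rule sum.cong) (auto simp: coef_mon)
  also have "\<dots> = coef i j t"
  proof (cases "i \<le> n \<and> j = n - i")
    case False
    have "coef i j t = 0"
    proof (rule ccontr)
      assume "coef i j t \<noteq> 0"
      then have "int (i + j) = int n" by (rule coef_homog[OF assms])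
      then show False using False by auto
    qed
    then show ?thesis using False by (auto simp: sum.delta)
  qed (simp add: sum.delta)
  finally show "coef i j (t - (\<Sum>k\<le>n. const (coef k (n - k) t) * (u ^ k * v ^ (n - k)))) = 0"
    by (simp add: coef_hom)
qed

abbreviation "OL m \<equiv> O_line L m"

text \<open>Brings a section on \<open>D\<^sub>+(u)\<close> over a power of \<open>w\<close>, the
  common denominator in which sections of both open sets can be compared.\<close>

lemma frv_uv:
  "frv (vec1 s) (u ^ j) = frv (vec1 (v ^ N * (u ^ (N - j) * s))) (w ^ N)" if "j \<le> N"
proof -
  have "w ^ N = (v ^ N * u ^ (N - j)) * u ^ j"
    using that by (simp add: w(1) power_mult_distrib mult.assoc flip: power_add)
  moreover have "v ^ N * u ^ (N - j) \<noteq> 0" using uv_nz by simp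
  ultimately show ?thesis using frv_cancel[of "v ^ N * u ^ (N - j)" "vec1 s" "u ^ j"]
    by (simp add: vec1_simps mult.assoc)
qed

lemma frv_vu:
  "frv (vec1 s) (v ^ j) = frv (vec1 (u ^ N * (v ^ (N - j) * s))) (w ^ N)" if "j \<le> N"
proof -
  have "w ^ N = (u ^ N * v ^ (N - j)) * v ^ j"
    using that by (simp add: w(1) power_mult_distrib mult.assoc flip: power_add)
  moreover have "u ^ N * v ^ (N - j) \<noteq> 0" using uv_nz by simp
  ultimately show ?thesis using frv_cancel[of "u ^ N * v ^ (N - j)" "vec1 s" "v ^ j"]
    by (simp add: vec1_simps mult.assoc)
qed

lemma frv1_diff: "s \<noteq> 0 \<Longrightarrow> frv (vec1 x) s - frv (vec1 y) s = frv (vec1 (x - y)) (s :: 'k R)"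
  and frv1_add: "s \<noteq> 0 \<Longrightarrow> frv (vec1 x) s + frv (vec1 y) s = frv (vec1 (x + y)) (s :: 'k R)"
proof -
  assume s: "s \<noteq> 0"
  have m: "s *s vec1 x - s *s vec1 y = s *s vec1 (x - y)" "s *s vec1 x + s *s vec1 y = s *s vec1 (x + y)"
    by (simp_all add: vec1_def Finite_Cartesian_Product.vec_eq_iff algebra_simps)
  show "frv (vec1 x) s - frv (vec1 y) s = frv (vec1 (x - y)) s"
    unfolding frv_diff[OF s s] m by (rule frv_cancel[OF s])
  show "frv (vec1 x) s + frv (vec1 y) s = frv (vec1 (x + y)) s"
    unfolding frv_add[OF s s] m by (rule frv_cancel[OF s])
qed

lemma O_w_zero: "frv (vec1 s) (w ^ N) \<in> snd (OL m w) \<Longrightarrow> \<alpha> dvd s"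
proof -
  assume "frv (vec1 s) (w ^ N) \<in> snd (OL m w)"
  then obtain i where "\<alpha> dvd w ^ i * s" using O_line_zeroE[OF _ uv_nz(3) homog_uv(3)] by blast
  then show ?thesis using \<alpha>_dvd_cancel[of i i s] by (simp add: w(1) power_mult_distrib)
qed

lemma snd_u: "homog (m + int j) s \<Longrightarrow> \<alpha> dvd s \<Longrightarrow> frv (vec1 s) (u ^ j) \<in> snd (OL m u)"
  using O_line_zeroI[OF uv_nz(1) homog_uv(1), of m j s 0] by simp
lemma snd_v: "homog (m + int j) s \<Longrightarrow> \<alpha> dvd s \<Longrightarrow> frv (vec1 s) (v ^ j) \<in> snd (OL m v)"
  using O_line_zeroI[OF uv_nz(2) homog_uv(2), of m j s 0] by simp
lemma snd_w: "homog (m + 2 * int j) s \<Longrightarrow> \<alpha> dvd s \<Longrightarrow> frv (vec1 s) (w ^ j) \<in> snd (OL m w)"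
  using O_line_zeroI[OF uv_nz(3) homog_uv(3), of m j s 0] by (simp add: mult.commute)

lemma wfO: "wf_sheaf (OL m)" by (rule wf_O_line)

text \<open>Global sections of \<open>\<O>\<^sub>L(m)\<close> are forms of degree \<open>m\<close>: a polynomial congruence
  \<open>v\<^sup>i x \<equiv> u\<^sup>j y\<close> forces \<open>u\<^sup>j\<close> to divide \<open>x\<close> modulo \<open>\<alpha>\<close>.\<close>

lemma cocycle_form:
  assumes "(x, y) \<in> cocycles (OL m)"
  obtains t where "homog m t" "x - frv (vec1 t) 1 \<in> snd (OL m u)" "y - frv (vec1 t) 1 \<in> snd (OL m v)"
proof -
  have xy: "x \<in> fst (OL m u)" "y \<in> fst (OL m v)" "x - y \<in> snd (OL m w)" using assms by (auto simp: cocycles_def)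
  obtain s j where s: "x = frv (vec1 s) (u ^ j)" "homog (m + int j) s"
    using O_lineE[OF xy(1) uv_nz(1) homog_uv(1)] by auto
  obtain s' i where s': "y = frv (vec1 s') (v ^ i)" "homog (m + int i) s'"
    using O_lineE[OF xy(2) uv_nz(2) homog_uv(2)] by auto
  let ?N = "i + j"
  have wN: "w ^ ?N \<noteq> 0" using uv_nz by simp
  have "x - y = frv (vec1 (v ^ ?N * (u ^ (?N - j) * s) - u ^ ?N * (v ^ (?N - i) * s'))) (w ^ ?N)"
    unfolding s s' using frv_uv[of j ?N s] frv_vu[of i ?N s'] frv1_diff[OF wN] by simp
  then have "\<alpha> dvd v ^ ?N * (u ^ (?N - j) * s) - u ^ ?N * (v ^ (?N - i) * s')"
    using xy(3) O_w_zero by simp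
  moreover have "v ^ ?N * (u ^ (?N - j) * s) - u ^ ?N * (v ^ (?N - i) * s') = u ^ i * v ^ j * (v ^ i * s - u ^ j * s')"
    by (simp add: power_add algebra_simps)
  ultimately have "\<alpha> dvd v ^ i * s - u ^ j * s'" using \<alpha>_dvd_cancel by simp
  then have eq: "var 2 ^ i * toL s = var 1 ^ j * toL s'" by (simp add: dvd_iff_toL toL_hom toL_uv)
  have pr1: "prime_elem (var 1 :: 'k R)" unfolding linear_form_axis[symmetric]
    by (rule prime_elem_linear_form) (simp add: axis_eq_0_iff)
  have n12: "\<not> var 1 dvd (var 2 :: 'k R)"
  proof
    assume "var 1 dvd (var 2 :: 'k R)"
    then have "linear_form (axis 1 1) dvd (linear_form (axis 2 1) :: 'k R)" by (simp add: linear_form_axis)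
    from linear_form_dvd_imp[OF this, of "axis 2 1"] show False unfolding dot_axis by (simp add: axis_def)
  qed
  have n12': "\<not> var 1 dvd (var 2 ^ i :: 'k R)" using n12 prime_elem_dvd_power[OF pr1] by blast
  \<comment> \<open>The power is written as a product of \<open>j\<close> equal primes so that
    \<open>prime_prod_dvd_cancel\<close> removes the factor \<open>var 2 ^ i\<close>. The quotient
    \<open>T\<close> is the restriction of the global form.\<close>
  have "(\<Prod>k<j. var 1) dvd var 2 ^ i * toL s" unfolding eq by simp
  then have "(\<Prod>k<j. var 1) dvd toL s"
    by (rule prime_prod_dvd_cancel[OF finite_lessThan pr1 n12'])
  then have "var 1 ^ j dvd toL s" by (simp only: prod_constant card_lessThan)
  then obtain T where T: "toL s = var 1 ^ j * T" ..
  have v1: "var 1 ^ j \<noteq> (0 :: 'k R)" using prime_elem_not_zeroI[OF pr1] by simp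
  have hT: "homog m T"
  proof -
    have 1: "homog (m + int j) (var 1 ^ j * T)" unfolding T[symmetric] by (rule homog_toL[OF s(2)])
    have 2: "homog (int j * 1) (var 1 ^ j :: 'k R)" by (rule homog_power[OF homog_var])
    show ?thesis using homog_cancel[OF 2 v1 1] by simp
  qed
  have T': "toL s' = var 2 ^ i * T"
  proof -
    have "var 1 ^ j * toL s' = var 1 ^ j * (var 2 ^ i * T)" unfolding eq[symmetric] T by (simp only: ac_simps)
    then show ?thesis by (rule iffD1[OF mult_left_cancel[OF v1]])
  qed
  have toof: "toL (ofL (toL f)) = toL f" for f using dvd_diff_ofL_toL[of f] by (simp add: dvd_iff_toL toL_hom)
  have o1: "toL (ofL (var 1)) = var 1" by (simp add: ofL_def)
  have ofp: "ofL (var 1 ^ j) = ofL (var 1) ^ j" unfolding ofL_def by (rule subst_power)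
  \<comment> \<open>\<open>T\<close> is not known to be a restriction, but
    \<open>var 1 ^ j * T\<close> is one; the equation holds after multiplication by the power, which
    cancels.\<close>
  have TT: "toL (ofL T) = T"
  proof -
    have "var 1 ^ j * toL (ofL T) = toL (ofL (var 1 ^ j * T))" by (simp add: ofL_hom toL_hom ofp o1)
    also have "\<dots> = var 1 ^ j * T" unfolding T[symmetric] by (rule toof)
    finally show ?thesis by (rule iffD1[OF mult_left_cancel[OF v1]])
  qed
  let ?t = "ofL T"
  have ht: "homog m ?t" by (rule homog_ofL[OF hT])
  have d: "\<alpha> dvd s - u ^ j * ?t" "\<alpha> dvd s' - v ^ i * ?t"
    by (simp_all add: dvd_iff_toL toL_hom toL_uv T T' TT)
  have hs: "homog (m + int j) (s - u ^ j * ?t)" "homog (m + int i) (s' - v ^ i * ?t)"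
    using s(2) s'(2) homog_mult[OF homog_power[OF homog_uv(1)] ht, of j] homog_mult[OF homog_power[OF homog_uv(2)] ht, of i]
    by (auto intro!: homog_diff simp: add.commute)
  have nz: "u ^ j \<noteq> 0" "v ^ i \<noteq> 0" using uv_nz by simp_all
  have f1: "frv (vec1 ?t) 1 = frv (vec1 (u ^ j * ?t)) (u ^ j)" "frv (vec1 ?t) 1 = frv (vec1 (v ^ i * ?t)) (v ^ i)"
    using frv_cancel[OF nz(1), of "vec1 ?t" 1] frv_cancel[OF nz(2), of "vec1 ?t" 1] by (simp_all add: vec1_simps)
  have "x - frv (vec1 ?t) 1 = frv (vec1 (s - u ^ j * ?t)) (u ^ j)" unfolding s f1(1) by (rule frv1_diff[OF nz(1)])
  moreover have "y - frv (vec1 ?t) 1 = frv (vec1 (s' - v ^ i * ?t)) (v ^ i)" unfolding s' f1(2) by (rule frv1_diff[OF nz(2)])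
  ultimately show ?thesis using that[OF ht] snd_u[OF hs(1) d(1)] snd_v[OF hs(2) d(2)] by simp
qed

section \<open>Bases of the cohomology of line bundles\<close>

lemma H0_negative:
  assumes "m < 0"
  shows "carrier (H0 L (OL m)) = {zero (H0 L (OL m))}"
proof -
  interpret vs_image "H0 L (OL m)" "H0_class (OL m)" "cocycles (OL m)" "\<lambda>t (x, y). (kscale t x, kscale t y)"
    by (rule H0_vs_image[OF wfO])
  have "H0_class (OL m) z = H0_class (OL m) 0" if zc: "z \<in> cocycles (OL m)" for z
  proof -
    obtain x y where z: "z = (x, y)" by (cases z)
    obtain t where t: "homog m t" "x - frv (vec1 t) 1 \<in> snd (OL m u)" "y - frv (vec1 t) 1 \<in> snd (OL m v)"
      using cocycle_form[OF zc[unfolded z]] .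
    have "t = 0" by (rule homog_neg[OF t(1) assms])
    then have "frv (vec1 t) 1 = 0" by (simp add: vec1_def frv_def Finite_Cartesian_Product.vec_eq_iff fract_collapse)
    then show ?thesis using t H0_class_eq_0[OF wfO] z by simp
  qed
  then have "\<forall>z\<in>cocycles (OL m). H0_class (OL m) z = H0_class (OL m) 0" by blast
  moreover have "0 \<in> cocycles (OL m)" by (rule subgrpD(1)[OF P])
  ultimately show ?thesis unfolding carrier zero by blast
qed

lemma sum_frv:
  assumes "s \<noteq> (0 :: 'k R)"
  shows "(\<Sum>i\<in>S. kscale (cc i) (frv (vec1 (e i)) s)) = frv (vec1 (\<Sum>i\<in>S. const (cc i) * e i)) s"
proof (induction S rule: infinite_finite_induct)
  case (insert x S)
  then show ?case by (simp add: kscale_frv vec1_simps frv1_add[OF assms])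
qed (simp_all add: vec1_def frv_def Finite_Cartesian_Product.vec_eq_iff fract_collapse)

text \<open>The basis consists of the monomials \<open>u ^ i * v ^ (n - i)\<close>, each represented
  by the same fraction on both open sets; independence is read off with \<open>coef\<close>.\<close>

lemma H0_basis: "\<exists>bs. ordered_basis (H0 L (OL (int n))) bs \<and> length bs = n + 1"
proof -
  let ?O = "OL (int n)"
  interpret vs_image "H0 L ?O" "H0_class ?O" "cocycles ?O" "\<lambda>t (x, y). (kscale t x, kscale t y)"
    by (rule H0_vs_image[OF wfO])
  let ?e = "\<lambda>i. frv (vec1 (u ^ i * v ^ (n - i))) 1"
  let ?b = "\<lambda>i. (?e i, ?e i)"
  have form: "(frv (vec1 t) 1, frv (vec1 t) 1) \<in> cocycles ?O" if t: "homog (int n) t" for t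
  proof -
    have "frv (vec1 t) (u ^ 0) \<in> fst (?O u)" "frv (vec1 t) (v ^ 0) \<in> fst (?O v)"
      by (rule O_lineI[OF homog_uv(1)], simp add: t, rule O_lineI[OF homog_uv(2)], simp add: t)
    then show ?thesis using subgrpD(1)[OF wf_subgrp(2)[OF wfO pw]] by (simp add: cocycles_def)
  qed
  have sum2: "(\<Sum>i<k. case ?b i of (x, y) \<Rightarrow> (kscale (cc i) x, kscale (cc i) y)) =
      (frv (vec1 (\<Sum>i<k. const (cc i) * (u ^ i * v ^ (n - i)))) 1, frv (vec1 (\<Sum>i<k. const (cc i) * (u ^ i * v ^ (n - i)))) 1)"
    for k :: nat and cc
    using sum_frv[of 1 cc "\<lambda>i. u ^ i * v ^ (n - i)" "{..<k}"] by (simp add: sum_prod[symmetric] prod_eq_iff fst_sum snd_sum)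
  have hu: "homog (int n) (u ^ i * v ^ (n - i))" if "i < n + 1" for i
    using homog_uvN[of i "n - i"] that by (simp add: of_nat_diff)
  have "ordered_basis (H0 L ?O) (map (\<lambda>i. H0_class ?O (?b i)) [0..<n + 1])"
  proof (rule image_basis)
    show "?b i \<in> cocycles ?O" if "i < n + 1" for i by (rule form[OF hu[OF that]])
  next
    fix z assume z: "z \<in> cocycles ?O"
    obtain x y where xy: "z = (x, y)" by (cases z)
    obtain t where t: "homog (int n) t" "x - frv (vec1 t) 1 \<in> snd (?O u)" "y - frv (vec1 t) 1 \<in> snd (?O v)"
      using cocycle_form[OF z[unfolded xy]] .
    let ?s = "\<Sum>i<n + 1. const (coef i (n - i) t) * (u ^ i * v ^ (n - i))"
    have d: "\<alpha> dvd t - ?s" using expansion[OF t(1)] by (simp add: lessThan_Suc_atMost)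
    have h: "homog (int n) (t - ?s)"
      by (intro homog_diff t homog_sum homog_const_mult hu) simp
    have "frv (vec1 (t - ?s)) (u ^ 0) \<in> snd (?O u)" by (rule snd_u) (use d h in simp_all)
    moreover have "frv (vec1 (t - ?s)) (v ^ 0) \<in> snd (?O v)" by (rule snd_v) (use d h in simp_all)
    ultimately have "frv (vec1 t) 1 - frv (vec1 ?s) 1 \<in> snd (?O u)" "frv (vec1 t) 1 - frv (vec1 ?s) 1 \<in> snd (?O v)"
      using frv1_diff[of 1 t ?s] by simp_all
    then have "(x - frv (vec1 t) 1) + (frv (vec1 t) 1 - frv (vec1 ?s) 1) \<in> snd (?O u)"
      "(y - frv (vec1 t) 1) + (frv (vec1 t) 1 - frv (vec1 ?s) 1) \<in> snd (?O v)"
      using t(2,3) subgrpD(4)[OF wf_subgrp(2)[OF wfO pu]] subgrpD(4)[OF wf_subgrp(2)[OF wfO pv]] by blast+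
    then have "x - frv (vec1 ?s) 1 \<in> snd (?O u)" "y - frv (vec1 ?s) 1 \<in> snd (?O v)" by simp_all
    then have "H0_class ?O z = H0_class ?O (frv (vec1 ?s) 1, frv (vec1 ?s) 1)"
      unfolding xy H0_class_def prod.case coset_eq_iff[OF wf_subgrp(2)[OF wfO pu]] coset_eq_iff[OF wf_subgrp(2)[OF wfO pv]]
        prod.inject by simp
    then show "\<exists>cc. H0_class ?O z = H0_class ?O (\<Sum>i<n + 1. case ?b i of (x, y) \<Rightarrow> (kscale (cc i) x, kscale (cc i) y))"
      unfolding sum2 by (rule exI[of _ "\<lambda>i. coef i (n - i) t"])
  next
    fix cc i assume e: "H0_class ?O (\<Sum>i<n + 1. case ?b i of (x, y) \<Rightarrow> (kscale (cc i) x, kscale (cc i) y)) = H0_class ?O 0"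
      and i: "i < n + 1"
    let ?s = "\<Sum>i<n + 1. const (cc i) * (u ^ i * v ^ (n - i))"
    have "frv (vec1 ?s) (u ^ 0) \<in> snd (?O u)" using e unfolding sum2 H0_class_eq_0[OF wfO] by simp
    then obtain k where "\<alpha> dvd u ^ k * ?s" using O_line_zeroE[OF _ uv_nz(1) homog_uv(1)] by blast
    then have "\<alpha> dvd ?s" using \<alpha>_dvd_cancel[of k 0] by simp
    then have "coef i (n - i) ?s = 0" using dvd_iff_coef by blast
    moreover have "coef i (n - i) ?s = (\<Sum>k<n + 1. if k = i then cc k else 0)"
      unfolding coef_hom coef_const by (rule sum.cong) (auto simp: coef_mon)
    moreover have "(\<Sum>k<n + 1. if k = i then cc k else 0) = cc i" using i by (subst sum.delta) auto
    ultimately show "cc i = 0" by (simp only:)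
  qed
  then show ?thesis by (intro exI[of _ "map (\<lambda>i. H0_class ?O (?b i)) [0..<n + 1]"]) simp
qed

lemma H0_nonneg:
  assumes "m \<ge> 0"
  shows "carrier (H0 L (OL m)) \<noteq> {zero (H0 L (OL m))}"
proof
  assume triv: "carrier (H0 L (OL m)) = {zero (H0 L (OL m))}"
  have vs: "vectorspace class_ring (H0 L (OL m))" by (rule vs_image.vs[OF H0_vs_image[OF wfO]])
  obtain bs where bs: "ordered_basis (H0 L (OL m)) bs" "length bs = nat m + 1"
    using H0_basis[of "nat m"] assms by auto
  note B = bs(1)[unfolded ordered_basis_iff[OF vs]]
  \<comment> \<open>The sum of all basis vectors is the nonzero section: the basis has
    \<open>nat m + 1 > 0\<close> elements.\<close>
  have "comb (H0 L (OL m)) bs (\<lambda>_. 1) \<in> carrier (H0 L (OL m))" using comb_closed[OF vs] B by blast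
  then have "comb (H0 L (OL m)) bs (\<lambda>_. 1) = zero (H0 L (OL m))" using triv by simp
  moreover have "comb (H0 L (OL m)) bs (\<lambda>_. 1) = zero (H0 L (OL m)) \<longrightarrow> (\<forall>i<length bs. (1::'k) = 0)"
    using B by (elim conjE) (erule spec)
  ultimately have "(1::'k) = 0" using bs(2) by auto
  then show False by simp
qed

text \<open>\<open>H\<^sup>1(\<O>\<^sub>L(m))\<close> has the basis \<open>u\<^sup>-\<^sup>1\<^sup>-\<^sup>k v\<^sup>k\<^sup>-\<^sup>n\<close>, \<open>k < n = -m-1\<close>; these are written with denominator \<open>(uv)\<^sup>n\<close>.\<close>

lemma H1_basis: "\<exists>bs. ordered_basis (H1 L (OL (- int n - 1))) bs \<and> length bs = n"
proof -
  let ?m = "- int n - 1"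
  let ?O = "OL ?m"
  interpret vs_image "H1 L ?O" "H1_class ?O" "fst (?O w)" kscale
    by (rule H1_vs_image[OF wfO])
  let ?e = "\<lambda>k. u ^ (n - 1 - k) * v ^ k"
  let ?b = "\<lambda>k. frv (vec1 (?e k)) (w ^ n)"
  note B = coboundaries_stable[OF wfO[of ?m]]
  have wnz: "w ^ N \<noteq> 0" for N using uv_nz by simp
  have he: "homog (?m + 2 * int n) (?e k)" if "k < n" for k
    using homog_uvN[of "n - 1 - k" k] that by (simp add: of_nat_diff)
  have sum1: "(\<Sum>k<n. kscale (cc k) (?b k)) = frv (vec1 (\<Sum>k<n. const (cc k) * ?e k)) (w ^ n)" for cc
    by (rule sum_frv[OF wnz])
  have lift: "frv (vec1 s) (w ^ n) = frv (vec1 (u ^ (N - n) * v ^ (N - n) * s)) (w ^ N)" if "n \<le> N" for s N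
    using frv_raise[OF uv_nz(3), of "vec1 s" n "N - n"] that by (simp add: vec1_simps w(1) power_mult_distrib)
  have "ordered_basis (H1 L ?O) (map (\<lambda>k. H1_class ?O (?b k)) [0..<n])"
  proof (rule image_basis)
    show "?b k \<in> fst (?O w)" if "k < n" for k
      by (rule O_lineI[OF homog_uv(3)]) (use he[OF that] in \<open>simp add: mult.commute\<close>)
  next
    fix z assume "z \<in> fst (?O w)"
    then obtain t0 N0 where t0: "z = frv (vec1 t0) (w ^ N0)" "homog (?m + 2 * int N0) t0"
      using O_lineE[OF _ uv_nz(3) homog_uv(3)] by (metis mult.commute)
    \<comment> \<open>The denominator exponent is raised above \<open>n\<close>, so that
      subtractions such as \<open>N - n\<close> are exact and the degree of the numerator is the
      natural number \<open>D\<close>, equal to \<open>2 * N - n - 1\<close>.\<close>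
    define N where "N = n + 1 + N0"
    define t where "t = w ^ (n + 1) * t0"
    have z: "z = frv (vec1 t) (w ^ N)" unfolding t0 N_def t_def vec1_simps(2)[symmetric] by (rule frv_raise[OF uv_nz(3)])
    define D where "D = n + 1 + 2 * N0"
    have D: "?m + 2 * int N = int D" by (simp add: D_def N_def)
    have "homog (int (n + 1) * 2 + (?m + 2 * int N0)) t" unfolding t_def by (intro homog_mult homog_power homog_uv t0)
    then have ht: "homog (int D) t" by (simp add: D_def algebra_simps)
    define cc where "cc k = coef (N - 1 - k) (N - n + k) t" for k
    let ?m1 = "\<lambda>i. const (coef i (D - i) t) * (u ^ i * v ^ (D - i))"
    \<comment> \<open>In \<open>u ^ i * v ^ (D - i)\<close> over \<open>w ^ N\<close> the factor
      \<open>u\<close> leaves the denominator for \<open>i \<ge> N\<close>; the factor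
      \<open>v\<close> leaves it for \<open>i < N - n\<close>, where \<open>D - i \<ge> N\<close>.
      These ranges are coboundaries from \<open>D\<^sub>+(v)\<close> and
      \<open>D\<^sub>+(u)\<close>; the \<open>n\<close> exponents between them give the
      basis.\<close>
    let ?A = "{N..D}" and ?C = "{..<N - n}" and ?M = "{N - n..<N}"
    have split: "{..D} = ?A \<union> ?C \<union> ?M" "finite (?A \<union> ?C)" "finite ?M" "(?A \<union> ?C) \<inter> ?M = {}" "?A \<inter> ?C = {}"
      by (auto simp: D_def N_def)
    have sums: "(\<Sum>i\<le>D. ?m1 i) = (\<Sum>i\<in>?A. ?m1 i) + (\<Sum>i\<in>?C. ?m1 i) + (\<Sum>i\<in>?M. ?m1 i)"
      unfolding split(1) by (subst sum.union_disjoint[OF split(2-4)], subst sum.union_disjoint) (use split in auto)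
    have A: "frv (vec1 (\<Sum>i\<in>?A. ?m1 i)) (w ^ N) \<in> fst (?O v)"
    proof -
      let ?s = "\<Sum>i\<in>?A. const (coef i (D - i) t) * (u ^ (i - N) * v ^ (D - i))"
      have "(\<Sum>i\<in>?A. ?m1 i) = u ^ N * (v ^ (N - N) * ?s)"
        unfolding sum_distrib_left
      proof (rule sum.cong[OF refl])
        fix i assume "i \<in> ?A"
        then have "u ^ i = u ^ N * u ^ (i - N)" by (simp flip: power_add)
        then show "?m1 i = u ^ N * (v ^ (N - N) * (const (coef i (D - i) t) * (u ^ (i - N) * v ^ (D - i))))"
          by (simp add: ac_simps)
      qed
      then have "frv (vec1 (\<Sum>i\<in>?A. ?m1 i)) (w ^ N) = frv (vec1 ?s) (v ^ N)" using frv_vu[of N N ?s] by simp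
      moreover have "homog (?m + int N * 1) ?s"
      proof (intro homog_sum homog_const_mult)
        fix i assume "i \<in> ?A"
        then have "int (i - N) + int (D - i) = ?m + int N * 1" using D by auto
        then show "homog (?m + int N * 1) (u ^ (i - N) * v ^ (D - i))" using homog_uvN by metis
      qed
      ultimately show ?thesis using O_lineI[OF homog_uv(2)] by simp
    qed
    have C: "frv (vec1 (\<Sum>i\<in>?C. ?m1 i)) (w ^ N) \<in> fst (?O u)"
    proof -
      let ?s = "\<Sum>i\<in>?C. const (coef i (D - i) t) * (u ^ i * v ^ (D - i - N))"
      have DN: "N \<le> D - i" if "i \<in> ?C" for i using that by (auto simp: D_def N_def)
      have "(\<Sum>i\<in>?C. ?m1 i) = v ^ N * (u ^ (N - N) * ?s)"
        unfolding sum_distrib_left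
      proof (rule sum.cong[OF refl])
        fix i assume "i \<in> ?C"
        then have "N \<le> D - i" by (rule DN)
        then have "D - i = N + (D - i - N)" by simp
        then have "v ^ (D - i) = v ^ N * v ^ (D - i - N)" by (rule trans[OF arg_cong[where f = "\<lambda>x. v ^ x"] power_add])
        then show "?m1 i = v ^ N * (u ^ (N - N) * (const (coef i (D - i) t) * (u ^ i * v ^ (D - i - N))))"
          by (simp add: ac_simps)
      qed
      then have "frv (vec1 (\<Sum>i\<in>?C. ?m1 i)) (w ^ N) = frv (vec1 ?s) (u ^ N)" using frv_uv[of N N ?s] by simp
      moreover have "homog (?m + int N * 1) ?s"
      proof (intro homog_sum homog_const_mult)
        fix i assume i: "i \<in> ?C"
        then have "int i + int (D - i - N) = ?m + int N * 1" using D DN[OF i] by auto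
        then show "homog (?m + int N * 1) (u ^ i * v ^ (D - i - N))" using homog_uvN by metis
      qed
      ultimately show ?thesis using O_lineI[OF homog_uv(1)] by simp
    qed
    have M: "(\<Sum>i\<in>?M. ?m1 i) = u ^ (N - n) * v ^ (N - n) * (\<Sum>k<n. const (cc k) * ?e k)"
    proof -
      have "(\<Sum>i\<in>?M. ?m1 i) = (\<Sum>k<n. const (cc k) * (u ^ (N - 1 - k) * v ^ (N - n + k)))"
      proof (rule sum.reindex_bij_witness[of _ "\<lambda>k. N - 1 - k" "\<lambda>i. N - 1 - i"])
        fix i assume i: "i \<in> ?M"
        then have "D - i = N - n + (N - 1 - i)" "N - 1 - (N - 1 - i) = i" by (auto simp: D_def N_def)
        then show "const (cc (N - 1 - i)) * (u ^ (N - 1 - (N - 1 - i)) * v ^ (N - n + (N - 1 - i))) = ?m1 i"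
          by (simp only: cc_def)
      qed (auto simp: N_def)
      also have "\<dots> = (\<Sum>k<n. u ^ (N - n) * v ^ (N - n) * (const (cc k) * ?e k))"
      proof (rule sum.cong[OF refl])
        fix k assume "k \<in> {..<n}"
        then have "N - 1 - k = (N - n) + (n - 1 - k)" by (auto simp: N_def)
        then have "u ^ (N - 1 - k) = u ^ (N - n) * u ^ (n - 1 - k)" by (simp only: power_add)
        then show "const (cc k) * (u ^ (N - 1 - k) * v ^ (N - n + k)) = u ^ (N - n) * v ^ (N - n) * (const (cc k) * ?e k)"
          by (simp only: power_add ac_simps)
      qed
      finally show ?thesis by (simp only: sum_distrib_left)
    qed
    have W: "frv (vec1 (t - (\<Sum>i\<le>D. ?m1 i))) (w ^ N) \<in> snd (?O w)"
    proof (rule snd_w[OF _ expansion[OF ht]])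
      have "homog (int D) (t - (\<Sum>i\<le>D. ?m1 i))"
      proof (intro homog_diff ht homog_sum homog_const_mult)
        fix i assume "i \<in> {..D}"
        then have "int i + int (D - i) = int D" by auto
        then show "homog (int D) (u ^ i * v ^ (D - i))" using homog_uvN by metis
      qed
      then show "homog (?m + 2 * int N) (t - (\<Sum>i\<le>D. ?m1 i))" unfolding D .
    qed
    have nN: "n \<le> N" by (simp add: N_def)
    have "z - (\<Sum>k<n. kscale (cc k) (?b k)) = frv (vec1 (\<Sum>i\<in>?C. ?m1 i)) (w ^ N)
        + frv (vec1 (\<Sum>i\<in>?A. ?m1 i)) (w ^ N) + frv (vec1 (t - (\<Sum>i\<le>D. ?m1 i))) (w ^ N)"
    proof -
      have s1: "(\<Sum>k<n. kscale (cc k) (?b k)) = frv (vec1 (\<Sum>i\<in>?M. ?m1 i)) (w ^ N)"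
        unfolding sum1 M by (rule lift[OF nN])
      have gen: "t - y = x + s + (t - (s + x + y))" for s x y :: "'k R" by (simp add: algebra_simps)
      show ?thesis
        unfolding s1 z frv1_add[OF wnz] frv1_diff[OF wnz] sums by (rule arg_cong[OF gen])
    qed
    also have "\<dots> \<in> coboundaries L ?O" by (rule B(3)[OF C A W])
    finally have "H1_class ?O z = H1_class ?O (\<Sum>k<n. kscale (cc k) (?b k))"
      unfolding H1_class_def coset_eq_iff[OF B(1)] .
    then show "\<exists>cc. H1_class ?O z = H1_class ?O (\<Sum>k<n. kscale (cc k) (?b k))" by blast
  next
    fix cc k assume e: "H1_class ?O (\<Sum>k<n. kscale (cc k) (?b k)) = H1_class ?O 0" and k: "k < n"
    let ?s = "\<Sum>k<n. const (cc k) * ?e k"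
    have "frv (vec1 ?s) (w ^ n) \<in> coboundaries L ?O" using e unfolding sum1 H1_class_eq_0[OF wfO] .
    then obtain x y z where xyz: "frv (vec1 ?s) (w ^ n) = x + y + z" "x \<in> fst (?O u)" "y \<in> fst (?O v)" "z \<in> snd (?O w)"
      unfolding coboundaries_def by (auto elim!: set_plus_elim)
    obtain t j where t: "x = frv (vec1 t) (u ^ j)" using O_lineE[OF xyz(2) uv_nz(1) homog_uv(1)] .
    obtain t' i where t': "y = frv (vec1 t') (v ^ i)" using O_lineE[OF xyz(3) uv_nz(2) homog_uv(2)] .
    define N where "N = n + i + j"
    have N: "n \<le> N" "i \<le> N" "j \<le> N" by (simp_all add: N_def)
    have "z = frv (vec1 ?s) (w ^ n) - x - y" using xyz(1) by simp
    also have "\<dots> = frv (vec1 (u ^ (N - n) * v ^ (N - n) * ?s - v ^ N * (u ^ (N - j) * t) - u ^ N * (v ^ (N - i) * t'))) (w ^ N)"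
      unfolding lift[OF N(1)] t t' frv_uv[OF N(3)] frv_vu[OF N(2)] frv1_diff[OF wnz] ..
    finally have "\<alpha> dvd u ^ (N - n) * v ^ (N - n) * ?s - v ^ N * (u ^ (N - j) * t) - u ^ N * (v ^ (N - i) * t')"
      using xyz(4) O_w_zero by simp
    \<comment> \<open>This monomial has both exponents below \<open>N\<close>, so multiples of
      \<open>u ^ N\<close> and of \<open>v ^ N\<close> do not contribute, and only the coefficient
      \<open>cc k\<close> is left.\<close>
    then have "coef (N - n + (n - 1 - k)) (N - n + k)
        (u ^ (N - n) * v ^ (N - n) * ?s - v ^ N * (u ^ (N - j) * t) - u ^ N * (v ^ (N - i) * t')) = 0"
      using dvd_iff_coef by blast
    moreover have "coef (N - n + (n - 1 - k)) (N - n + k) (v ^ N * (u ^ (N - j) * t)) = 0"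
      using coef_mult(2)[of "N - n + (n - 1 - k)" 0 "N - n + k" N "u ^ (N - j) * t"] k N(1) by simp
    moreover have "coef (N - n + (n - 1 - k)) (N - n + k) (u ^ N * (v ^ (N - i) * t')) = 0"
      using coef_mult(2)[of "N - n + (n - 1 - k)" N "N - n + k" 0 "v ^ (N - i) * t'"] k N(1) by simp
    ultimately have "coef (n - 1 - k) k ?s = 0" unfolding coef_hom(2) coef_mult(1) by simp
    moreover have "coef (n - 1 - k) k ?s = (\<Sum>l<n. if l = k then cc l else 0)"
      unfolding coef_hom coef_const by (rule sum.cong) (use k in \<open>auto simp: coef_mon\<close>)
    ultimately show "cc k = 0" using k by simp
  qed
  then show ?thesis by (intro exI[of _ "map (\<lambda>k. H1_class ?O (?b k)) [0..<n]"]) simp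
qed

lemma H0_basis_nat: "\<exists>bs. ordered_basis (H0 L (OL m)) bs \<and> length bs = nat (m + 1)"
proof (cases "m < 0")
  case True
  have vs: "vectorspace class_ring (H0 L (OL m))" by (rule vs_image.vs[OF H0_vs_image[OF wfO]])
  interpret vectorspace class_ring "H0 L (OL m)" by (rule vs)
  have "ordered_basis (H0 L (OL m)) []"
    unfolding ordered_basis_iff[OF vs] H0_negative[OF True] comb_def by simp
  then show ?thesis using True by (intro exI[of _ "[]"]) simp
next
  case False
  then show ?thesis using H0_basis[of "nat m"] by (simp add: nat_add_distrib)
qed

end

section \<open>From the line to the arrangement\<close>

lemma line_coh_exists:
  fixes L :: "('k::field ^ 3) set"
  assumes L: "is_line L"
  obtains a b c p q r where "line_coh a b c p q r L"
proof -
  let ?c = "line_covec L" and ?Q = "\<lambda>(a, b). {x \<in> L. dot a x = 0 \<and> dot b x = 0} = {0}"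
  have Lc: "x \<in> L \<longleftrightarrow> dot ?c x = 0" for x using line_covec[OF L] by blast
  \<comment> \<open>Completing the equation of \<open>L\<close> shows that some pair meets the
    condition in \<open>line_coords\<close>; the pair chosen there therefore meets it and completes
    the equation to a frame.\<close>
  obtain a0 b0 where "\<And>x. dot a0 x = 0 \<Longrightarrow> dot b0 x = 0 \<Longrightarrow> dot ?c x = 0 \<Longrightarrow> x = 0"
    using frame_completion[OF line_covec_nz[OF L]] by blast
  then have "?Q (a0, b0)" using Lc by auto
  then have Q: "?Q (SOME p. ?Q p)" by (rule someI)
  obtain a b where ab: "(SOME p. ?Q p) = (a, b)" by fastforce
  have lc: "line_coords L = (linear_form a, linear_form b)"
    unfolding line_coords_def ab by simp
  have Qe: "{x \<in> L. dot a x = 0 \<and> dot b x = 0} = {0}" using Q unfolding ab prod.case .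
  have "\<exists>p q r. frame a b ?c p q r"
  proof (rule frame_exists[of a b ?c])
    fix x assume "dot a x = 0" "dot b x = 0" "dot ?c x = 0"
    then have "x \<in> {x \<in> L. dot a x = 0 \<and> dot b x = 0}" using Lc by simp
    then have "x \<in> {0}" unfolding Qe .
    then show "x = 0" by simp
  qed blast
  then obtain p q r where "frame a b ?c p q r" by blast
  then have "line_coh a b ?c p q r L"
    unfolding line_coh_def line_frame_def line_frame_axioms_def line_coh_axioms_def
    using L lc by (simp add: coord_u_def coord_v_def)
  then show ?thesis using that by blast
qed

text \<open>For the empty arrangement every point lies vacuously on all lines, so it suffices to
  exhibit a point.\<close>

lemma essential_nonempty: "essential A \<Longrightarrow> A \<noteq> ({} :: ('k::field ^ 3) set set)"
proof
  assume A: "essential A" "A = {}"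
  let ?e = "axis 1 1 :: 'k ^ 3"
  have "?e \<noteq> 0" by (simp add: axis_eq_0_iff)
  then have "vec.independent {?e}" by (subst vec.independent_insert) (simp add: vec.independent_empty)
  then have "vec.dim (vec.span {?e}) = 1" by (simp add: vec.dim_span_eq_card_independent)
  then have "is_point (vec.span {?e})" by (simp add: is_point_def)
  then show False using A by (auto simp: essential_def)
qed

text \<open>For exactly these \<open>i\<close> and \<open>j\<close> the sheaves
  \<open>O_line L i\<close> and \<open>O_line L j\<close> are isomorphic to image and kernel. The
  choices in \<open>alpha_map\<close> are therefore isomorphisms, and the exact sequence applies to
  them.\<close>

lemma alpha_map_properties:
  fixes A :: "('k::field_char_0 ^ 3) set set"
  assumes "arrangement A" "essential A" "is_line L" "L \<notin> A"
    and i: "i = der_twist A - 1 + int (card (restriction A L)) - int (card A)"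
    and j: "j = der_twist A - int (card (restriction A L))"
  shows "alpha_map A L i j \<in> module_hom class_ring (H0 L (O_line L i)) (H1 L (O_line L j))"
    "L \<in> jump_lines A \<longleftrightarrow> carrier (H0 L (O_line L j)) \<noteq> {zero (H0 L (O_line L j))} \<or>
      (\<exists>X\<in>carrier (H0 L (O_line L i)). X \<noteq> zero (H0 L (O_line L i)) \<and> alpha_map A L i j X = zero (H1 L (O_line L j)))"
proof -
  obtain a b c p q r where "line_coh a b c p q r L" using line_coh_exists[OF assms(3)] .
  then interpret line_coh a b c p q r L .
  interpret arr_frame a b c p q r L A
    by unfold_locales (use assms essential_nonempty in auto)
  let ?E = "der_on_line L A (der_twist A - 1)" and ?G = "der_on_line L (insert L A) (der_twist A)"
  let ?f = "(*s) (Fract \<alpha> 1) :: 'k R fract ^ 3 \<Rightarrow> 'k R fract ^ 3"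
  define \<psi> where "\<psi> = (SOME \<psi>. sheaf_iso (O_line L i) (image_sheaf ?f ?E ?G) \<psi>)"
  define \<phi> where "\<phi> = (SOME \<phi>. sheaf_iso (kernel_sheaf ?f ?E ?G) (O_line L j) \<phi>)"
  \<comment> \<open>Multiplication by \<open>\<alpha>\<close> has degree one, so the target carries
    one twist more than the source.\<close>
  have tw: "der_twist A - 1 + 1 = der_twist A" by simp
  note im = image_corr[of "der_twist A - 1", unfolded tw i[symmetric]]
    and ker = kernel_corr[of "der_twist A - 1", unfolded tw j[symmetric]]
  have "\<exists>\<psi>. sheaf_iso (O_line L i) (image_sheaf ?f ?E ?G) \<psi>"
    using im(1) corr_iso[OF _ wf_O_line im(2)] by blast
  then have \<psi>: "sheaf_iso (O_line L i) (image_sheaf ?f ?E ?G) \<psi>" unfolding \<psi>_def by (rule someI_ex)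
  have "\<exists>\<phi>. sheaf_iso (kernel_sheaf ?f ?E ?G) (O_line L j) \<phi>"
    using ker(1) corr_iso[OF _ ker(2) wf_O_line] by blast
  then have \<phi>: "sheaf_iso (kernel_sheaf ?f ?E ?G) (O_line L j) \<phi>" unfolding \<phi>_def by (rule someI_ex)
  interpret S: connecting_setup L ?E ?G "Fract \<alpha> 1" "O_line L i" "O_line L j" \<psi> \<phi>
    by unfold_locales (intro wf_der arr arr_insert wf_O_line im(2) ker(2) \<psi> \<phi>)+
  have al: "alpha_map A L i j = S.alpha"
    unfolding S.alpha_def unfolding alpha_map_def Let_def line_form_L \<psi>_def \<phi>_def by (rule refl)
  show "alpha_map A L i j \<in> module_hom class_ring (H0 L (O_line L i)) (H1 L (O_line L j))"
    unfolding al by (rule S.alpha_hom)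
  have "L \<in> jump_lines A \<longleftrightarrow> carrier (H0 L ?E) \<noteq> {zero (H0 L ?E)}"
    using assms(3) by (simp add: jump_lines_def)
  then show "L \<in> jump_lines A \<longleftrightarrow> carrier (H0 L (O_line L j)) \<noteq> {zero (H0 L (O_line L j))} \<or>
      (\<exists>X\<in>carrier (H0 L (O_line L i)). X \<noteq> zero (H0 L (O_line L i)) \<and> alpha_map A L i j X = zero (H1 L (O_line L j)))"
    unfolding al S.nontrivial_iff .
qed

lemma O_line_cohomology:
  fixes L :: "('k::field ^ 3) set"
  assumes "is_line L"
  shows "vectorspace class_ring (H0 L (O_line L m))" "vectorspace class_ring (H1 L (O_line L m))"
    "\<exists>bs. ordered_basis (H0 L (O_line L m)) bs \<and> length bs = nat (m + 1)"
    "m < 0 \<Longrightarrow> \<exists>bs. ordered_basis (H1 L (O_line L m)) bs \<and> length bs = nat (- m - 1)"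
    "carrier (H0 L (O_line L m)) \<noteq> {zero (H0 L (O_line L m))} \<longleftrightarrow> m \<ge> 0"
proof -
  obtain a b c p q r where "line_coh a b c p q r L" using line_coh_exists[OF assms] .
  then interpret line_coh a b c p q r L .
  show "vectorspace class_ring (H0 L (O_line L m))" by (rule vs_image.vs[OF H0_vs_image[OF wfO]])
  show "vectorspace class_ring (H1 L (O_line L m))" by (rule vs_image.vs[OF H1_vs_image[OF wfO]])
  show "\<exists>bs. ordered_basis (H0 L (O_line L m)) bs \<and> length bs = nat (m + 1)" by (rule H0_basis_nat)
  show "\<exists>bs. ordered_basis (H1 L (O_line L m)) bs \<and> length bs = nat (- m - 1)" if "m < 0"
    using H1_basis[of "nat (- m - 1)"] that by simp
  show "carrier (H0 L (O_line L m)) \<noteq> {zero (H0 L (O_line L m))} \<longleftrightarrow> m \<ge> 0"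
    using H0_nonneg[of m] H0_negative[of m] by fastforce
qed

theorem theorem4p9:
  fixes A :: "('k::field_char_0 ^ 3) set set" and L :: "('k ^ 3) set" and d s :: int
  assumes "arrangement A" and "essential A"
    and "is_line L" and "L \<notin> A"
    and "d = int (card A)"
    and "s = int (card (restriction A L))"
  shows
    "(odd d \<longrightarrow>
       (L \<in> jump_lines A \<longleftrightarrow>
          (d - 1) div 2 \<ge> s \<or>
          map_det (H0 L (O_line L (s - (d + 3) div 2))) (H1 L (O_line L ((d - 1) div 2 - s)))
            (alpha_map A L (s - (d + 3) div 2) ((d - 1) div 2 - s)) = 0)) \<and>
     (even d \<longrightarrow>
       (L \<in> jump_lines A \<longleftrightarrow>
          (d - 2) div 2 \<ge> s \<or>
          int (map_rank (H0 L (O_line L (s - (d + 4) div 2))) (H1 L (O_line L ((d - 2) div 2 - s)))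
            (alpha_map A L (s - (d + 4) div 2) ((d - 2) div 2 - s))) \<le> s - (d + 4) div 2))"
proof (intro conjI impI)
  note coh = O_line_cohomology[OF assms(3)]
  assume "odd d"
  then obtain k where k: "d = 2 * k + 1" by (elim oddE)
  let ?i = "s - (d + 3) div 2" and ?j = "(d - 1) div 2 - s"
  have ij: "?i = s - k - 2" "?j = k - s" "(d - 1) div 2 = k" unfolding k by simp_all
  have tw: "der_twist A = k" unfolding der_twist_def assms(5)[symmetric] k norm_twist_def by simp
  have i: "?i = der_twist A - 1 + int (card (restriction A L)) - int (card A)"
    and j: "?j = der_twist A - int (card (restriction A L))"
    unfolding tw ij(1,2) assms(5,6)[symmetric] k by simp_all
  note al = alpha_map_properties[OF assms(1-4) i j]
  show "L \<in> jump_lines A \<longleftrightarrow> (d - 1) div 2 \<ge> s \<or>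
      map_det (H0 L (O_line L ?i)) (H1 L (O_line L ?j)) (alpha_map A L ?i ?j) = 0"
  proof (cases "s \<le> k")
    case True
    \<comment> \<open>Here \<open>?j \<ge> 0\<close>, so the kernel bundle has a nonzero section and
      both sides hold.\<close>
    then show ?thesis unfolding al(2) coh(5) by (simp add: ij)
  next
    case False
    then have neg: "?j < 0" by (simp add: ij)
    obtain bs where bs: "ordered_basis (H0 L (O_line L ?i)) bs" "length bs = nat (?i + 1)" using coh(3) by blast
    obtain cs where cs: "ordered_basis (H1 L (O_line L ?j)) cs" "length cs = nat (- ?j - 1)" using coh(4)[OF neg] by blast
    \<comment> \<open>Both lengths are \<open>nat (s - k - 1)\<close>, so for odd \<open>d\<close>
      the matrix is square. For \<open>s = k + 1\<close> both spaces are zero and no nonzero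
      \<open>X\<close> exists, in accordance with determinant \<open>1\<close>.\<close>
    have "length bs = length cs" unfolding bs(2) cs(2) ij by simp
    then have "map_det (H0 L (O_line L ?i)) (H1 L (O_line L ?j)) (alpha_map A L ?i ?j) = 0 \<longleftrightarrow>
      (\<exists>X\<in>carrier (H0 L (O_line L ?i)). X \<noteq> zero (H0 L (O_line L ?i)) \<and> alpha_map A L ?i ?j X = zero (H1 L (O_line L ?j)))"
      by (rule map_det_eq_0_iff[OF coh(1,2) al(1) bs(1) cs(1)])
    then show ?thesis unfolding al(2) coh(5) using neg False ij(3) by auto
  qed
next
  note coh = O_line_cohomology[OF assms(3)]
  assume "even d"
  then obtain k where k: "d = 2 * k" by (elim evenE)
  let ?i = "s - (d + 4) div 2" and ?j = "(d - 2) div 2 - s"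
  have ij: "?i = s - k - 2" "?j = k - 1 - s" "(d - 2) div 2 = k - 1" unfolding k by simp_all
  have tw: "der_twist A = k - 1" unfolding der_twist_def assms(5)[symmetric] k norm_twist_def by simp
  have i: "?i = der_twist A - 1 + int (card (restriction A L)) - int (card A)"
    and j: "?j = der_twist A - int (card (restriction A L))"
    unfolding tw ij(1,2) assms(5,6)[symmetric] k by simp_all
  note al = alpha_map_properties[OF assms(1-4) i j]
  let ?rk = "map_rank (H0 L (O_line L ?i)) (H1 L (O_line L ?j)) (alpha_map A L ?i ?j)"
  obtain bs where bs: "ordered_basis (H0 L (O_line L ?i)) bs" "length bs = nat (?i + 1)" using coh(3) by blast
  \<comment> \<open>The source has dimension \<open>?i + 1\<close>, so the bound on the rank says
    that \<open>alpha_map\<close> is not injective. For \<open>?i < 0\<close> the dimension is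
    \<open>0\<close> and both inequalities fail.\<close>
  have "int ?rk \<le> ?i \<longleftrightarrow> ?rk < length bs" unfolding bs(2) by linarith
  also have "\<dots> \<longleftrightarrow>
      (\<exists>X\<in>carrier (H0 L (O_line L ?i)). X \<noteq> zero (H0 L (O_line L ?i)) \<and> alpha_map A L ?i ?j X = zero (H1 L (O_line L ?j)))"
    by (rule map_rank_less_iff[OF coh(1,2) al(1) bs(1)])
  finally show "L \<in> jump_lines A \<longleftrightarrow> (d - 2) div 2 \<ge> s \<or> int ?rk \<le> ?i"
    unfolding al(2) coh(5) by simp
qed

end
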